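(* Let $\{f_\theta(x,y):\theta\in\Theta\}$, where $\Theta\subset\mathbb{R}^d$, be a family of densities with respect to a $\sigma$-finite measure $\mu\times\nu$ on $\mathcal{X}\times\mathcal{Y}$. Let $X_1,X_2,\ldots$ be i.i.d. from a probability distribution $P$ that has a density $h$ with respect to $\mu$, and let $Y_1,Y_2,\ldots$ be i.i.d. from a probability distribution $Q$ that has a density $g$ with respect to $\nu$, the sequence $(X_i)$ being independent of the sequence $(Y_j)$. Suppose: (1) second partial derivatives of $f_\theta(x,y)$ with respect to $\theta$ exist and are continuous on $\Theta$ for all $x$ and $y$, and may be passed under the integral sign in $\int f_\theta(x\mid y)\,d\mu(x)$; (2) $\mathcal{Y}$ is a separable metric space and $y\mapsto\nabla f_{\theta^*}(x\mid y)$ is continuous for each $x$; (3) there is an interior point $\theta^*$ of $\Theta$ such that $Q\nabla\log f_{\theta^*}(Y)=0$, $V=\operatorname{var}_Q\nabla\log f_{\theta^*}(Y)$ is finite and $J=-Q\nabla^2\log f_{\theta^*}(Y)$ is finite and nonsingular; (4) there exists a $\rho>0$ such that $S_\rho=\{\theta:|\theta-\theta^*|\le\rho\}$ is contained in $\Theta$ and $\mathcal{F}_1=\{\nabla^2\log f_\theta(\cdot):\theta\in S_\rho\}$ is $Q$-Glivenko–Cantelli; (5) $\mathcal{F}_2=\{f_{\theta^*}(\cdot\mid y)/h(\cdot):y\in\mathcal{Y}\}$ is $P$-Glivenko–Cantelli; (6) $\mathcal{F}_3=\{\nabla f_{\theta^*}(\cdot\mid y)/h(\cdot):y\in\mathcal{Y}\}$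 is $P$-Donsker and its envelope function $F$ has a finite second moment; (7) $\mathcal{F}_4=\{\nabla^2 f_\theta(\cdot\mid y)/h(\cdot):y\in\mathcal{Y},\ \theta\in S_\rho\}$ is $P$-Glivenko–Cantelli; (8) there is a sequence $\hat\theta_{m,n}$ which converges to $\theta^*$ in probability (as $m,n\to\infty$) such that $\sqrt{\min(m,n)}\,\nabla K_{m,n}(\hat\theta_{m,n})\to0$ in probability as $m,n\to\infty$. Then $$W=\operatorname{var}_P\, Q\,\nabla f_{\theta^*}(X\mid Y)/h(X)$$ is finite and $$\Big(\frac{V}{n}+\frac{W}{m}\Big)^{-1/2}J(\hat\theta_{m,n}-\theta^* )\longrightarrow\mathcal{N}(0,I)\quad\text{in distribution as } m,n\to\infty.$$
   Context: Notation. $\nabla$ and $\nabla^2$ denote first and second derivatives with respect to $\theta$. $P$ and $Q$ also denote expectation operators: $P$ integrates over $X\sim P$ (with everything else held fixed) and $Q$ integrates over $Y\sim Q$. $\mathbb{P}_m$ and $\mathbb{Q}_n$ are the empirical measures of $X_1,\ldots,X_m$ and $Y_1,\ldots,Y_n$, also used as expectation operators. Thus $Q\nabla f_{\theta^*}(X\mid Y)/h(X)$ is the function of $X$ obtained by averaging $\nabla f_{\theta^*}(X\mid Y)/h(X)$ over $Y\sim Q$ with $X$ fixed, and $W$ is its covariance matrix under $X\sim P$. Marginal and conditional densities: $f_\theta(y)=\int f_\theta(x,y)\,d\mu(x)$, $f_\theta(x\mid y)=f_\theta(x,y)/f_\theta(y)$. The importance sampling density $h$ is such that $P f_\theta(X,y)/h(X)=f_\theta(y)$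 for each $\theta$ and $y$. Put $f_{\theta,m}(y)=\frac1m\sum_{i=1}^m f_\theta(X_i,y)/h(X_i)$ and $$K_{m,n}(\theta)=\mathbb{Q}_n\log\frac{g(Y)}{f_{\theta,m}(Y)}=\frac1n\sum_{j=1}^n\log\frac{g(Y_j)}{f_{\theta,m}(Y_j)}.$$ A family $\mathcal{F}$ of real functions is $P$-Glivenko–Cantelli if $\sup_{f\in\mathcal{F}}|\mathbb{P}_mf-Pf|\to0$ outer almost surely as $m\to\infty$ (and $Q$-Glivenko–Cantelli with $\mathbb{Q}_n,Q$ in place of $\mathbb{P}_m,P$); it is $P$-Donsker if $\sqrt m(\mathbb{P}_m-P)$ converges weakly (in the Hoffmann-Jørgensen sense) in $\ell^\infty(\mathcal{F})$ to a tight Borel measurable (Gaussian) limit. Families of vector- or matrix-valued functions are Glivenko–Cantelli or Donsker if each component family is. An envelope function of a family bounds (componentwise) the absolute values of all its members. Limits "as $m,n\to\infty$" mean that both $m$ and $n$ go to infinity simultaneously, with no restriction on how they do so.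
   Formalization: The convergence in distribution is stated only for nonsingular V and W; otherwise (V/n+W/m)^(-1/2) may be undefined or, since (8) only controls errors at rate 1/√min(m,n), the claim fails (e.g. W=0, n=m²). Finiteness of W is unconditional. *)

theory Defs
  imports "HOL-Probability.Probability"
begin

section \<open>Derivatives with respect to the parameter\<close>

definition partial_deriv :: "'d::finite \<Rightarrow> (real ^ 'd \<Rightarrow> real) \<Rightarrow> real ^ 'd \<Rightarrow> real" where
  "partial_deriv i u \<theta> = deriv (\<lambda>t. u (\<theta> + t *\<^sub>R axis i 1)) 0"

definition has_partial_deriv :: "'d::finite \<Rightarrow> (real ^ 'd \<Rightarrow> real) \<Rightarrow> real ^ 'd \<Rightarrow> bool" where
  "has_partial_deriv i u \<theta> \<longleftrightarrow> (\<lambda>t. u (\<theta> + t *\<^sub>R axis i 1)) differentiable (at 0)"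

definition grad :: "(real ^ 'd::finite \<Rightarrow> real) \<Rightarrow> real ^ 'd \<Rightarrow> real ^ 'd" where
  "grad u \<theta> = (\<chi> i. partial_deriv i u \<theta>)"

definition hess :: "(real ^ 'd::finite \<Rightarrow> real) \<Rightarrow> real ^ 'd \<Rightarrow> real ^ 'd ^ 'd" where
  "hess u \<theta> = (\<chi> i j. partial_deriv i (partial_deriv j u) \<theta>)"

definition second_partials_exist_on :: "(real ^ 'd::finite \<Rightarrow> real) \<Rightarrow> (real ^ 'd) set \<Rightarrow> bool" where
  "second_partials_exist_on u S \<longleftrightarrow>
     (\<forall>\<theta>\<in>S. \<forall>i j. has_partial_deriv j u \<theta> \<and> has_partial_deriv i (partial_deriv j u) \<theta>)"

text \<open>\<^const>\<open>deriv\<close> is two-sided and carries no information where the derivative does not exist,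
  so derivatives are meaningful only at interior points of the parameter set.\<close>

text \<open>Derivatives up to order two may be passed under the integral sign in
  \<^term>\<open>\<integral>x. u \<theta> x \<partial>N\<close>, for \<^term>\<open>\<theta> \<in> S\<close>.\<close>

definition second_partials_under_integral ::
  "'x measure \<Rightarrow> (real ^ 'd::finite \<Rightarrow> 'x \<Rightarrow> real) \<Rightarrow> (real ^ 'd) set \<Rightarrow> bool" where
  "second_partials_under_integral N u S \<longleftrightarrow>
     (\<forall>x\<in>space N. second_partials_exist_on (\<lambda>\<theta>. u \<theta> x) S) \<and>
     second_partials_exist_on (\<lambda>\<theta>. \<integral>x. u \<theta> x \<partial>N) S \<and>
     (\<forall>\<theta>\<in>S.
        integrable N (\<lambda>x. grad (\<lambda>\<theta>. u \<theta> x) \<theta>) \<and>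
        grad (\<lambda>\<theta>. \<integral>x. u \<theta> x \<partial>N) \<theta> = (\<integral>x. grad (\<lambda>\<theta>. u \<theta> x) \<theta> \<partial>N) \<and>
        integrable N (\<lambda>x. hess (\<lambda>\<theta>. u \<theta> x) \<theta>) \<and>
        hess (\<lambda>\<theta>. \<integral>x. u \<theta> x \<partial>N) \<theta> = (\<integral>x. hess (\<lambda>\<theta>. u \<theta> x) \<theta> \<partial>N))"


section \<open>Densities\<close>

definition is_prob_density :: "'a measure \<Rightarrow> ('a \<Rightarrow> real) \<Rightarrow> bool" where
  "is_prob_density N u \<longleftrightarrow>
     u \<in> borel_measurable N \<and> (\<forall>x\<in>space N. 0 \<le> u x) \<and> (\<integral>\<^sup>+ x. ennreal (u x) \<partial>N) = 1"

definition marg_density :: "'x measure \<Rightarrow> ('t \<Rightarrow> 'x \<Rightarrow> 'y \<Rightarrow> real) \<Rightarrow> 't \<Rightarrow> 'y \<Rightarrow> real" where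
  "marg_density \<mu> f \<theta> y = (\<integral>x. f \<theta> x y \<partial>\<mu>)"

definition cond_density :: "'x measure \<Rightarrow> ('t \<Rightarrow> 'x \<Rightarrow> 'y \<Rightarrow> real) \<Rightarrow> 't \<Rightarrow> 'x \<Rightarrow> 'y \<Rightarrow> real" where
  "cond_density \<mu> f \<theta> x y = f \<theta> x y / marg_density \<mu> f \<theta> y"


section \<open>Empirical measures, Glivenko--Cantelli and Donsker families\<close>

text \<open>Samples are indexed from 0: the first \<open>m\<close> observations are \<open>x 0, \<dots>, x (m - 1)\<close>.\<close>

definition empirical :: "(nat \<Rightarrow> 'x) \<Rightarrow> nat \<Rightarrow> ('x \<Rightarrow> real) \<Rightarrow> real" where
  "empirical x m \<phi> = (\<Sum>i<m. \<phi> (x i)) / real m"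

text \<open>The canonical i.i.d. sample: the coordinate projections of the infinite product space.\<close>

abbreviation iid_space :: "'x measure \<Rightarrow> (nat \<Rightarrow> 'x) measure" where
  "iid_space P \<equiv> Pi\<^sub>M UNIV (\<lambda>_. P)"

text \<open>Outer almost sure convergence to 0 of possibly non-measurable maps: they have measurable
  majorants (equivalently, their measurable covers) that converge to 0 almost surely.\<close>

definition outer_AS_tendsto_0 :: "'w measure \<Rightarrow> (nat \<Rightarrow> 'w \<Rightarrow> ennreal) \<Rightarrow> bool" where
  "outer_AS_tendsto_0 M Z \<longleftrightarrow>
     (\<exists>\<Delta>. (\<forall>m. \<Delta> m \<in> borel_measurable M) \<and> (\<forall>m. \<forall>\<omega>\<in>space M. Z m \<omega> \<le> \<Delta> m \<omega>) \<and>
          (AE \<omega> in M. (\<lambda>m. \<Delta> m \<omega>) \<longlonglongrightarrow> 0))"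

definition glivenko_cantelli :: "'x measure \<Rightarrow> ('x \<Rightarrow> real) set \<Rightarrow> bool" where
  "glivenko_cantelli P F \<longleftrightarrow>
     (\<forall>\<phi>\<in>F. integrable P \<phi>) \<and>
     outer_AS_tendsto_0 (iid_space P)
       (\<lambda>m x. SUP \<phi>\<in>F. ennreal \<bar>empirical x m \<phi> - (\<integral>z. \<phi> z \<partial>P)\<bar>)"

definition glivenko_cantelli_mat :: "'x measure \<Rightarrow> ('x \<Rightarrow> real ^ 'd ^ 'e) set \<Rightarrow> bool" where
  "glivenko_cantelli_mat P F \<longleftrightarrow> (\<forall>i j. glivenko_cantelli P ((\<lambda>\<phi> x. \<phi> x $ i $ j) ` F))"

text \<open>The space of bounded real functions on \<open>F\<close> with the supremum metric.\<close>

abbreviation linfty :: "'i set \<Rightarrow> ('i \<Rightarrow> real) metric" where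
  "linfty F \<equiv> funspace F euclidean_metric"

definition borel_of_top :: "'a topology \<Rightarrow> 'a measure" where
  "borel_of_top T = sigma (topspace T) {U. openin T U}"

definition tight_prob_on :: "'a topology \<Rightarrow> 'a measure \<Rightarrow> bool" where
  "tight_prob_on T L \<longleftrightarrow>
     prob_space L \<and> sets L = sets (borel_of_top T) \<and>
     (\<forall>\<epsilon>>0. \<exists>K. compactin T K \<and> K \<in> sets L \<and> measure L K \<ge> 1 - \<epsilon>)"

text \<open>Outer expectation of a bounded, possibly non-measurable function.\<close>

definition outer_expectation :: "'w measure \<Rightarrow> ('w \<Rightarrow> real) \<Rightarrow> real" where
  "outer_expectation M T =
     Inf {integral\<^sup>L M U | U. integrable M U \<and> (\<forall>\<omega>\<in>space M. T \<omega> \<le> U \<omega>)}"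

text \<open>Weak convergence in the sense of Hoffmann-Jorgensen.\<close>

definition HJ_weak_conv :: "'w measure \<Rightarrow> 'a topology \<Rightarrow> (nat \<Rightarrow> 'w \<Rightarrow> 'a) \<Rightarrow> 'a measure \<Rightarrow> bool" where
  "HJ_weak_conv M T G L \<longleftrightarrow>
     (\<forall>H. continuous_map T euclideanreal H \<longrightarrow> bounded (H ` topspace T) \<longrightarrow>
        (\<lambda>m. outer_expectation M (\<lambda>\<omega>. H (G m \<omega>))) \<longlonglongrightarrow> (\<integral>z. H z \<partial>L))"

definition empirical_process ::
  "'x measure \<Rightarrow> ('x \<Rightarrow> real) set \<Rightarrow> nat \<Rightarrow> (nat \<Rightarrow> 'x) \<Rightarrow> ('x \<Rightarrow> real) \<Rightarrow> real" where
  "empirical_process P F m x = (\<lambda>\<phi>\<in>F. sqrt (real m) * (empirical x m \<phi> - (\<integral>z. \<phi> z \<partial>P)))"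

definition donsker :: "'x measure \<Rightarrow> ('x \<Rightarrow> real) set \<Rightarrow> bool" where
  "donsker P F \<longleftrightarrow>
     (\<forall>\<phi>\<in>F. integrable P \<phi>) \<and>
     (\<forall>m. \<forall>x\<in>space (iid_space P). empirical_process P F m x \<in> mspace (linfty F)) \<and>
     (\<exists>L. tight_prob_on (mtopology_of (linfty F)) L \<and>
          HJ_weak_conv (iid_space P) (mtopology_of (linfty F)) (empirical_process P F) L)"

definition donsker_vec :: "'x measure \<Rightarrow> ('x \<Rightarrow> real ^ 'd) set \<Rightarrow> bool" where
  "donsker_vec P F \<longleftrightarrow> (\<forall>i. donsker P ((\<lambda>\<phi> x. \<phi> x $ i) ` F))"

definition envelope_vec :: "'x measure \<Rightarrow> ('x \<Rightarrow> real ^ 'd) set \<Rightarrow> ('x \<Rightarrow> real ^ 'd) \<Rightarrow> bool" where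
  "envelope_vec P F E \<longleftrightarrow> (\<forall>\<phi>\<in>F. \<forall>x\<in>space P. \<forall>i. \<bar>\<phi> x $ i\<bar> \<le> E x $ i)"


section \<open>Random vectors\<close>

text \<open>On a probability space, finiteness of the covariance matrix of \<open>Z\<close> amounts to this.\<close>

definition finite_second_moment :: "'w measure \<Rightarrow> ('w \<Rightarrow> real ^ 'd) \<Rightarrow> bool" where
  "finite_second_moment M Z \<longleftrightarrow>
     (\<forall>i. (\<lambda>\<omega>. Z \<omega> $ i) \<in> borel_measurable M \<and> integrable M (\<lambda>\<omega>. (Z \<omega> $ i)\<^sup>2))"

definition cov_matrix :: "'w measure \<Rightarrow> ('w \<Rightarrow> real ^ 'd) \<Rightarrow> real ^ 'd ^ 'd" where
  "cov_matrix M Z =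
     (\<chi> i j. \<integral>\<omega>. (Z \<omega> $ i - (\<integral>\<omega>'. Z \<omega>' $ i \<partial>M)) * (Z \<omega> $ j - (\<integral>\<omega>'. Z \<omega>' $ j \<partial>M)) \<partial>M)"

definition iid_seq :: "'w measure \<Rightarrow> 'a measure \<Rightarrow> (nat \<Rightarrow> 'w \<Rightarrow> 'a) \<Rightarrow> bool" where
  "iid_seq M N X \<longleftrightarrow> prob_space.indep_vars M (\<lambda>_. N) X UNIV \<and> (\<forall>i. distr M N (X i) = N)"

text \<open>The library's \<^const>\<open>prob_space.indep_var\<close> needs both variables to have values in the same
  type, hence this version.\<close>

definition indep_rvs ::
  "'w measure \<Rightarrow> 'a measure \<Rightarrow> ('w \<Rightarrow> 'a) \<Rightarrow> 'b measure \<Rightarrow> ('w \<Rightarrow> 'b) \<Rightarrow> bool" where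
  "indep_rvs M N1 Z1 N2 Z2 \<longleftrightarrow>
     Z1 \<in> measurable M N1 \<and> Z2 \<in> measurable M N2 \<and>
     prob_space.indep_set M {Z1 -` A \<inter> space M | A. A \<in> sets N1} {Z2 -` B \<inter> space M | B. B \<in> sets N2}"

text \<open>Convergence in probability along a filter; the outer measure makes the notion meaningful
  without measurability of \<open>Z k\<close> and agrees with the usual one for random variables.\<close>

definition tendsto_in_prob ::
  "'w measure \<Rightarrow> ('k \<Rightarrow> 'w \<Rightarrow> 'b::metric_space) \<Rightarrow> 'b \<Rightarrow> 'k filter \<Rightarrow> bool" where
  "tendsto_in_prob M Z c A \<longleftrightarrow>
     (\<forall>\<epsilon>>0. ((\<lambda>k. outer_measure_of M {\<omega> \<in> space M. dist (Z k \<omega>) c > \<epsilon>}) \<longlongrightarrow> 0) A)"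

definition tendsto_in_distr ::
  "'w measure \<Rightarrow> ('k \<Rightarrow> 'w \<Rightarrow> 'b::topological_space) \<Rightarrow> 'b measure \<Rightarrow> 'k filter \<Rightarrow> bool" where
  "tendsto_in_distr M Z L A \<longleftrightarrow>
     (\<forall>k. Z k \<in> borel_measurable M) \<and>
     (\<forall>H :: 'b \<Rightarrow> real. continuous_on UNIV H \<longrightarrow> bounded (range H) \<longrightarrow>
        ((\<lambda>k. \<integral>\<omega>. H (Z k \<omega>) \<partial>M) \<longlongrightarrow> (\<integral>z. H z \<partial>L)) A)"

text \<open>The distribution $N(0, I)$.\<close>

definition std_normal_vec :: "(real ^ 'd::finite) measure" where
  "std_normal_vec =
     density lborel (\<lambda>z. ennreal (exp (- (norm z)\<^sup>2 / 2) / sqrt (2 * pi) ^ CARD('d)))"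

definition pos_def :: "real ^ 'd ^ 'd \<Rightarrow> bool" where
  "pos_def A \<longleftrightarrow> transpose A = A \<and> (\<forall>v. v \<noteq> 0 \<longrightarrow> v \<bullet> (A *v v) > 0)"

text \<open>The symmetric positive definite inverse square root; meaningful only if \<open>A\<close> is itself
  positive definite.\<close>

definition inv_sqrt_matrix :: "real ^ 'd ^ 'd \<Rightarrow> real ^ 'd ^ 'd" where
  "inv_sqrt_matrix A = (THE B. pos_def B \<and> B ** B = matrix_inv A)"


section \<open>The Monte Carlo approximation\<close>

definition mc_density ::
  "('t \<Rightarrow> 'x \<Rightarrow> 'y \<Rightarrow> real) \<Rightarrow> ('x \<Rightarrow> real) \<Rightarrow> (nat \<Rightarrow> 'x) \<Rightarrow> nat \<Rightarrow> 't \<Rightarrow> 'y \<Rightarrow> real" where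
  "mc_density f h x m \<theta> y = empirical x m (\<lambda>x'. f \<theta> x' y / h x')"

definition mc_KL ::
  "('t \<Rightarrow> 'x \<Rightarrow> 'y \<Rightarrow> real) \<Rightarrow> ('x \<Rightarrow> real) \<Rightarrow> ('y \<Rightarrow> real) \<Rightarrow> (nat \<Rightarrow> 'x) \<Rightarrow> (nat \<Rightarrow> 'y) \<Rightarrow>
     nat \<Rightarrow> nat \<Rightarrow> 't \<Rightarrow> real" where
  "mc_KL f h g x y m n \<theta> = empirical y n (\<lambda>y'. ln (g y' / mc_density f h x m \<theta> y'))"

end

theory Submission
  imports Defs
begin

text \<open>Write \<open>a\<^sub>m(\<theta>, y)\<close> for the average of \<open>f\<^sub>\<theta>(x | y) / h(x)\<close> over the first \<open>m\<close> draws from \<open>P\<close>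
  (\<open>ratio\<close>). The Monte Carlo density is the true marginal density times this ratio
  (\<open>mc_density_eq\<close>), so the criterion splits as \<open>K\<^sub>m\<^sub>n(\<theta>) = const - Q\<^sub>n ln f\<^sub>\<theta>(Y) - Q\<^sub>n ln
  a\<^sub>m(\<theta>, Y)\<close>: the negative log likelihood, and an error term that depends on both samples
  (\<open>mc_KL_partials\<close>). Importance sampling makes the ratio have mean 1 for every \<open>\<theta>\<close>, hence
  gradient and Hessian of mean 0 (\<open>mean_ratio\<close>, \<open>mean_ratio_grad\<close>, \<open>mean_ratio_hess\<close>). By the
  two Glivenko--Cantelli hypotheses under \<open>P\<close>, the ratio is close to 1 at \<open>\<theta>\<^sup>*\<close> and its Hessian
  is close to 0 near \<open>\<theta>\<^sup>*\<close>, uniformly in \<open>y\<close>; the Donsker hypothesis makes its gradient at \<open>\<theta>\<^sup>*\<close>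
  uniformly of order \<open>1 / sqrt m\<close>.

  Consequently the Hessian of \<open>K\<^sub>m\<^sub>n\<close> is close to \<open>J\<close> near \<open>\<theta>\<^sup>*\<close>: the contribution of the ratio
  is negligible (\<open>ratio_bounds\<close>), and \<open>Q\<^sub>n \<nabla>\<^sup>2 ln f\<^sub>\<theta>(Y)\<close> is uniformly close to its mean, which
  is continuous at \<open>\<theta>\<^sup>*\<close> (\<open>mean_log_marg_hess_cont\<close>). Continuity of \<open>\<nabla>\<^sup>2 ln f\<^sub>\<theta>(y)\<close> itself has
  to be proved; it holds because, for one fixed favourable sample, the marginal density is the
  Monte Carlo density, which is twice continuously differentiable, divided by a ratio whose
  Hessian is as small as desired (\<open>log_marg_hess_isCont\<close>).

  The gradient of \<open>K\<^sub>m\<^sub>n\<close> at \<open>\<theta>\<^sup>*\<close> is \<open>- Q\<^sub>n \<psi> - Q\<^sub>n (\<nabla> a\<^sub>m / a\<^sub>m)\<close>, where \<open>\<psi>\<close> is the score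
  \<open>\<nabla> ln f\<^sub>\<theta>\<close> at \<open>\<theta>\<^sup>*\<close>. Dividing by \<open>a\<^sub>m\<close> changes little. The key point is that \<open>Q\<^sub>n\<close> may be
  replaced by \<open>Q\<close> in the second term with an error \<open>o(1 / sqrt m)\<close>, although the averaged
  function is itself random (\<open>ratio_grad_equicontinuity\<close>): asymptotic tightness confines the
  process \<open>y \<mapsto> sqrt m \<nabla> a\<^sub>m(\<theta>\<^sup>*, y)\<close> to small balls around finitely many functions of \<open>y\<close>, which
  may be chosen among realised paths of the process (\<open>donsker_finite_net\<close>), hence continuous and
  bounded, and the weak law of large numbers applies to each of them. Averaging over \<open>Q\<close> first
  turns \<open>\<nabla> a\<^sub>m(\<theta>\<^sup>*, \<cdot>)\<close> into the average of \<open>mean_score\<close> over the draws from \<open>P\<close>; this function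
  has mean 0, and a finite second moment because of the envelope. Taylor expansion
  (\<open>linearisation_estimate\<close>, \<open>estimator_linearisation\<close>) now gives

  \<open>J(\<theta>\<^sub>m\<^sub>n - \<theta>\<^sup>*) = Q\<^sub>n \<psi> + P\<^sub>m mean_score + o(1 / sqrt (min m n))\<close> in probability.

  The right-hand side is a sum of two independent averages of centred i.i.d. vectors. The
  norming matrix \<open>(V / n + W / m)\<^sup>-\<^sup>1\<^sup>/\<^sup>2\<close> exists uniquely and is of order \<open>sqrt (min m n)\<close>
  (\<open>pos_def_sqrt_exists\<close>, \<open>pos_def_sqrt_unique\<close>, \<open>pooled_covariance\<close>), so that the error term
  stays negligible after norming, and the characteristic function of the normed sum converges to
  that of \<open>N(0, I)\<close>. This holds however \<open>m\<close> and \<open>n\<close> are related, because the approximation of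
  characteristic functions is uniform over bounded sets of frequencies (\<open>iid_char_limit\<close>,
  \<open>two_sample_char_limit\<close>). Convergence of characteristic functions is transferred to integrals
  of bounded continuous functions by Gaussian smoothing
  (\<open>char_convergence_imp_compact_support_convergence\<close>, \<open>compact_support_convergence_imp_weak\<close>).
  Limits along \<open>m, n \<rightarrow> \<infinity>\<close> are handled through arbitrary pairs of sequences
  (\<open>tendsto_prod_sequentiallyI\<close>); \<open>estimator_CLT\<close> puts everything together.\<close>

section \<open>Calculus with partial derivatives\<close>

lemma partial_derivI:
  assumes "((\<lambda>t. u (\<theta> + t *\<^sub>R axis i 1)) has_real_derivative D) (at 0)"
  shows "has_partial_deriv i u \<theta>" "partial_deriv i u \<theta> = D"
  using assms DERIV_imp_deriv real_differentiable_def
  by (auto simp: has_partial_deriv_def partial_deriv_def)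

lemma partial_derivD:
  assumes "has_partial_deriv i u \<theta>"
  shows "((\<lambda>t. u (\<theta> + t *\<^sub>R axis i 1)) has_real_derivative partial_deriv i u \<theta>) (at 0)"
  using assms DERIV_imp_deriv real_differentiable_def
  by (metis has_partial_deriv_def partial_deriv_def)

lemma partial_derivD_at:
  assumes "has_partial_deriv i u (\<theta> + s *\<^sub>R axis i 1)"
  shows "((\<lambda>t. u (\<theta> + t *\<^sub>R axis i 1)) has_real_derivative
           partial_deriv i u (\<theta> + s *\<^sub>R axis i 1)) (at s)"
proof -
  have "((\<lambda>t. u (\<theta> + (t + s) *\<^sub>R axis i 1)) has_real_derivative
           partial_deriv i u (\<theta> + s *\<^sub>R axis i 1)) (at 0)"
    using partial_derivD[OF assms] by (simp add: scaleR_add_left add_ac)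
  then show ?thesis
    using DERIV_shift[of "\<lambda>t. u (\<theta> + t *\<^sub>R axis i 1)" _ 0 s] by simp
qed

lemma eventually_line_in_open:
  fixes \<theta> :: "real ^ 'd::finite"
  assumes "open S" "\<theta> \<in> S"
  shows "eventually (\<lambda>t. \<theta> + t *\<^sub>R axis i 1 \<in> S) (nhds 0)"
proof -
  have "((\<lambda>t::real. \<theta> + t *\<^sub>R axis i 1) \<longlongrightarrow> \<theta> + 0 *\<^sub>R axis i 1) (nhds 0)"
    by (intro tendsto_intros filterlim_ident)
  then show ?thesis using assms topological_tendstoD by fastforce
qed

text \<open>Partial derivatives are local: this allows a function to be replaced by a formula that
  holds only on an open set.\<close>

lemma partial_deriv_cong_open:
  fixes \<theta> :: "real ^ 'd::finite"
  assumes "open S" "\<theta> \<in> S" "\<And>\<theta>'. \<theta>' \<in> S \<Longrightarrow> u \<theta>' = v \<theta>'"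
  shows "partial_deriv i u \<theta> = partial_deriv i v \<theta>"
    and "has_partial_deriv i u \<theta> \<longleftrightarrow> has_partial_deriv i v \<theta>"
proof -
  have ev: "eventually (\<lambda>t. u (\<theta> + t *\<^sub>R axis i 1) = v (\<theta> + t *\<^sub>R axis i 1)) (nhds 0)"
    using eventually_line_in_open[OF assms(1,2)] by eventually_elim (use assms in auto)
  then show "partial_deriv i u \<theta> = partial_deriv i v \<theta>"
    unfolding partial_deriv_def by (rule deriv_cong_ev) simp
  have "((\<lambda>t. u (\<theta> + t *\<^sub>R axis i 1)) has_real_derivative D) (at 0) \<longleftrightarrow>
        ((\<lambda>t. v (\<theta> + t *\<^sub>R axis i 1)) has_real_derivative D) (at 0)" for D
    by (rule DERIV_cong_ev) (use ev in auto)
  then show "has_partial_deriv i u \<theta> \<longleftrightarrow> has_partial_deriv i v \<theta>"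
    by (simp add: has_partial_deriv_def real_differentiable_def)
qed

lemma second_partials_cong_open:
  fixes \<theta> :: "real ^ 'd::finite"
  assumes "open S" "\<And>\<theta>'. \<theta>' \<in> S \<Longrightarrow> u \<theta>' = v \<theta>'"
  shows "second_partials_exist_on u S \<longleftrightarrow> second_partials_exist_on v S"
    and "\<theta> \<in> S \<Longrightarrow> partial_deriv i (partial_deriv j u) \<theta> = partial_deriv i (partial_deriv j v) \<theta>"
  using assms unfolding second_partials_exist_on_def
  by (simp_all add: partial_deriv_cong_open[OF assms(1), of _ u v]
      partial_deriv_cong_open[OF assms(1), of _ "partial_deriv j u" "partial_deriv j v" for j]
      cong: ball_cong)

text \<open>Changing the coordinates of \<open>\<theta>0\<close> into those of \<open>\<theta>\<close> one at a time and using the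
  one-dimensional mean value theorem on each step gives a first-order expansion that needs only
  the existence of partial derivatives, at the price of a separate intermediate point for each
  coordinate. All these points are at least as close to \<open>\<theta>0\<close> as \<open>\<theta>\<close> is, since each of their
  coordinates lies between those of \<open>\<theta>0\<close> and \<open>\<theta>\<close>.\<close>

lemma coordinate_mean_value:
  fixes u :: "real ^ 'd::finite \<Rightarrow> real"
  assumes diff: "\<And>\<xi> i. norm (\<xi> - \<theta>0) \<le> norm (\<theta> - \<theta>0) \<Longrightarrow> has_partial_deriv i u \<xi>"
  shows "\<exists>\<xi>. (\<forall>i. norm (\<xi> i - \<theta>0) \<le> norm (\<theta> - \<theta>0)) \<and>
           u \<theta> - u \<theta>0 = (\<Sum>i\<in>UNIV. partial_deriv i u (\<xi> i) * (\<theta> - \<theta>0) $ i)"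
proof -
  define p where "p A = (\<chi> i. if i \<in> A then \<theta> $ i else \<theta>0 $ i)" for A
  have p_norm: "norm (z - \<theta>0) \<le> norm (\<theta> - \<theta>0)"
    if "\<And>i. \<bar>z $ i - \<theta>0 $ i\<bar> \<le> \<bar>\<theta> $ i - \<theta>0 $ i\<bar>" for z
    unfolding norm_vec_def by (rule L2_set_mono) (use that in auto)
  have "\<exists>\<xi>. (\<forall>i. norm (\<xi> i - \<theta>0) \<le> norm (\<theta> - \<theta>0)) \<and>
           u (p A) - u \<theta>0 = (\<Sum>i\<in>A. partial_deriv i u (\<xi> i) * (\<theta> - \<theta>0) $ i)" for A :: "'d set"
    using finite[of A]
  proof (induction A rule: finite_induct)
    case empty
    have "p {} = \<theta>0" by (simp add: p_def vec_eq_iff)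
    then show ?case by (auto intro: exI[of _ "\<lambda>_. \<theta>0"])
  next
    case (insert k A)
    then obtain \<xi> where \<xi>: "\<And>i. norm (\<xi> i - \<theta>0) \<le> norm (\<theta> - \<theta>0)"
      "u (p A) - u \<theta>0 = (\<Sum>i\<in>A. partial_deriv i u (\<xi> i) * (\<theta> - \<theta>0) $ i)" by blast
    define c where "c = (\<theta> - \<theta>0) $ k"
    have step: "p (insert k A) = p A + c *\<^sub>R axis k 1"
      using insert(2) by (auto simp: p_def c_def vec_eq_iff axis_def)
    have line: "norm (p A + s *\<^sub>R axis k 1 - \<theta>0) \<le> norm (\<theta> - \<theta>0)" if "\<bar>s\<bar> \<le> \<bar>c\<bar>" for s
      by (rule p_norm) (use that insert(2) in \<open>auto simp: p_def c_def axis_def\<close>)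
    have D: "((\<lambda>t. u (p A + t *\<^sub>R axis k 1)) has_real_derivative
           partial_deriv k u (p A + s *\<^sub>R axis k 1)) (at s)" if "\<bar>s\<bar> \<le> \<bar>c\<bar>" for s
      by (intro partial_derivD_at diff line that)
    have "\<exists>s. \<bar>s\<bar> \<le> \<bar>c\<bar> \<and> u (p A + c *\<^sub>R axis k 1) - u (p A) = partial_deriv k u (p A + s *\<^sub>R axis k 1) * c"
    proof (cases c "0::real" rule: linorder_cases)
      case greater
      from MVT2[OF greater, of "\<lambda>t. u (p A + t *\<^sub>R axis k 1)"
          "\<lambda>s. partial_deriv k u (p A + s *\<^sub>R axis k 1)"]
      obtain z where "0 < z" "z < c"
        "u (p A + c *\<^sub>R axis k 1) - u (p A + 0 *\<^sub>R axis k 1) =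
          (c - 0) * partial_deriv k u (p A + z *\<^sub>R axis k 1)" using D by auto
      then show ?thesis by (intro exI[of _ z]) auto
    next
      case less
      from MVT2[OF less, of "\<lambda>t. u (p A + t *\<^sub>R axis k 1)"
          "\<lambda>s. partial_deriv k u (p A + s *\<^sub>R axis k 1)"]
      obtain z where "c < z" "z < 0"
        "u (p A + 0 *\<^sub>R axis k 1) - u (p A + c *\<^sub>R axis k 1) =
          (0 - c) * partial_deriv k u (p A + z *\<^sub>R axis k 1)" using D by auto
      then show ?thesis by (intro exI[of _ z]) (auto simp: algebra_simps)
    qed (auto intro: exI[of _ 0])
    then obtain s where s: "\<bar>s\<bar> \<le> \<bar>c\<bar>"
      "u (p A + c *\<^sub>R axis k 1) - u (p A) = partial_deriv k u (p A + s *\<^sub>R axis k 1) * c" by blast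
    define \<xi>' where "\<xi>' = \<xi>(k := p A + s *\<^sub>R axis k 1)"
    have eq: "(\<Sum>i\<in>A. partial_deriv i u (\<xi>' i) * (\<theta> - \<theta>0) $ i) =
          (\<Sum>i\<in>A. partial_deriv i u (\<xi> i) * (\<theta> - \<theta>0) $ i)"
      by (rule sum.cong) (use insert(2) in \<open>auto simp: \<xi>'_def\<close>)
    have "u (p (insert k A)) - u \<theta>0 = (\<Sum>i\<in>insert k A. partial_deriv i u (\<xi>' i) * (\<theta> - \<theta>0) $ i)"
      using insert(1,2) s(2) \<xi>(2) unfolding step sum.insert[OF insert(1,2)] eq
      by (simp add: \<xi>'_def c_def)
    moreover have "norm (\<xi>' i - \<theta>0) \<le> norm (\<theta> - \<theta>0)" for i
      using \<xi>(1) line[OF s(1)] by (simp add: \<xi>'_def)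
    ultimately show ?case by blast
  qed
  from this[of UNIV] show ?thesis by (simp add: p_def)
qed

text \<open>Bounded partial derivatives take the place of differentiability in the estimates below:
  existence of second partial derivatives alone gives no control over the function between the
  coordinate axes.\<close>

lemma bounded_partials_imp_lipschitz_at:
  fixes u :: "real ^ 'd::finite \<Rightarrow> real"
  assumes diff: "\<And>\<xi> i. \<xi> \<in> ball \<theta>0 r \<Longrightarrow> has_partial_deriv i u \<xi>"
    and bd: "\<And>\<xi> i. \<xi> \<in> ball \<theta>0 r \<Longrightarrow> \<bar>partial_deriv i u \<xi>\<bar> \<le> B"
    and \<theta>: "\<theta> \<in> ball \<theta>0 r"
  shows "\<bar>u \<theta> - u \<theta>0\<bar> \<le> B * real CARD('d) * norm (\<theta> - \<theta>0)"
proof -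
  have ball: "\<xi> \<in> ball \<theta>0 r" if "norm (\<xi> - \<theta>0) \<le> norm (\<theta> - \<theta>0)" for \<xi>
    using that \<theta> by (simp add: dist_norm norm_minus_commute)
  then obtain \<xi> where \<xi>: "\<And>i. norm (\<xi> i - \<theta>0) \<le> norm (\<theta> - \<theta>0)"
    and eq: "u \<theta> - u \<theta>0 = (\<Sum>i\<in>UNIV. partial_deriv i u (\<xi> i) * (\<theta> - \<theta>0) $ i)"
    using coordinate_mean_value[of \<theta>0 \<theta> u] diff by metis
  have "0 \<le> B" using bd[OF \<theta>] by (meson abs_ge_zero order_trans)
  have "\<bar>u \<theta> - u \<theta>0\<bar> \<le> (\<Sum>i\<in>UNIV. \<bar>partial_deriv i u (\<xi> i) * (\<theta> - \<theta>0) $ i\<bar>)"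
    unfolding eq by (rule sum_abs)
  also have "\<dots> \<le> (\<Sum>i\<in>(UNIV::'d set). B * norm (\<theta> - \<theta>0))"
    unfolding abs_mult
    by (intro sum_mono mult_mono bd ball \<xi> component_le_norm_cart \<open>0 \<le> B\<close> abs_ge_zero)
  finally show ?thesis by (simp add: mult_ac)
qed

lemma bounded_partials_imp_continuous_at:
  fixes u :: "real ^ 'd::finite \<Rightarrow> real"
  assumes diff: "\<And>\<xi> i. \<xi> \<in> ball \<theta>0 r \<Longrightarrow> has_partial_deriv i u \<xi>"
    and bd: "\<And>\<xi> i. \<xi> \<in> ball \<theta>0 r \<Longrightarrow> \<bar>partial_deriv i u \<xi>\<bar> \<le> B"
    and r: "0 < r"
  shows "isCont u \<theta>0"
proof -
  have ev: "eventually (\<lambda>\<theta>. \<theta> \<in> ball \<theta>0 r) (at \<theta>0)"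
    using r by (intro eventually_at_in_open') auto
  have "((\<lambda>\<theta>. B * real CARD('d) * norm (\<theta> - \<theta>0)) \<longlongrightarrow> B * real CARD('d) * norm (\<theta>0 - \<theta>0)) (at \<theta>0)"
    by (intro tendsto_intros)
  then have "((\<lambda>\<theta>. u \<theta> - u \<theta>0) \<longlongrightarrow> 0) (at \<theta>0)"
    by (intro tendsto_rabs_zero_cancel[OF tendsto_sandwich[OF always_eventually
        eventually_mono[OF ev bounded_partials_imp_lipschitz_at[OF diff bd]] tendsto_const]]) auto
  then show ?thesis unfolding isCont_def by (simp add: LIM_zero_iff)
qed

lemma continuous_partials_imp_continuous_on:
  fixes u :: "real ^ 'd::finite \<Rightarrow> real"
  assumes "open S" and diff: "\<And>\<xi> i. \<xi> \<in> S \<Longrightarrow> has_partial_deriv i u \<xi>"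
    and cont: "\<And>i. continuous_on S (partial_deriv i u)"
  shows "continuous_on S u"
proof (rule continuous_at_imp_continuous_on, rule ballI)
  fix \<theta>0 assume "\<theta>0 \<in> S"
  then obtain r where r: "0 < r" "cball \<theta>0 r \<subseteq> S" using \<open>open S\<close> open_contains_cball by blast
  have "\<exists>B. \<forall>\<xi>\<in>cball \<theta>0 r. \<bar>partial_deriv i u \<xi>\<bar> \<le> B" for i
  proof -
    have "bounded (partial_deriv i u ` cball \<theta>0 r)"
      by (intro compact_imp_bounded compact_continuous_image continuous_on_subset[OF cont] r) auto
    then show ?thesis by (auto simp: bounded_iff)
  qed
  then obtain B where B: "\<And>i \<xi>. \<xi> \<in> cball \<theta>0 r \<Longrightarrow> \<bar>partial_deriv i u \<xi>\<bar> \<le> B i" by metis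
  have "\<bar>partial_deriv i u \<xi>\<bar> \<le> Max (range B)" if "\<xi> \<in> ball \<theta>0 r" for i \<xi>
    using B[of \<xi> i] that by (auto intro: order_trans[OF _ Max_ge])
  then show "isCont u \<theta>0"
    using r diff by (intro bounded_partials_imp_continuous_at[of \<theta>0 r u]) (auto simp: subset_eq)
qed

lemma continuous_hess_imp_continuous:
  fixes u :: "real ^ 'd::finite \<Rightarrow> real"
  assumes "open S" "second_partials_exist_on u S" "continuous_on S (hess u)"
  shows "continuous_on S (partial_deriv i (partial_deriv j u))"
    and "continuous_on S (partial_deriv j u)" and "continuous_on S u"
proof -
  show 2: "continuous_on S (partial_deriv i (partial_deriv j u))" for i j
    using continuous_on_component[OF continuous_on_component[OF assms(3)], of i j]
    by (simp add: hess_def)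
  show 1: "continuous_on S (partial_deriv j u)" for j
    by (rule continuous_partials_imp_continuous_on[OF assms(1) _ 2])
       (use assms(2) in \<open>auto simp: second_partials_exist_on_def\<close>)
  show "continuous_on S u"
    by (rule continuous_partials_imp_continuous_on[OF assms(1) _ 1])
       (use assms(2) in \<open>auto simp: second_partials_exist_on_def\<close>)
qed

text \<open>Quotient rule for \<open>ln u\<close>. The expression for the second derivative separates the part that
  is linear in the Hessian of \<open>u\<close> from a product of gradients.\<close>

lemma ln_partials:
  fixes u :: "real ^ 'd::finite \<Rightarrow> real"
  assumes S: "open S" and ex: "second_partials_exist_on u S" and pos: "\<And>\<theta>. \<theta> \<in> S \<Longrightarrow> 0 < u \<theta>"
  shows "second_partials_exist_on (\<lambda>\<theta>. ln (u \<theta>)) S"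
    and "\<theta> \<in> S \<Longrightarrow> partial_deriv j (\<lambda>\<theta>. ln (u \<theta>)) \<theta> = partial_deriv j u \<theta> / u \<theta>"
    and "\<theta> \<in> S \<Longrightarrow> partial_deriv i (partial_deriv j (\<lambda>\<theta>. ln (u \<theta>))) \<theta> =
          partial_deriv i (partial_deriv j u) \<theta> / u \<theta> -
          partial_deriv i u \<theta> * partial_deriv j u \<theta> / (u \<theta>)\<^sup>2"
proof -
  have 1: "((\<lambda>t. ln (u (\<theta> + t *\<^sub>R axis j 1))) has_real_derivative partial_deriv j u \<theta> / u \<theta>) (at 0)"
    if "\<theta> \<in> S" for \<theta> j
    using partial_derivD[of j u \<theta>] pos[OF that] ex that
    by (auto simp: second_partials_exist_on_def intro!: derivative_eq_intros)
  have 2: "((\<lambda>t. partial_deriv j u (\<theta> + t *\<^sub>R axis i 1) / u (\<theta> + t *\<^sub>R axis i 1)) has_real_derivative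
     partial_deriv i (partial_deriv j u) \<theta> / u \<theta> -
          partial_deriv i u \<theta> * partial_deriv j u \<theta> / (u \<theta>)\<^sup>2) (at 0)"
    if "\<theta> \<in> S" for \<theta> i j
  proof -
    have d: "((\<lambda>t. u (\<theta> + t *\<^sub>R axis i 1)) has_real_derivative partial_deriv i u \<theta>) (at 0)"
      "((\<lambda>t. partial_deriv j u (\<theta> + t *\<^sub>R axis i 1)) has_real_derivative
          partial_deriv i (partial_deriv j u) \<theta>) (at 0)"
      using ex that by (auto simp: second_partials_exist_on_def intro!: partial_derivD)
    have "u \<theta> \<noteq> 0" using pos[OF that] by simp
    then show ?thesis
      using DERIV_divide[OF d(2,1)] by (simp add: field_simps power2_eq_square)
  qed
  note eq1 = partial_derivI(2)[OF 1]
  show "\<theta> \<in> S \<Longrightarrow> partial_deriv j (\<lambda>\<theta>. ln (u \<theta>)) \<theta> = partial_deriv j u \<theta> / u \<theta>" by (rule eq1)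
  have eq2: "partial_deriv i (partial_deriv j (\<lambda>\<theta>. ln (u \<theta>))) \<theta> =
      partial_deriv i (\<lambda>\<theta>. partial_deriv j u \<theta> / u \<theta>) \<theta>"
    and ex2: "has_partial_deriv i (partial_deriv j (\<lambda>\<theta>. ln (u \<theta>))) \<theta> \<longleftrightarrow>
      has_partial_deriv i (\<lambda>\<theta>. partial_deriv j u \<theta> / u \<theta>) \<theta>" if "\<theta> \<in> S" for \<theta> i j
    using partial_deriv_cong_open[OF S that eq1] by auto
  show "\<theta> \<in> S \<Longrightarrow> partial_deriv i (partial_deriv j (\<lambda>\<theta>. ln (u \<theta>))) \<theta> =
          partial_deriv i (partial_deriv j u) \<theta> / u \<theta> -
          partial_deriv i u \<theta> * partial_deriv j u \<theta> / (u \<theta>)\<^sup>2"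
    using eq2 partial_derivI(2)[OF 2] by simp
  show "second_partials_exist_on (\<lambda>\<theta>. ln (u \<theta>)) S"
    unfolding second_partials_exist_on_def
    using partial_derivI(1)[OF 1] ex2 partial_derivI(1)[OF 2] by simp
qed

lemma lincomb_partials:
  fixes u :: "'k \<Rightarrow> real ^ 'd::finite \<Rightarrow> real"
  assumes S: "open S" and ex: "\<And>k. k \<in> A \<Longrightarrow> second_partials_exist_on (u k) S" and "finite A"
  shows "second_partials_exist_on (\<lambda>\<theta>. \<Sum>k\<in>A. c k * u k \<theta>) S"
    and "\<theta> \<in> S \<Longrightarrow> partial_deriv j (\<lambda>\<theta>. \<Sum>k\<in>A. c k * u k \<theta>) \<theta> = (\<Sum>k\<in>A. c k * partial_deriv j (u k) \<theta>)"
    and "\<theta> \<in> S \<Longrightarrow> partial_deriv i (partial_deriv j (\<lambda>\<theta>. \<Sum>k\<in>A. c k * u k \<theta>)) \<theta> =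
          (\<Sum>k\<in>A. c k * partial_deriv i (partial_deriv j (u k)) \<theta>)"
proof -
  have 1: "((\<lambda>t. (\<Sum>k\<in>A. c k * u k (\<theta> + t *\<^sub>R axis j 1))) has_real_derivative
       (\<Sum>k\<in>A. c k * partial_deriv j (u k) \<theta>)) (at 0)" if "\<theta> \<in> S" for \<theta> j
    by (intro DERIV_sum DERIV_cmult partial_derivD)
       (use that ex in \<open>auto simp: second_partials_exist_on_def\<close>)
  have 2: "((\<lambda>t. (\<Sum>k\<in>A. c k * partial_deriv j (u k) (\<theta> + t *\<^sub>R axis i 1))) has_real_derivative
       (\<Sum>k\<in>A. c k * partial_deriv i (partial_deriv j (u k)) \<theta>)) (at 0)" if "\<theta> \<in> S" for \<theta> i j
    by (intro DERIV_sum DERIV_cmult partial_derivD)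
       (use that ex in \<open>auto simp: second_partials_exist_on_def\<close>)
  note eq1 = partial_derivI(2)[OF 1]
  show "\<theta> \<in> S \<Longrightarrow> partial_deriv j (\<lambda>\<theta>. \<Sum>k\<in>A. c k * u k \<theta>) \<theta> = (\<Sum>k\<in>A. c k * partial_deriv j (u k) \<theta>)"
    by (rule eq1)
  have eq2: "partial_deriv i (partial_deriv j (\<lambda>\<theta>. \<Sum>k\<in>A. c k * u k \<theta>)) \<theta> =
      partial_deriv i (\<lambda>\<theta>. \<Sum>k\<in>A. c k * partial_deriv j (u k) \<theta>) \<theta>"
    and ex2: "has_partial_deriv i (partial_deriv j (\<lambda>\<theta>. \<Sum>k\<in>A. c k * u k \<theta>)) \<theta> \<longleftrightarrow>
      has_partial_deriv i (\<lambda>\<theta>. \<Sum>k\<in>A. c k * partial_deriv j (u k) \<theta>) \<theta>" if "\<theta> \<in> S" for \<theta> i j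
    using partial_deriv_cong_open[OF S that eq1] by auto
  show "\<theta> \<in> S \<Longrightarrow> partial_deriv i (partial_deriv j (\<lambda>\<theta>. \<Sum>k\<in>A. c k * u k \<theta>)) \<theta> =
          (\<Sum>k\<in>A. c k * partial_deriv i (partial_deriv j (u k)) \<theta>)"
    using eq2 partial_derivI(2)[OF 2] by simp
  show "second_partials_exist_on (\<lambda>\<theta>. \<Sum>k\<in>A. c k * u k \<theta>) S"
    unfolding second_partials_exist_on_def
    using partial_derivI(1)[OF 1] ex2 partial_derivI(1)[OF 2] by simp
qed

lemma partial_deriv_const [simp]: "partial_deriv i (\<lambda>_. c) \<theta> = 0"
  by (simp add: partial_deriv_def)

lemma diff_partials:
  fixes u v :: "real ^ 'd::finite \<Rightarrow> real"
  assumes S: "open S" and ex: "second_partials_exist_on u S" "second_partials_exist_on v S"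
  shows "second_partials_exist_on (\<lambda>\<theta>. u \<theta> - v \<theta>) S"
    and "\<theta> \<in> S \<Longrightarrow> partial_deriv j (\<lambda>\<theta>. u \<theta> - v \<theta>) \<theta> = partial_deriv j u \<theta> - partial_deriv j v \<theta>"
    and "\<theta> \<in> S \<Longrightarrow> partial_deriv i (partial_deriv j (\<lambda>\<theta>. u \<theta> - v \<theta>)) \<theta> =
          partial_deriv i (partial_deriv j u) \<theta> - partial_deriv i (partial_deriv j v) \<theta>"
  using lincomb_partials[OF S, where A = UNIV and u = "\<lambda>b. if b then u else v"
      and c = "\<lambda>b. if b then 1 else -1"] ex
  by (simp_all add: UNIV_bool)

lemma bounded_partials_imp_continuous_on:
  fixes u :: "real ^ 'd::finite \<Rightarrow> real"
  assumes "open S" and diff: "\<And>\<xi> i. \<xi> \<in> S \<Longrightarrow> has_partial_deriv i u \<xi>"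
    and bd: "\<And>\<xi> i. \<xi> \<in> S \<Longrightarrow> \<bar>partial_deriv i u \<xi>\<bar> \<le> B"
  shows "continuous_on S u"
proof (rule continuous_at_imp_continuous_on, rule ballI)
  fix \<theta>0 assume "\<theta>0 \<in> S"
  then obtain r where r: "0 < r" "ball \<theta>0 r \<subseteq> S" using \<open>open S\<close> open_contains_ball by blast
  show "isCont u \<theta>0"
    by (rule bounded_partials_imp_continuous_at[of \<theta>0 r u B]) (use r diff bd in auto)
qed

text \<open>The second difference over a square of side \<open>c\<close> is a mixed derivative at some point of the
  square, by the mean value theorem in direction \<open>i\<close> and then in direction \<open>j\<close>. The order of
  differentiation on the right is determined by the order of these two steps, whereas the
  left-hand side is symmetric.\<close>

lemma mixed_difference:
  fixes u :: "real ^ 'd::finite \<Rightarrow> real"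
  assumes S: "\<And>s t. 0 \<le> s \<Longrightarrow> s \<le> c \<Longrightarrow> 0 \<le> t \<Longrightarrow> t \<le> c \<Longrightarrow> \<theta> + s *\<^sub>R axis i 1 + t *\<^sub>R axis j 1 \<in> S"
    and ex: "second_partials_exist_on u S" and c: "0 < c"
  shows "\<exists>s t. 0 \<le> s \<and> s \<le> c \<and> 0 \<le> t \<and> t \<le> c \<and>
     u (\<theta> + c *\<^sub>R axis i 1 + c *\<^sub>R axis j 1) - u (\<theta> + c *\<^sub>R axis i 1) - u (\<theta> + c *\<^sub>R axis j 1) + u \<theta> =
     c * c * partial_deriv j (partial_deriv i u) (\<theta> + s *\<^sub>R axis i 1 + t *\<^sub>R axis j 1)"
proof -
  define p where "p s t = \<theta> + s *\<^sub>R axis i 1 + t *\<^sub>R axis j 1" for s t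
  have p_alt: "p s t = (\<theta> + t *\<^sub>R axis j 1) + s *\<^sub>R axis i 1" for s t by (simp add: p_def)
  have pS: "p s t \<in> S" if "0 \<le> s" "s \<le> c" "0 \<le> t" "t \<le> c" for s t using S that by (simp add: p_def)
  have d1: "((\<lambda>s. u (p s t)) has_real_derivative partial_deriv i u (p s t)) (at s)"
    if "0 \<le> s" "s \<le> c" "0 \<le> t" "t \<le> c" for s t
    using partial_derivD_at[of i u "\<theta> + t *\<^sub>R axis j 1" s] ex pS[OF that]
    unfolding p_alt second_partials_exist_on_def by blast
  have d2: "((\<lambda>t. partial_deriv i u (p s t)) has_real_derivative partial_deriv j (partial_deriv i u) (p s t)) (at t)"
    if "0 \<le> s" "s \<le> c" "0 \<le> t" "t \<le> c" for s t
    using partial_derivD_at[of j "partial_deriv i u" "\<theta> + s *\<^sub>R axis i 1" t] ex pS[OF that]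
    unfolding p_def second_partials_exist_on_def by blast
  have "\<exists>s. s > 0 \<and> s < c \<and> (u (p c c) - u (p c 0)) - (u (p 0 c) - u (p 0 0)) =
      (c - 0) * (partial_deriv i u (p s c) - partial_deriv i u (p s 0))"
    by (rule MVT2[OF c]) (intro DERIV_diff d1; use c in simp)
  then obtain s where s: "s > 0" "s < c"
    "(u (p c c) - u (p c 0)) - (u (p 0 c) - u (p 0 0)) =
      c * (partial_deriv i u (p s c) - partial_deriv i u (p s 0))" by auto
  have "\<exists>t. t > 0 \<and> t < c \<and> partial_deriv i u (p s c) - partial_deriv i u (p s 0) =
      (c - 0) * partial_deriv j (partial_deriv i u) (p s t)"
    by (rule MVT2[OF c]) (intro d2; use s in simp)
  then obtain t where "t > 0" "t < c"
    "partial_deriv i u (p s c) - partial_deriv i u (p s 0) = c * partial_deriv j (partial_deriv i u) (p s t)" by auto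
  then show ?thesis using s
    by (intro exI[of _ s] exI[of _ t]) (simp add: p_def algebra_simps)
qed

text \<open>Schwarz's theorem under continuity at the single point \<open>\<theta>\<close>, where it is available in the
  application.\<close>

lemma mixed_partials_commute:
  fixes u :: "real ^ 'd::finite \<Rightarrow> real"
  assumes S: "open S" "\<theta> \<in> S" and ex: "second_partials_exist_on u S"
    and cont: "\<And>i j. isCont (partial_deriv i (partial_deriv j u)) \<theta>"
  shows "partial_deriv i (partial_deriv j u) \<theta> = partial_deriv j (partial_deriv i u) \<theta>"
proof -
  let ?A = "partial_deriv i (partial_deriv j u)" and ?B = "partial_deriv j (partial_deriv i u)"
  have "\<bar>?A \<theta> - ?B \<theta>\<bar> \<le> e" if "e > 0" for e
  proof -
    obtain r where r: "r > 0" "ball \<theta> r \<subseteq> S" using S open_contains_ball by blast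
    obtain d1 where d1: "d1 > 0" "\<And>z. dist z \<theta> < d1 \<Longrightarrow> \<bar>?A z - ?A \<theta>\<bar> < e/2"
      using cont[of i j, unfolded continuous_at_eps_delta, rule_format, of "e/2"] \<open>e > 0\<close>
      by (auto simp: dist_real_def)
    obtain d2 where d2: "d2 > 0" "\<And>z. dist z \<theta> < d2 \<Longrightarrow> \<bar>?B z - ?B \<theta>\<bar> < e/2"
      using cont[of j i, unfolded continuous_at_eps_delta, rule_format, of "e/2"] \<open>e > 0\<close>
      by (auto simp: dist_real_def)
    \<comment> \<open>Squares of side \<open>c\<close> stay inside the ball and within the reach of both continuity moduli.\<close>
    define c where "c = min r (min d1 d2) / 3"
    have "c > 0" using r(1) d1(1) d2(1) by (simp add: c_def)
    moreover have "3 * c \<le> r" "3 * c \<le> d1" "3 * c \<le> d2" unfolding c_def by simp_all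
    ultimately have c: "c > 0" "2 * c < r" "2 * c < d1" "2 * c < d2" by linarith+
    have near: "dist (\<theta> + s *\<^sub>R axis k 1 + t *\<^sub>R axis l 1) \<theta> \<le> 2 * c"
      if "0 \<le> s" "s \<le> c" "0 \<le> t" "t \<le> c" for s t k l
    proof -
      have "norm (s *\<^sub>R axis k 1 + t *\<^sub>R (axis l 1 :: real ^ 'd)) \<le> \<bar>s\<bar> + \<bar>t\<bar>"
        using norm_triangle_ineq[of "s *\<^sub>R axis k 1" "t *\<^sub>R (axis l 1 :: real ^ 'd)"] by simp
      then show ?thesis using that by (simp add: dist_norm add.assoc)
    qed
    have inS: "\<theta> + s *\<^sub>R axis k 1 + t *\<^sub>R axis l 1 \<in> S"
      if "0 \<le> s" "s \<le> c" "0 \<le> t" "t \<le> c" for s t k l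
    proof -
      have "dist (\<theta> + s *\<^sub>R axis k 1 + t *\<^sub>R axis l 1) \<theta> < r"
        using near[OF that, of k l] c(2) by linarith
      then have "\<theta> + s *\<^sub>R axis k 1 + t *\<^sub>R axis l 1 \<in> ball \<theta> r"
        unfolding mem_ball by (subst dist_commute)
      then show ?thesis using r(2) by blast
    qed
    \<comment> \<open>The same second difference, expanded in the two possible orders.\<close>
    obtain s t where 1: "0 \<le> s" "s \<le> c" "0 \<le> t" "t \<le> c"
      "u (\<theta> + c *\<^sub>R axis i 1 + c *\<^sub>R axis j 1) - u (\<theta> + c *\<^sub>R axis i 1) - u (\<theta> + c *\<^sub>R axis j 1) + u \<theta> =
       c * c * ?B (\<theta> + s *\<^sub>R axis i 1 + t *\<^sub>R axis j 1)"
      using mixed_difference[where i = i and j = j, OF inS ex c(1)] by blast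
    obtain s' t' where 2: "0 \<le> s'" "s' \<le> c" "0 \<le> t'" "t' \<le> c"
      "u (\<theta> + c *\<^sub>R axis j 1 + c *\<^sub>R axis i 1) - u (\<theta> + c *\<^sub>R axis j 1) - u (\<theta> + c *\<^sub>R axis i 1) + u \<theta> =
       c * c * ?A (\<theta> + s' *\<^sub>R axis j 1 + t' *\<^sub>R axis i 1)"
      using mixed_difference[where i = j and j = i, OF inS ex c(1)] by blast
    let ?p = "\<theta> + s *\<^sub>R axis i 1 + t *\<^sub>R axis j 1" and ?q = "\<theta> + s' *\<^sub>R axis j 1 + t' *\<^sub>R axis i 1"
    have "c * c * ?B ?p = c * c * ?A ?q"
      unfolding 1(5)[symmetric] 2(5)[symmetric] by (simp add: add_ac)
    then have "?B ?p = ?A ?q" using c(1) by simp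
    moreover have "\<bar>?A ?q - ?A \<theta>\<bar> < e/2"
      using near[OF 2(1-4), of j i] c by (intro d1(2)) linarith
    moreover have "\<bar>?B ?p - ?B \<theta>\<bar> < e/2"
      using near[OF 1(1-4), of i j] c by (intro d2(2)) linarith
    ultimately show ?thesis by linarith
  qed
  then have "\<bar>?A \<theta> - ?B \<theta>\<bar> \<le> 0 + e" if "e > 0" for e using that by simp
  then have "\<bar>?A \<theta> - ?B \<theta>\<bar> \<le> 0" by (rule field_le_epsilon)
  then show ?thesis by simp
qed

text \<open>The exceptional null set in \<open>zero\<close> may depend on \<open>\<theta>\<close>. This is harmless because a
  derivative that exists is the limit of difference quotients along one sequence, so that only
  countably many null sets matter.\<close>

lemma AE_zero_partial_deriv:
  fixes u :: "real ^ 'd::finite \<Rightarrow> 'x \<Rightarrow> real"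
  assumes S: "open S" "\<theta> \<in> S"
    and zero: "\<And>\<theta>. \<theta> \<in> S \<Longrightarrow> AE x in N. Z x \<longrightarrow> u \<theta> x = 0"
    and diff: "\<And>x. x \<in> space N \<Longrightarrow> has_partial_deriv i (\<lambda>\<theta>. u \<theta> x) \<theta>"
  shows "AE x in N. Z x \<longrightarrow> partial_deriv i (\<lambda>\<theta>. u \<theta> x) \<theta> = 0"
proof -
  obtain r where r: "r > 0" "\<And>t. \<bar>t\<bar> < r \<Longrightarrow> \<theta> + t *\<^sub>R axis i 1 \<in> S"
    using eventually_line_in_open[OF S, of i] unfolding eventually_nhds_metric dist_real_def by auto
  \<comment> \<open>Any sequence of nonzero steps of size below \<open>r\<close> that tends to 0.\<close>
  define t where "t k = r / real (k + 2)" for k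
  have t: "t k \<noteq> 0" "\<bar>t k\<bar> < r" for k using r(1) by (auto simp: t_def field_simps add_pos_nonneg)
  have "t \<longlonglongrightarrow> 0"
    unfolding t_def using LIMSEQ_ignore_initial_segment[OF lim_const_over_n[of r], of 2] by simp
  then have t_lim: "filterlim t (at 0) sequentially"
    using t(1) by (auto simp: filterlim_at)
  have "AE x in N. \<forall>k. Z x \<longrightarrow> u (\<theta> + t k *\<^sub>R axis i 1) x = 0"
    unfolding AE_all_countable using zero r(2) t(2) by blast
  with zero[OF S(2)] AE_space show ?thesis
  proof eventually_elim
    case (elim x)
    show ?case
    proof
      assume "Z x"
      have "((\<lambda>s. (u (\<theta> + s *\<^sub>R axis i 1) x - u (\<theta> + 0 *\<^sub>R axis i 1) x) / (s - 0)) \<longlongrightarrow>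
          partial_deriv i (\<lambda>\<theta>. u \<theta> x) \<theta>) (at 0)"
        using partial_derivD[OF diff] elim unfolding has_field_derivative_iff by simp
      from filterlim_compose[OF this t_lim]
      have "(\<lambda>k. 0) \<longlonglongrightarrow> partial_deriv i (\<lambda>\<theta>. u \<theta> x) \<theta>" using elim \<open>Z x\<close> by simp
      then show "partial_deriv i (\<lambda>\<theta>. u \<theta> x) \<theta> = 0" by (simp add: LIMSEQ_const_iff)
    qed
  qed
qed

section \<open>Positive definite matrices and covariances\<close>

lemma symmetric_matrix_inner:
  fixes A :: "real ^ 'n::finite ^ 'n"
  assumes "transpose A = A"
  shows "x \<bullet> (A *v y) = (A *v x) \<bullet> y"
  using assms by (metis dot_lmul_matrix vector_transpose_matrix)

lemma symmetric_matrixI: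
  fixes A :: "real ^ 'n::finite ^ 'n"
  assumes "\<And>x y. x \<bullet> (A *v y) = (A *v x) \<bullet> y"
  shows "transpose A = A"
proof -
  have "A $ i $ j = A $ j $ i" for i j
    using assms[of "axis i 1" "axis j 1"]
    by (simp only: matrix_vector_mult_basis inner_axis inner_axis' column_def vec_lambda_beta inner_real_def mult_1_left mult_1_right)
  then show ?thesis by (simp add: transpose_def vec_eq_iff)
qed

lemma pos_def_inner: "pos_def A \<Longrightarrow> x \<bullet> (A *v y) = (A *v x) \<bullet> y"
  for A :: "real ^ 'n::finite ^ 'n"
  by (auto simp: pos_def_def intro: symmetric_matrix_inner)

text \<open>The quadratic form attains a positive minimum on the unit sphere.\<close>

lemma pos_def_coercive:
  fixes A :: "real ^ 'n::finite ^ 'n"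
  assumes "pos_def A"
  shows "\<exists>a>0. \<forall>v. a * (norm v)\<^sup>2 \<le> v \<bullet> (A *v v)"
proof -
  have "axis undefined 1 \<in> sphere (0::real^'n) 1" by simp
  then have ne: "sphere (0::real^'n) 1 \<noteq> {}" by blast
  have cont: "continuous_on (sphere 0 1) (\<lambda>v. v \<bullet> (A *v v))"
    by (rule continuous_on_inner[OF continuous_on_id
          linear_continuous_on[OF matrix_vector_mul_bounded_linear]])
  obtain w where w: "w \<in> sphere 0 1" "\<forall>v\<in>sphere 0 1. w \<bullet> (A *v w) \<le> v \<bullet> (A *v v)"
    using continuous_attains_inf[OF compact_sphere ne cont] by blast
  define a where "a = w \<bullet> (A *v w)"
  have "w \<noteq> 0" using w(1) by auto
  then have "0 < a" using assms by (auto simp: a_def pos_def_def)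
  moreover have "a * (norm v)\<^sup>2 \<le> v \<bullet> (A *v v)" for v
  proof (cases "v = 0")
    case False
    then have "v /\<^sub>R norm v \<in> sphere 0 1" by simp
    then have "a \<le> (v /\<^sub>R norm v) \<bullet> (A *v (v /\<^sub>R norm v))"
      using w(2) unfolding a_def by blast
    also have "\<dots> = (v \<bullet> (A *v v)) / (norm v)\<^sup>2"
      unfolding matrix_vector_mult_scaleR inner_scaleR_left inner_scaleR_right
      by (simp add: power2_eq_square divide_inverse)
    finally show ?thesis using False by (simp add: pos_le_divide_eq)
  qed simp
  ultimately show ?thesis by blast
qed

lemma pos_def_invertible:
  fixes A :: "real ^ 'n::finite ^ 'n"
  assumes "pos_def A" shows "invertible A"
proof -
  have "x = 0" if "A *v x = 0" for x
    using assms that unfolding pos_def_def by (metis inner_zero_right less_irrefl)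
  then have "\<exists>B. B ** A = mat 1" unfolding matrix_left_invertible_ker by blast
  then show ?thesis by (simp add: invertible_left_inverse)
qed

lemma matrix_inv_works:
  fixes A :: "'a::semiring_1 ^ 'n ^ 'm"
  assumes "invertible A"
  shows "A ** matrix_inv A = mat 1" "matrix_inv A ** A = mat 1"
  using someI_ex[OF assms[unfolded invertible_def]] by (simp_all add: matrix_inv_def)

lemma pos_def_matrix_inv:
  fixes A :: "real ^ 'n::finite ^ 'n"
  assumes A: "pos_def A" shows "pos_def (matrix_inv A)"
proof -
  have AI: "A ** matrix_inv A = mat 1" "matrix_inv A ** A = mat 1"
    using matrix_inv_works[OF pos_def_invertible[OF A]] by auto
  have AI': "A *v (matrix_inv A *v x) = x" for x
    by (simp add: matrix_vector_mul_assoc AI)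
  have "transpose (matrix_inv A) = matrix_inv A"
  proof (rule symmetric_matrixI)
    fix x y
    show "x \<bullet> (matrix_inv A *v y) = (matrix_inv A *v x) \<bullet> y"
      using pos_def_inner[OF A, of "matrix_inv A *v x" "matrix_inv A *v y"] by (simp add: AI')
  qed
  moreover have "v \<bullet> (matrix_inv A *v v) > 0" if "v \<noteq> 0" for v
  proof -
    have "matrix_inv A *v v \<noteq> 0" using AI'[of v] that by auto
    then have "(matrix_inv A *v v) \<bullet> (A *v (matrix_inv A *v v)) > 0" using A by (auto simp: pos_def_def)
    then show ?thesis by (simp add: AI' inner_commute)
  qed
  ultimately show ?thesis by (simp add: pos_def_def)
qed

text \<open>Put \<open>D = B - C\<close>. From \<open>B\<^sup>2 = C\<^sup>2\<close> follows \<open>B D = - D C\<close>, so that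
  \<open>tr (D B D) = - tr (D D C) = - tr (D C D)\<close>. Both \<open>tr (D B D)\<close> and \<open>tr (D C D)\<close> are sums of
  values of positive definite forms at the columns of \<open>D\<close>; since they cancel, \<open>D\<close> vanishes.\<close>

lemma pos_def_sqrt_unique:
  fixes B C :: "real ^ 'n::finite ^ 'n"
  assumes B: "pos_def B" and C: "pos_def C" and eq: "B ** B = C ** C"
  shows "B = C"
proof -
  define D where "D x = B *v x - C *v x" for x
  have sym: "x \<bullet> D y = D x \<bullet> y" for x y
    unfolding D_def inner_diff_right inner_diff_left using B C pos_def_inner by metis
  have lin: "linear D" unfolding D_def
    by (intro linear_compose_sub matrix_vector_mul_linear)
  have BC: "B *v (B *v x) = C *v (C *v x)" for x by (simp add: matrix_vector_mul_assoc eq)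
  have anti: "B *v (D x) = - D (C *v x)" for x
    by (simp add: D_def matrix_vector_mult_diff_distrib BC)
  \<comment> \<open>The two traces, written out over the columns of \<open>D\<close>, add up to 0.\<close>
  have tr: "(\<Sum>i\<in>UNIV. D (axis i 1) \<bullet> (B *v (D (axis i 1)))) +
        (\<Sum>i\<in>UNIV. D (axis i 1) \<bullet> (C *v (D (axis i 1)))) = 0"
  proof -
    have "D (axis i 1) \<bullet> (B *v (D (axis i 1))) = - (D (D (axis i 1)) \<bullet> (C *v axis i 1))" for i
      unfolding anti by (simp add: sym)
    also have "\<dots> i = - (C *v D (D (axis i 1))) $ i" for i
      by (simp add: pos_def_inner[OF C] inner_axis)
    finally have 1: "(\<Sum>i\<in>UNIV. D (axis i 1) \<bullet> (B *v (D (axis i 1)))) =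
        - (\<Sum>i\<in>UNIV. (C *v D (D (axis i 1))) $ i)" by (simp add: sum_negf)
    define c where "c = matrix D"
    have c: "D x = c *v x" for x unfolding c_def by (simp add: matrix_works lin)
    have diag: "(A *v axis i 1) $ i = A $ i $ i" for A :: "real ^ 'n ^ 'n" and i
      by (simp add: matrix_vector_mult_basis column_def)
    have "(\<Sum>i\<in>UNIV. (C *v D (D (axis i 1))) $ i) = trace (C ** c ** c)"
      by (simp only: c matrix_vector_mul_assoc trace_def diag matrix_mul_assoc)
    also have "\<dots> = trace (c ** C ** c)"
      by (metis matrix_mul_assoc trace_mul_sym)
    also have "\<dots> = (\<Sum>i\<in>UNIV. D (C *v (D (axis i 1))) $ i)"
      by (simp only: c matrix_vector_mul_assoc trace_def diag matrix_mul_assoc)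
    also have "\<dots> = (\<Sum>i\<in>UNIV. D (axis i 1) \<bullet> (C *v (D (axis i 1))))"
    proof (rule sum.cong[OF refl])
      fix i
      have "D (C *v D (axis i 1)) $ i = axis i 1 \<bullet> D (C *v D (axis i 1))" by (simp add: inner_axis')
      then show "D (C *v D (axis i 1)) $ i = D (axis i 1) \<bullet> (C *v (D (axis i 1)))" by (simp add: sym)
    qed
    finally show ?thesis using 1 by simp
  qed
  have nonneg: "0 \<le> v \<bullet> (A *v v)" if "pos_def A" for A :: "real ^ 'n ^ 'n" and v
    using that by (cases "v = 0") (auto simp: pos_def_def less_imp_le)
  have "(\<Sum>i\<in>UNIV. D (axis i 1) \<bullet> (B *v (D (axis i 1)))) = 0"
    using tr sum_nonneg[of UNIV "\<lambda>i. D (axis i 1) \<bullet> (B *v (D (axis i 1)))"]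
      sum_nonneg[of UNIV "\<lambda>i. D (axis i 1) \<bullet> (C *v (D (axis i 1)))"] nonneg[OF B] nonneg[OF C]
    by (smt (verit))
  then have "\<forall>i\<in>UNIV. D (axis i 1) \<bullet> (B *v (D (axis i 1))) = 0"
    by (subst (asm) sum_nonneg_eq_0_iff) (auto intro: nonneg[OF B])
  then have "D (axis i 1) = 0" for i using B by (metis UNIV_I less_irrefl pos_def_def)
  then have "column i B = column i C" for i by (simp add: D_def matrix_vector_mult_basis)
  then show ?thesis by (simp add: vec_eq_iff column_def)
qed

text \<open>Scale so that \<open>C = I - A / c\<close> has norm below 1, and look for the root in the form
  \<open>sqrt c (I - Z)\<close>. Its square is \<open>A\<close> exactly if \<open>Z = (C + Z\<^sup>2) / 2\<close>. The right-hand side is a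
  contraction of a small ball of symmetric operators, so that a solution exists by the Banach
  fixed point theorem; smallness of \<open>Z\<close> makes the root positive definite. This avoids
  diagonalisation.\<close>

lemma pos_def_sqrt_exists:
  fixes A :: "real ^ 'n::finite ^ 'n"
  assumes A: "pos_def A"
  shows "\<exists>B. pos_def B \<and> B ** B = A"
proof -
  obtain a where a: "a > 0" "\<And>v. a * (norm v)\<^sup>2 \<le> v \<bullet> (A *v v)" using pos_def_coercive[OF A] by blast
  obtain K where K: "\<And>v. norm (A *v v) \<le> norm v * K" "K > 0"
    using bounded_linear.pos_bounded[OF matrix_vector_mul_bounded_linear[of A]] by blast
  \<comment> \<open>With \<open>a \<le> A \<le> K\<close> in the sense of forms and norms, \<open>norm (v - A v / c)\<^sup>2 \<le> (1 - 2 a / c +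
    K\<^sup>2 / c\<^sup>2) norm v\<^sup>2\<close>; this value of \<open>c\<close> minimises the factor, and \<open>q\<close> is the minimum.\<close>
  define c where "c = K\<^sup>2 / a"
  define q where "q = 1 - a\<^sup>2 / K\<^sup>2"
  have c: "c > 0" using a K by (simp add: c_def)
  define C where "C = Blinfun (\<lambda>v. v - (1/c) *\<^sub>R (A *v v))"
  have C: "blinfun_apply C v = v - (1/c) *\<^sub>R (A *v v)" for v
    unfolding C_def by (subst bounded_linear_Blinfun_apply)
      (auto intro!: bounded_linear_intros matrix_vector_mul_bounded_linear)
  have Cn: "(norm (C v))\<^sup>2 \<le> q * (norm v)\<^sup>2" for v
  proof -
    have "(norm (C v))\<^sup>2 = (norm v)\<^sup>2 - 2 * (v \<bullet> (A *v v)) / c + (norm (A *v v))\<^sup>2 / c\<^sup>2"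
      unfolding C power2_norm_eq_inner
      by (simp add: inner_diff_left inner_diff_right inner_commute power2_eq_square)
    also have "\<dots> \<le> (norm v)\<^sup>2 - 2 * (a * (norm v)\<^sup>2) / c + (norm v * K)\<^sup>2 / c\<^sup>2"
      using c a(2)[of v] power_mono[OF K(1) norm_ge_zero, of v 2] K
      by (intro add_mono diff_mono divide_right_mono) auto
    also have "\<dots> = q * (norm v)\<^sup>2"
      using a K by (simp add: c_def q_def field_simps power2_eq_square)
    finally show ?thesis .
  qed
  have q: "0 \<le> q" "q < 1"
  proof -
    have "0 \<le> (norm (C (axis undefined 1)))\<^sup>2" by (rule zero_le_power2)
    also have "\<dots> \<le> q" using Cn[of "axis undefined 1"] by simp
    finally show "0 \<le> q" .
    show "q < 1" using a K by (simp add: q_def)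
  qed
  have nC: "norm C \<le> sqrt q"
  proof (rule norm_blinfun_bound)
    fix v show "norm (C v) \<le> sqrt q * norm v"
      using real_sqrt_le_mono[OF Cn[of v]] by (simp add: real_sqrt_mult)
  qed (use q in simp)
  \<comment> \<open>The smaller root of \<open>r\<^sup>2 - 2 r + sqrt q = 0\<close>, so that the bound \<open>(sqrt q + r\<^sup>2) / 2\<close> for
    the image of the ball of radius \<open>r\<close> equals \<open>r\<close>; the Lipschitz constant on this ball is
    \<open>r < 1\<close>.\<close>
  define r where "r = 1 - sqrt (1 - sqrt q)"
  have sq1: "0 \<le> sqrt q" "sqrt q < 1" using q by auto
  have r: "0 \<le> r" "r < 1" "sqrt q + r * r = 2 * r"
  proof -
    have "(sqrt (1 - sqrt q))\<^sup>2 = 1 - sqrt q" using sq1 by simp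
    then show "sqrt q + r * r = 2 * r" by (simp add: r_def power2_eq_square algebra_simps)
    show "0 \<le> r" "r < 1" using sq1 by (auto simp: r_def)
  qed
  define S where "S = {Z :: (real^'n) \<Rightarrow>\<^sub>L (real^'n). norm Z \<le> r \<and> (\<forall>x y. x \<bullet> blinfun_apply Z y = blinfun_apply Z x \<bullet> y)}"
  define \<Phi> where "\<Phi> Z = (1/2) *\<^sub>R (C + (Z o\<^sub>L Z))" for Z
  have "closed S"
  proof -
    have "S = cball 0 r \<inter> (\<Inter>x y. {Z. x \<bullet> blinfun_apply Z y = blinfun_apply Z x \<bullet> y})"
      by (auto simp: S_def)
    moreover have "closed {Z. x \<bullet> blinfun_apply Z y = blinfun_apply Z x \<bullet> y}" for x y :: "real^'n"
      by (intro closed_Collect_eq continuous_intros)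
    ultimately show ?thesis by (auto intro!: closed_Int closed_INT)
  qed
  then have "Topological_Spaces.complete S" by (simp add: complete_eq_closed)
  moreover have "S \<noteq> {}" using r by (auto simp: S_def intro!: exI[of _ 0])
  moreover have "\<Phi> ` S \<subseteq> S"
  proof safe
    fix Z assume Z: "Z \<in> S"
    have "norm (\<Phi> Z) \<le> (norm C + norm (Z o\<^sub>L Z)) / 2"
      using norm_triangle_ineq[of C "Z o\<^sub>L Z"] by (simp add: \<Phi>_def)
    also have "\<dots> \<le> (sqrt q + r * r) / 2"
      using Z nC norm_blinfun_compose[of Z Z] mult_mono[of "norm Z" r "norm Z" r] r
      by (auto simp: S_def)
    finally have "norm (\<Phi> Z) \<le> r" using r by simp
    moreover have "x \<bullet> C y = C x \<bullet> y" for x y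
      by (simp add: C inner_diff_left inner_diff_right pos_def_inner[OF A])
    then have "x \<bullet> \<Phi> Z y = \<Phi> Z x \<bullet> y" for x y
      using Z by (simp add: \<Phi>_def S_def blinfun.add_left blinfun.scaleR_left inner_add_left inner_add_right)
    ultimately show "\<Phi> Z \<in> S" by (simp add: S_def)
  qed
  moreover have "dist (\<Phi> Z) (\<Phi> Z') \<le> r * dist Z Z'" if "Z \<in> S" "Z' \<in> S" for Z Z'
  proof -
    have "\<Phi> Z - \<Phi> Z' = (1/2) *\<^sub>R ((Z o\<^sub>L (Z - Z')) + ((Z - Z') o\<^sub>L Z'))"
      by (rule blinfun_eqI) (simp add: \<Phi>_def blinfun.bilinear_simps scaleR_diff_right scaleR_add_right)
    then have "norm (\<Phi> Z - \<Phi> Z') \<le> (norm (Z o\<^sub>L (Z - Z')) + norm ((Z - Z') o\<^sub>L Z')) / 2"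
      using norm_triangle_ineq[of "Z o\<^sub>L (Z - Z')" "(Z - Z') o\<^sub>L Z'"] by simp
    also have "\<dots> \<le> (r * norm (Z - Z') + norm (Z - Z') * r) / 2"
    proof -
      have "norm Z \<le> r" "norm Z' \<le> r" using that by (auto simp: S_def)
      then show ?thesis
        using norm_blinfun_compose[of Z "Z - Z'"] norm_blinfun_compose[of "Z - Z'" Z']
          mult_right_mono[of "norm Z" r "norm (Z - Z')"] mult_left_mono[of "norm Z'" r "norm (Z - Z')"]
        by (simp add: mult.commute[of r])
    qed
    finally show ?thesis by (simp add: dist_norm)
  qed
  ultimately obtain Z where Z: "Z \<in> S" "\<Phi> Z = Z" using r Banach_fix[of S r \<Phi>] by blast
  have fix2: "C v + Z (Z v) = 2 *\<^sub>R Z v" for v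
  proof -
    have "blinfun_apply (\<Phi> Z) v = (1/2) *\<^sub>R (C v + Z (Z v))"
      by (simp add: \<Phi>_def blinfun.bilinear_simps)
    then have "2 *\<^sub>R blinfun_apply (\<Phi> Z) v = C v + Z (Z v)" by simp
    then show ?thesis by (simp only: Z(2))
  qed
  define B where "B = matrix (\<lambda>v. sqrt c *\<^sub>R (v - Z v))"
  have B: "B *v v = sqrt c *\<^sub>R (v - Z v)" for v
  proof -
    have "linear (\<lambda>v. sqrt c *\<^sub>R (v - Z v))"
      by (intro bounded_linear.linear bounded_linear_intros blinfun.bounded_linear_right)
    then show ?thesis unfolding B_def by (simp add: matrix_works)
  qed
  have "B *v (B *v v) = A *v v" for v
  proof -
    have "B *v (B *v v) = c *\<^sub>R (v - 2 *\<^sub>R Z v + Z (Z v))"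
      using c by (simp add: B blinfun.bilinear_simps algebra_simps scaleR_2)
    also have "\<dots> = c *\<^sub>R (v - C v)" using arg_cong[OF fix2[of v], of "(*\<^sub>R) c"] by (simp add: algebra_simps)
    also have "\<dots> = A *v v" using c by (simp add: C)
    finally show ?thesis .
  qed
  then have "B ** B = A" by (metis matrix_eq matrix_vector_mul_assoc)
  moreover have "pos_def B"
    unfolding pos_def_def
  proof (intro conjI allI impI)
    show "transpose B = B"
      by (rule symmetric_matrixI) (use Z(1) in \<open>simp add: B S_def inner_diff_left inner_diff_right\<close>)
    fix v :: "real^'n" assume v: "v \<noteq> 0"
    have "v \<bullet> Z v \<le> norm v * norm (Z v)" by (rule norm_cauchy_schwarz)
    also have "\<dots> \<le> norm v * (r * norm v)"
      using Z(1) norm_blinfun[of Z v] mult_right_mono[of "norm Z" r "norm v"]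
      by (intro mult_left_mono) (auto simp: S_def)
    also have "\<dots> < norm v * norm v" using r v by simp
    finally have "v \<bullet> Z v < v \<bullet> v" by (simp add: dot_square_norm power2_eq_square)
    then show "0 < v \<bullet> (B *v v)" using c by (simp add: B inner_diff_right)
  qed
  ultimately show ?thesis by blast
qed

lemma inv_sqrt_matrix:
  fixes A :: "real ^ 'n::finite ^ 'n"
  assumes A: "pos_def A"
  shows "pos_def (inv_sqrt_matrix A)" "inv_sqrt_matrix A ** inv_sqrt_matrix A = matrix_inv A"
proof -
  have "\<exists>!B. pos_def B \<and> B ** B = matrix_inv A"
    using pos_def_sqrt_exists[OF pos_def_matrix_inv[OF A]] pos_def_sqrt_unique by metis
  from theI'[OF this] show "pos_def (inv_sqrt_matrix A)"
    "inv_sqrt_matrix A ** inv_sqrt_matrix A = matrix_inv A"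
    by (simp_all add: inv_sqrt_matrix_def)
qed

text \<open>In matrix form this is \<open>S A S = I\<close> for \<open>S = A\<^sup>-\<^sup>1\<^sup>/\<^sup>2\<close>; it will make the limiting
  covariance matrix the identity.\<close>

lemma inv_sqrt_matrix_sandwich:
  fixes A :: "real ^ 'n::finite ^ 'n"
  assumes A: "pos_def A"
  shows "(inv_sqrt_matrix A *v t) \<bullet> (A *v (inv_sqrt_matrix A *v t)) = t \<bullet> t"
proof -
  let ?S = "inv_sqrt_matrix A"
  have SS: "?S ** ?S ** A = mat 1"
    using matrix_inv_works[OF pos_def_invertible[OF A]] by (simp add: inv_sqrt_matrix[OF A])
  then have "?S ** (?S ** A) = mat 1" by (simp add: matrix_mul_assoc)
  then have "?S ** A ** ?S = mat 1" by (simp add: matrix_left_right_inverse)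
  then have "?S *v (A *v (?S *v t)) = t" by (simp add: matrix_vector_mul_assoc matrix_mul_assoc)
  then show ?thesis using pos_def_inner[OF inv_sqrt_matrix(1)[OF A], of t "A *v (?S *v t)"] by simp
qed

lemma inv_sqrt_matrix_bound:
  fixes A :: "real ^ 'n::finite ^ 'n"
  assumes A: "pos_def A" and a: "0 < a" "\<And>v. a * (norm v)\<^sup>2 \<le> v \<bullet> (A *v v)"
  shows "norm (inv_sqrt_matrix A *v t) \<le> norm t / sqrt a"
proof -
  have "a * (norm (inv_sqrt_matrix A *v t))\<^sup>2 \<le> (norm t)\<^sup>2"
    using a(2)[of "inv_sqrt_matrix A *v t"] inv_sqrt_matrix_sandwich[OF A, of t]
    by (simp add: dot_square_norm)
  then have "sqrt (a * (norm (inv_sqrt_matrix A *v t))\<^sup>2) \<le> norm t"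
    using real_le_lsqrt by (metis norm_ge_zero real_sqrt_abs real_sqrt_le_mono abs_norm_cancel)
  then show ?thesis using a(1) by (simp add: real_sqrt_mult field_simps)
qed

text \<open>If \<open>v \<bullet> A v = 0\<close> and \<open>u = A v\<close>, the nonnegative quadratic polynomial
  \<open>t \<mapsto> (v + t u) \<bullet> A (v + t u)\<close> vanishes at 0, so that its linear coefficient \<open>2 u \<bullet> u\<close> is 0,
  and \<open>A v = 0\<close> contradicts invertibility.\<close>

lemma psd_invertible_imp_pos_def:
  fixes A :: "real ^ 'n::finite ^ 'n"
  assumes sym: "transpose A = A" and psd: "\<And>v. 0 \<le> v \<bullet> (A *v v)" and inv: "invertible A"
  shows "pos_def A"
  unfolding pos_def_def
proof (intro conjI allI impI sym)
  fix v :: "real ^ 'n" assume "v \<noteq> 0"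
  show "0 < v \<bullet> (A *v v)"
  proof (rule ccontr)
    assume "\<not> 0 < v \<bullet> (A *v v)"
    then have 0: "v \<bullet> (A *v v) = 0" using psd[of v] by simp
    define u where "u = A *v v"
    have pos: "0 \<le> t * (2 * (u \<bullet> u) + t * (u \<bullet> (A *v u)))" for t
    proof -
      have "0 \<le> (v + t *\<^sub>R u) \<bullet> (A *v (v + t *\<^sub>R u))" by (rule psd)
      also have "\<dots> = t * (2 * (u \<bullet> u) + t * (u \<bullet> (A *v u)))"
        using 0 symmetric_matrix_inner[OF sym, of v u]
        by (simp add: u_def matrix_vector_right_distrib matrix_vector_mult_scaleR inner_add_left
            inner_add_right algebra_simps)
      finally show ?thesis .
    qed
    have "u \<bullet> u = 0"
    proof (rule ccontr)
      assume "u \<bullet> u \<noteq> 0"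
      then have uu: "u \<bullet> u > 0" by simp
      \<comment> \<open>A negative \<open>t\<close> so small that the linear term outweighs the quadratic one; the 1 avoids
        division by 0.\<close>
      define t where "t = - (u \<bullet> u) / (u \<bullet> (A *v u) + 1)"
      have q: "0 \<le> u \<bullet> (A *v u)" by (rule psd)
      then have t: "t < 0" using uu by (simp add: t_def divide_neg_pos)
      have "- t * (u \<bullet> (A *v u)) \<le> u \<bullet> u"
        using q uu by (simp add: t_def field_simps)
      then have "2 * (u \<bullet> u) + t * (u \<bullet> (A *v u)) > 0" using uu by linarith
      then have "t * (2 * (u \<bullet> u) + t * (u \<bullet> (A *v u))) < 0" using t by (simp add: mult_neg_pos)
      then show False using pos[of t] by simp
    qed
    then have "A *v v = 0" by (simp add: u_def)
    then show False
      using \<open>v \<noteq> 0\<close> inv by (metis invertible_left_inverse matrix_left_invertible_ker)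
  qed
qed

lemma cov_matrix_quadratic_form:
  fixes Z :: "'w \<Rightarrow> real ^ 'd::finite"
  assumes Z: "finite_second_moment M Z" and mean: "\<And>i. (\<integral>\<omega>. Z \<omega> $ i \<partial>M) = 0"
  shows "transpose (cov_matrix M Z) = cov_matrix M Z"
    and "u \<bullet> (cov_matrix M Z *v u) = (\<integral>\<omega>. (u \<bullet> Z \<omega>)\<^sup>2 \<partial>M)"
    and "integrable M (\<lambda>\<omega>. (norm (Z \<omega>))\<^sup>2)"
    and "Z \<in> borel_measurable M"
proof -
  have Zm: "(\<lambda>\<omega>. Z \<omega> $ i) \<in> borel_measurable M" and Z2: "integrable M (\<lambda>\<omega>. (Z \<omega> $ i)\<^sup>2)" for i
    using Z by (auto simp: finite_second_moment_def)
  have prod: "integrable M (\<lambda>\<omega>. Z \<omega> $ i * Z \<omega> $ j)" for i j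
  proof (rule Bochner_Integration.integrable_bound)
    show "integrable M (\<lambda>\<omega>. (Z \<omega> $ i)\<^sup>2 + (Z \<omega> $ j)\<^sup>2)" using Z2 by simp
    show "AE \<omega> in M. norm (Z \<omega> $ i * Z \<omega> $ j) \<le> norm ((Z \<omega> $ i)\<^sup>2 + (Z \<omega> $ j)\<^sup>2)"
    proof (rule AE_I2)
      fix \<omega>
      have "2 * (\<bar>Z \<omega> $ i\<bar> * \<bar>Z \<omega> $ j\<bar>) \<le> (Z \<omega> $ i)\<^sup>2 + (Z \<omega> $ j)\<^sup>2"
        using sum_squares_bound[of "\<bar>Z \<omega> $ i\<bar>" "\<bar>Z \<omega> $ j\<bar>"] by simp
      moreover have "0 \<le> \<bar>Z \<omega> $ i\<bar> * \<bar>Z \<omega> $ j\<bar>" by simp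
      ultimately have "\<bar>Z \<omega> $ i\<bar> * \<bar>Z \<omega> $ j\<bar> \<le> (Z \<omega> $ i)\<^sup>2 + (Z \<omega> $ j)\<^sup>2" by linarith
      then show "norm (Z \<omega> $ i * Z \<omega> $ j) \<le> norm ((Z \<omega> $ i)\<^sup>2 + (Z \<omega> $ j)\<^sup>2)"
        by (simp add: abs_mult)
    qed
  qed (use Zm in simp)
  have cov: "cov_matrix M Z $ i $ j = (\<integral>\<omega>. Z \<omega> $ i * Z \<omega> $ j \<partial>M)" for i j
    by (simp add: cov_matrix_def mean)
  show "transpose (cov_matrix M Z) = cov_matrix M Z"
    by (simp add: vec_eq_iff transpose_def cov mult.commute)
  have "u \<bullet> (cov_matrix M Z *v u) = (\<Sum>i\<in>UNIV. \<Sum>j\<in>UNIV. u $ i * (u $ j * (\<integral>\<omega>. Z \<omega> $ i * Z \<omega> $ j \<partial>M)))"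
    by (simp add: inner_vec_def matrix_vector_mult_def cov sum_distrib_left mult_ac)
  also have "\<dots> = (\<integral>\<omega>. (\<Sum>i\<in>UNIV. \<Sum>j\<in>UNIV. u $ i * (u $ j * (Z \<omega> $ i * Z \<omega> $ j))) \<partial>M)"
    using prod by (simp add: Bochner_Integration.integral_sum)
  also have "\<dots> = (\<integral>\<omega>. (u \<bullet> Z \<omega>)\<^sup>2 \<partial>M)"
    by (intro Bochner_Integration.integral_cong refl)
      (simp add: inner_vec_def power2_eq_square sum_product mult_ac)
  finally show "u \<bullet> (cov_matrix M Z *v u) = (\<integral>\<omega>. (u \<bullet> Z \<omega>)\<^sup>2 \<partial>M)" .
  have "(norm (Z \<omega>))\<^sup>2 = (\<Sum>i\<in>UNIV. (Z \<omega> $ i)\<^sup>2)" for \<omega>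
    unfolding power2_norm_eq_inner inner_vec_def by (simp add: power2_eq_square)
  then show "integrable M (\<lambda>\<omega>. (norm (Z \<omega>))\<^sup>2)" using Z2 by simp
  have "(\<lambda>\<omega>. \<Sum>i\<in>UNIV. Z \<omega> $ i *\<^sub>R (axis i 1 :: real ^ 'd)) \<in> borel_measurable M"
    using Zm by (intro borel_measurable_sum borel_measurable_scaleR) auto
  moreover have "(\<Sum>i\<in>UNIV. z $ i *\<^sub>R axis i 1) = z" for z :: "real ^ 'd"
    by (simp add: vec_eq_iff axis_def if_distrib cong: if_cong)
  ultimately show "Z \<in> borel_measurable M" by simp
qed

lemma cov_matrix_pos_def:
  fixes Z :: "'w \<Rightarrow> real ^ 'd::finite"
  assumes "finite_second_moment M Z" "\<And>i. (\<integral>\<omega>. Z \<omega> $ i \<partial>M) = 0" "invertible (cov_matrix M Z)"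
  shows "pos_def (cov_matrix M Z)"
  using cov_matrix_quadratic_form[OF assms(1,2)] assms(3)
  by (intro psd_invertible_imp_pos_def) simp_all

text \<open>\<open>V / n + W / m\<close> is at least \<open>c / min m n\<close> times the identity, where \<open>c\<close> is a common lower
  bound for \<open>V\<close> and \<open>W\<close>. The constant \<open>K\<close> is uniform in \<open>m\<close> and \<open>n\<close>: the norming matrix is of
  order \<open>sqrt (min m n)\<close> however the sample sizes are related.\<close>

lemma pooled_covariance:
  fixes V W :: "real ^ 'd::finite ^ 'd"
  assumes V: "pos_def V" and W: "pos_def W"
  shows "\<exists>K>0. \<forall>m n. 0 < m \<longrightarrow> 0 < n \<longrightarrow> pos_def ((1 / real n) *\<^sub>R V + (1 / real m) *\<^sub>R W) \<and>
     (\<forall>t. norm (inv_sqrt_matrix ((1 / real n) *\<^sub>R V + (1 / real m) *\<^sub>R W) *v t)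
        \<le> K * sqrt (real (min m n)) * norm t)"
proof -
  obtain a where a: "a > 0" "\<And>v. a * (norm v)\<^sup>2 \<le> v \<bullet> (V *v v)" using pos_def_coercive[OF V] by blast
  obtain b where b: "b > 0" "\<And>v. b * (norm v)\<^sup>2 \<le> v \<bullet> (W *v v)" using pos_def_coercive[OF W] by blast
  define c where "c = min a b"
  have c: "c > 0" using a b by (simp add: c_def)
  have "pos_def ((1 / real n) *\<^sub>R V + (1 / real m) *\<^sub>R W) \<and>
     (\<forall>t. norm (inv_sqrt_matrix ((1 / real n) *\<^sub>R V + (1 / real m) *\<^sub>R W) *v t)
        \<le> (1 / sqrt c) * sqrt (real (min m n)) * norm t)" if mn: "0 < m" "0 < n" for m n :: nat
  proof -
    let ?S = "(1 / real n) *\<^sub>R V + (1 / real m) *\<^sub>R W"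
    let ?l = "c / real (min m n)"
    have l: "?l > 0" using c mn by simp
    have Sv: "v \<bullet> (?S *v v) = (v \<bullet> (V *v v)) / real n + (v \<bullet> (W *v v)) / real m" for v
      by (simp add: matrix_vector_mult_add_rdistrib scaleR_matrix_vector_assoc[symmetric] inner_add_right)
    have low: "?l * (norm v)\<^sup>2 \<le> v \<bullet> (?S *v v)" for v
    proof -
      have v2: "c * (norm v)\<^sup>2 \<le> v \<bullet> (V *v v)" "c * (norm v)\<^sup>2 \<le> v \<bullet> (W *v v)"
        using a(2)[of v] b(2)[of v] mult_right_mono[of c a "(norm v)\<^sup>2"] mult_right_mono[of c b "(norm v)\<^sup>2"]
        by (auto simp: c_def)
      have nn: "0 \<le> c * (norm v)\<^sup>2" using c by simp
      have "c * (norm v)\<^sup>2 / real n \<le> (v \<bullet> (V *v v)) / real n" "c * (norm v)\<^sup>2 / real m \<le> (v \<bullet> (W *v v)) / real m"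
        using v2 by (simp_all add: divide_right_mono)
      moreover have "0 \<le> c * (norm v)\<^sup>2 / real n" "0 \<le> c * (norm v)\<^sup>2 / real m" using nn by simp_all
      moreover have "c * (norm v)\<^sup>2 / real (min m n) = c * (norm v)\<^sup>2 / real m \<or> c * (norm v)\<^sup>2 / real (min m n) = c * (norm v)\<^sup>2 / real n"
        by (simp add: min_def)
      ultimately show ?thesis unfolding Sv by auto
    qed
    have "transpose ?S = ?S" using V W by (simp add: pos_def_def transpose_def vec_eq_iff)
    moreover have "v \<bullet> (?S *v v) > 0" if "v \<noteq> 0" for v
      using low[of v] l that by (meson less_le_trans mult_pos_pos zero_less_norm_iff zero_less_power)
    ultimately have pd: "pos_def ?S" by (simp add: pos_def_def)
    have "norm (inv_sqrt_matrix ?S *v t) \<le> (1 / sqrt c) * sqrt (real (min m n)) * norm t" for t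
      using inv_sqrt_matrix_bound[OF pd l low, of t] by (simp add: real_sqrt_divide mult.commute)
    with pd show ?thesis by blast
  qed
  then show ?thesis using c by (intro exI[of _ "1 / sqrt c"]) auto
qed

section \<open>Events of high probability\<close>

text \<open>For large \<open>k\<close>, the property \<open>Q k\<close> holds outside an event of probability at most \<open>\<epsilon>\<close>. The
  exceptional event is measurable although \<open>Q k\<close> itself may not be; this fits outer
  probabilities, and a finite number of such statements can be combined by adding their error
  probabilities. Convergence in probability to 0 of \<open>Z\<close> says that \<open>whp M \<epsilon>\<close> holds for
  \<open>norm (Z k) \<le> \<delta>\<close> whatever \<open>\<epsilon>\<close> and \<open>\<delta>\<close> are; stochastic boundedness, that for every \<open>\<epsilon>\<close> it holds
  for \<open>norm (Z k) \<le> C\<close> with some \<open>C\<close>.\<close>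

definition whp :: "'w measure \<Rightarrow> real \<Rightarrow> (nat \<Rightarrow> 'w \<Rightarrow> bool) \<Rightarrow> bool" where
  "whp M \<epsilon> Q \<longleftrightarrow>
     (\<forall>\<^sub>F k in sequentially. \<exists>B\<in>sets M. measure M B \<le> \<epsilon> \<and> (\<forall>\<omega>\<in>space M - B. Q k \<omega>))"

lemma whp_mono:
  assumes "whp M \<epsilon> Q" "\<And>k \<omega>. \<omega> \<in> space M \<Longrightarrow> Q k \<omega> \<Longrightarrow> R k \<omega>" "\<epsilon> \<le> \<epsilon>'"
  shows "whp M \<epsilon>' R"
  using assms(1) unfolding whp_def
proof (rule eventually_mono)
  fix k assume "\<exists>B\<in>sets M. measure M B \<le> \<epsilon> \<and> (\<forall>\<omega>\<in>space M - B. Q k \<omega>)"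
  then obtain B where "B \<in> sets M" "measure M B \<le> \<epsilon>" "\<forall>\<omega>\<in>space M - B. Q k \<omega>" by blast
  then show "\<exists>B\<in>sets M. measure M B \<le> \<epsilon>' \<and> (\<forall>\<omega>\<in>space M - B. R k \<omega>)"
    using assms(2,3) by (intro bexI[of _ B]) auto
qed

lemma whp_mono_eventually:
  assumes "whp M \<epsilon> Q" "\<forall>\<^sub>F k in sequentially. \<forall>\<omega>\<in>space M. Q k \<omega> \<longrightarrow> R k \<omega>"
  shows "whp M \<epsilon> R"
  using assms(1)[unfolded whp_def] assms(2) unfolding whp_def by eventually_elim blast

lemma whp_conj:
  assumes "prob_space M" "whp M \<epsilon> Q" "whp M \<epsilon>' R"
  shows "whp M (\<epsilon> + \<epsilon>') (\<lambda>k \<omega>. Q k \<omega> \<and> R k \<omega>)"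
  using assms(2,3)[unfolded whp_def] unfolding whp_def
proof eventually_elim
  case (elim k)
  interpret prob_space M by fact
  from elim obtain B C where "B \<in> sets M" "measure M B \<le> \<epsilon>" "\<forall>\<omega>\<in>space M - B. Q k \<omega>"
    "C \<in> sets M" "measure M C \<le> \<epsilon>'" "\<forall>\<omega>\<in>space M - C. R k \<omega>" by blast
  then show ?case
    by (intro bexI[of _ "B \<union> C"]) (auto intro: order_trans[OF measure_Un_le add_mono])
qed

lemma whp_conj_list:
  assumes "prob_space M" "list_all (\<lambda>Q. whp M \<epsilon> Q) Qs" "0 \<le> \<epsilon>"
  shows "whp M (real (length Qs) * \<epsilon>) (\<lambda>k \<omega>. list_all (\<lambda>Q. Q k \<omega>) Qs)"
  using assms(2)
proof (induction Qs)
  case Nil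
  show ?case unfolding whp_def by (auto intro!: always_eventually bexI[of _ "{}"])
next
  case (Cons Q Qs)
  then have "whp M (\<epsilon> + real (length Qs) * \<epsilon>) (\<lambda>k \<omega>. Q k \<omega> \<and> list_all (\<lambda>Q. Q k \<omega>) Qs)"
    by (intro whp_conj assms) auto
  then show ?case by (simp add: algebra_simps)
qed

lemma whp_finite_all:
  assumes "prob_space M" "finite I" "\<And>i. i \<in> I \<Longrightarrow> whp M \<epsilon> (Q i)"
  shows "whp M (real (card I) * \<epsilon>) (\<lambda>k \<omega>. \<forall>i\<in>I. Q i k \<omega>)"
  using assms(2,3)
proof (induction I rule: finite_induct)
  case empty
  show ?case unfolding whp_def by (auto intro!: always_eventually bexI[of _ "{}"])
next
  case (insert x I)
  have "whp M \<epsilon> (Q x)" by (rule insert.prems) simp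
  moreover have "whp M (real (card I) * \<epsilon>) (\<lambda>k \<omega>. \<forall>i\<in>I. Q i k \<omega>)"
    by (rule insert.IH) (rule insert.prems, simp)
  ultimately have "whp M (\<epsilon> + real (card I) * \<epsilon>) (\<lambda>k \<omega>. Q x k \<omega> \<and> (\<forall>i\<in>I. Q i k \<omega>))"
    by (rule whp_conj[OF assms(1)])
  then show ?case using insert(1,2) by (simp add: algebra_simps)
qed

lemma whp_finite_all_UNIV:
  assumes "prob_space M" "\<epsilon> > 0" "\<And>i \<epsilon>. \<epsilon> > 0 \<Longrightarrow> whp M \<epsilon> (Q i)"
  shows "whp M \<epsilon> (\<lambda>k \<omega>. \<forall>i::'i::finite. Q i k \<omega>)"
  using whp_finite_all[OF assms(1) finite, of UNIV "\<epsilon> / real CARD('i)" Q] assms(2,3) by simp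

lemma whp_compose_index:
  assumes "whp M \<epsilon> Q" "filterlim m at_top sequentially"
  shows "whp M \<epsilon> (\<lambda>k. Q (m k))"
  using assms unfolding whp_def filterlim_iff by blast

lemma whp_AE:
  assumes "AE \<omega> in M. Q \<omega>" "0 \<le> \<epsilon>"
  shows "whp M \<epsilon> (\<lambda>k. Q)"
proof -
  obtain N where N: "{\<omega> \<in> space M. \<not> Q \<omega>} \<subseteq> N" "emeasure M N = 0" "N \<in> sets M"
    using AE_E[OF assms(1)] by blast
  then have "measure M N \<le> \<epsilon>" using assms(2) by (simp add: measure_def)
  then show ?thesis unfolding whp_def using N by (intro always_eventually allI bexI[of _ N]) auto
qed

lemma whp_distr:
  assumes "whp (distr M N g) \<epsilon> Q" "g \<in> measurable M N"
  shows "whp M \<epsilon> (\<lambda>k \<omega>. Q k (g \<omega>))"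
  using assms(1) unfolding whp_def
proof eventually_elim
  case (elim k)
  then obtain B where B: "B \<in> sets N" "measure (distr M N g) B \<le> \<epsilon>" "\<forall>\<omega>\<in>space N - B. Q k \<omega>" by auto
  have "measure M (g -` B \<inter> space M) \<le> \<epsilon>" using B assms(2) by (simp add: measure_distr)
  moreover have "g -` B \<inter> space M \<in> sets M" by (rule measurable_sets[OF assms(2) B(1)])
  moreover have "\<forall>\<omega>\<in>space M - (g -` B \<inter> space M). Q k (g \<omega>)"
    using B(3) measurable_space[OF assms(2)] by auto
  ultimately show ?case by blast
qed

lemma tendsto_in_prob_whp:
  assumes M: "prob_space M" and Z: "tendsto_in_prob M Z c sequentially" and "\<eta> > 0" "\<epsilon> > 0"
  shows "whp M \<epsilon> (\<lambda>k \<omega>. dist (Z k \<omega>) c \<le> \<eta>)"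
proof -
  interpret prob_space M by fact
  have "(\<lambda>k. outer_measure_of M {\<omega> \<in> space M. dist (Z k \<omega>) c > \<eta>}) \<longlonglongrightarrow> 0"
    using Z \<open>\<eta> > 0\<close> by (simp add: tendsto_in_prob_def)
  then have "\<forall>\<^sub>F k in sequentially. outer_measure_of M {\<omega> \<in> space M. dist (Z k \<omega>) c > \<eta>} < ennreal \<epsilon>"
    by (rule order_tendstoD) (use \<open>\<epsilon> > 0\<close> in simp)
  then show ?thesis unfolding whp_def
  proof eventually_elim
    case (elim k)
    obtain E where E: "E \<in> sets M" "{\<omega> \<in> space M. dist (Z k \<omega>) c > \<eta>} \<subseteq> E"
      "outer_measure_of M {\<omega> \<in> space M. dist (Z k \<omega>) c > \<eta>} = emeasure M E"
      using outer_measure_of_attain[of "{\<omega> \<in> space M. dist (Z k \<omega>) c > \<eta>}" M] by auto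
    then have "measure M E \<le> \<epsilon>"
      using elim \<open>\<epsilon> > 0\<close> by (simp add: emeasure_eq_measure ennreal_less_iff less_imp_le)
    then show ?case using E by (intro bexI[of _ E]) (auto simp: not_less)
  qed
qed

lemma tendsto_in_prob_compose:
  assumes "tendsto_in_prob M Z c F" "filterlim g F G"
  shows "tendsto_in_prob M (\<lambda>k. Z (g k)) c G"
  using assms(1) filterlim_compose[OF _ assms(2)] unfolding tendsto_in_prob_def by blast

text \<open>Almost sure convergence of the measurable majorants implies their convergence in
  probability, by dominated convergence applied to the indicators.\<close>

lemma outer_AS_tendsto_0_whp:
  assumes "prob_space M" "outer_AS_tendsto_0 M Z" "\<eta> > 0" "\<epsilon> > 0"
  shows "whp M \<epsilon> (\<lambda>m \<omega>. Z m \<omega> \<le> ennreal \<eta>)"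
proof -
  interpret prob_space M by fact
  obtain \<Delta> where \<Delta>[measurable]: "\<And>m. \<Delta> m \<in> borel_measurable M"
    and le: "\<And>m \<omega>. \<omega> \<in> space M \<Longrightarrow> Z m \<omega> \<le> \<Delta> m \<omega>"
    and lim: "AE \<omega> in M. (\<lambda>m. \<Delta> m \<omega>) \<longlonglongrightarrow> 0"
    using assms(2) unfolding outer_AS_tendsto_0_def by blast
  let ?B = "\<lambda>m. {\<omega>\<in>space M. \<Delta> m \<omega> > ennreal \<eta>}"
  have "(\<lambda>m. LINT \<omega>|M. indicator (?B m) \<omega>) \<longlonglongrightarrow> (LINT \<omega>|M. (0::real))"
  proof (rule integral_dominated_convergence[where w = "\<lambda>_. 1"])
    show "AE \<omega> in M. (\<lambda>m. indicator (?B m) \<omega> :: real) \<longlonglongrightarrow> 0"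
      using lim
    proof eventually_elim
      case (elim \<omega>)
      have "\<forall>\<^sub>F m in sequentially. \<Delta> m \<omega> < ennreal \<eta>"
        using order_tendstoD(2)[OF elim, of "ennreal \<eta>"] \<open>\<eta> > 0\<close> by simp
      then have "\<forall>\<^sub>F m in sequentially. (indicator (?B m) \<omega> :: real) = 0"
        by eventually_elim (auto simp: indicator_def)
      then show ?case by (rule tendsto_eventually)
    qed
  qed (auto simp: indicator_def)
  then have "(\<lambda>m. measure M (?B m)) \<longlonglongrightarrow> 0" by simp
  from order_tendstoD(2)[OF this \<open>\<epsilon> > 0\<close>] show ?thesis unfolding whp_def
  proof eventually_elim
    case (elim m)
    then show ?case
      by (intro bexI[of _ "?B m"]) (auto simp: not_less less_imp_le intro: order_trans[OF le])
  qed
qed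

text \<open>An almost sure statement holds along at least one path. Fixing such a path turns a uniform
  law of large numbers into a deterministic uniform approximation of means by finite averages.\<close>

lemma outer_AS_tendsto_0_path:
  assumes "prob_space M" "outer_AS_tendsto_0 M Z"
  shows "\<exists>\<omega>\<in>space M. \<forall>\<eta>>0. \<forall>\<^sub>F m in sequentially. Z m \<omega> \<le> ennreal \<eta>"
proof -
  interpret prob_space M by fact
  obtain \<Delta> where le: "\<And>m \<omega>. \<omega> \<in> space M \<Longrightarrow> Z m \<omega> \<le> \<Delta> m \<omega>"
    and lim: "AE \<omega> in M. (\<lambda>m. \<Delta> m \<omega>) \<longlonglongrightarrow> 0"
    using assms(2) unfolding outer_AS_tendsto_0_def by blast
  have "\<exists>\<omega>\<in>space M. (\<lambda>m. \<Delta> m \<omega>) \<longlonglongrightarrow> 0"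
  proof (rule ccontr)
    assume "\<not> ?thesis"
    then have "AE \<omega> in M. False" using lim by (auto elim!: AE_mp)
    then show False by simp
  qed
  then obtain \<omega> where \<omega>: "\<omega> \<in> space M" "(\<lambda>m. \<Delta> m \<omega>) \<longlonglongrightarrow> 0" by blast
  have "\<forall>\<^sub>F m in sequentially. Z m \<omega> \<le> ennreal \<eta>" if "\<eta> > 0" for \<eta>
  proof -
    have "\<forall>\<^sub>F m in sequentially. \<Delta> m \<omega> < ennreal \<eta>"
      using order_tendstoD(2)[OF \<omega>(2), of "ennreal \<eta>"] that by simp
    then show ?thesis
      by eventually_elim (use le[OF \<omega>(1)] in \<open>auto intro: order_trans less_imp_le\<close>)
  qed
  with \<omega>(1) show ?thesis by blast
qed

lemma whp_imp_exists:
  assumes "prob_space M" "whp M \<epsilon> Q" "\<epsilon> < 1"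
  shows "\<exists>k. \<exists>\<omega>\<in>space M. Q k \<omega>"
proof -
  interpret prob_space M by fact
  from eventually_happens'[OF sequentially_bot assms(2)[unfolded whp_def]]
  obtain k B where B: "B \<in> sets M" "measure M B \<le> \<epsilon>" "\<forall>\<omega>\<in>space M - B. Q k \<omega>" by blast
  have "space M - B \<noteq> {}"
  proof
    assume "space M - B = {}"
    then have "B = space M" using B(1) sets.sets_into_space by blast
    then show False using B(2) assms(3) prob_space by simp
  qed
  then show ?thesis using B(3) by blast
qed

section \<open>Empirical measures, Glivenko--Cantelli and Donsker families\<close>

lemma empirical_bound:
  assumes "\<And>z. \<bar>u z\<bar> \<le> b" shows "\<bar>empirical y n u\<bar> \<le> b"
proof -
  have "0 \<le> b" using assms[of undefined] by linarith
  have "\<bar>\<Sum>j<n. u (y j)\<bar> \<le> (\<Sum>j<n. b)" by (rule order_trans[OF sum_abs]) (intro sum_mono assms)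
  then have "\<bar>\<Sum>j<n. u (y j)\<bar> / real n \<le> (\<Sum>j<n. b) / real n" by (rule divide_right_mono) simp
  also have "\<dots> \<le> b" using \<open>0 \<le> b\<close> by simp
  finally show ?thesis by (simp add: empirical_def)
qed

lemma empirical_diff: "empirical y n u - empirical y n v = empirical y n (\<lambda>z. u z - v z)"
  by (simp add: empirical_def sum_subtractf diff_divide_distrib)

lemma empirical_cmult: "c * empirical y n u = empirical y n (\<lambda>z. c * u z)"
  by (simp add: empirical_def sum_distrib_left)

lemma SUP_ennreal_abs_le_iff:
  assumes "0 \<le> \<eta>"
  shows "(SUP \<phi>\<in>F. ennreal \<bar>a \<phi>\<bar>) \<le> ennreal \<eta> \<longleftrightarrow> (\<forall>\<phi>\<in>F. \<bar>a \<phi>\<bar> \<le> \<eta>)"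
  using assms by (simp add: SUP_le_iff)

lemma prob_space_iid_space: "prob_space P \<Longrightarrow> prob_space (iid_space P)"
  by (intro prob_space_PiM)

lemma iid_seq_measurable:
  assumes "prob_space M" "iid_seq M P X"
  shows "X i \<in> measurable M P"
  using assms by (auto simp: iid_seq_def prob_space.indep_vars_def)

text \<open>The Glivenko--Cantelli and Donsker properties are defined on the canonical sample space
  \<open>iid_space\<close>; by equality of distributions they carry over to samples on any probability space
  (\<open>whp_iid\<close>).\<close>

lemma iid_seq_process:
  assumes M: "prob_space M" and X: "iid_seq M P X"
  shows "(\<lambda>\<omega> i. X i \<omega>) \<in> measurable M (iid_space P)"
    and "distr M (iid_space P) (\<lambda>\<omega> i. X i \<omega>) = iid_space P"
proof -
  interpret prob_space M by fact
  show "(\<lambda>\<omega> i. X i \<omega>) \<in> measurable M (iid_space P)"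
    by (rule measurable_PiM_single') (use iid_seq_measurable[OF M X] in \<open>auto dest: measurable_space\<close>)
  have "indep_vars (\<lambda>_. P) X UNIV" using X by (simp add: iid_seq_def)
  then show "distr M (iid_space P) (\<lambda>\<omega> i. X i \<omega>) = iid_space P"
    using X iid_seq_measurable[OF M X]
    by (subst (asm) indep_vars_iff_distr_eq_PiM) (auto simp: iid_seq_def restrict_UNIV)
qed

lemma whp_iid:
  assumes "prob_space M" "iid_seq M P X" "whp (iid_space P) \<epsilon> Q"
  shows "whp M \<epsilon> (\<lambda>k \<omega>. Q k (\<lambda>i. X i \<omega>))"
  using whp_distr[of M "iid_space P" "\<lambda>\<omega> i. X i \<omega>"] iid_seq_process[OF assms(1,2)] assms(3) by simp

lemma glivenko_cantelli_whp:
  assumes "prob_space P" "glivenko_cantelli P F" "\<eta> > 0" "\<epsilon> > 0"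
  shows "whp (iid_space P) \<epsilon> (\<lambda>m x. \<forall>\<phi>\<in>F. \<bar>empirical x m \<phi> - (\<integral>z. \<phi> z \<partial>P)\<bar> \<le> \<eta>)"
proof -
  have "outer_AS_tendsto_0 (iid_space P)
       (\<lambda>m x. SUP \<phi>\<in>F. ennreal \<bar>empirical x m \<phi> - (\<integral>z. \<phi> z \<partial>P)\<bar>)"
    using assms(2) by (simp add: glivenko_cantelli_def)
  from outer_AS_tendsto_0_whp[OF prob_space_iid_space[OF assms(1)] this assms(3,4)]
  show ?thesis using assms(3) by (simp add: SUP_ennreal_abs_le_iff)
qed

lemma glivenko_cantelli_path:
  assumes "prob_space P" "glivenko_cantelli P F"
  shows "\<exists>x\<in>space (iid_space P). \<forall>\<eta>>0. \<forall>\<^sub>F m in sequentially.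
           \<forall>\<phi>\<in>F. \<bar>empirical x m \<phi> - (\<integral>z. \<phi> z \<partial>P)\<bar> \<le> \<eta>"
proof -
  have "outer_AS_tendsto_0 (iid_space P)
       (\<lambda>m x. SUP \<phi>\<in>F. ennreal \<bar>empirical x m \<phi> - (\<integral>z. \<phi> z \<partial>P)\<bar>)"
    using assms(2) by (simp add: glivenko_cantelli_def)
  from outer_AS_tendsto_0_path[OF prob_space_iid_space[OF assms(1)] this]
  obtain x where "x \<in> space (iid_space P)"
    and le: "\<And>\<eta>. \<eta> > 0 \<Longrightarrow> \<forall>\<^sub>F m in sequentially.
        (SUP \<phi>\<in>F. ennreal \<bar>empirical x m \<phi> - (\<integral>z. \<phi> z \<partial>P)\<bar>) \<le> ennreal \<eta>" by blast
  moreover have "\<forall>\<^sub>F m in sequentially. \<forall>\<phi>\<in>F. \<bar>empirical x m \<phi> - (\<integral>z. \<phi> z \<partial>P)\<bar> \<le> \<eta>"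
    if "\<eta> > 0" for \<eta>
    using le[OF that] that by (simp add: SUP_ennreal_abs_le_iff)
  ultimately show ?thesis by blast
qed

lemma iid_sum_second_moment:
  fixes \<psi> :: "'a \<Rightarrow> real"
  assumes M: "prob_space M" and Y: "iid_seq M Q Y"
    and \<psi>[measurable]: "\<psi> \<in> borel_measurable Q" and int2: "integrable Q (\<lambda>y. (\<psi> y)\<^sup>2)"
    and mean: "(\<integral>y. \<psi> y \<partial>Q) = 0"
  shows "integrable M (\<lambda>\<omega>. (\<Sum>j<n. \<psi> (Y j \<omega>))\<^sup>2)"
    and "(\<integral>\<omega>. (\<Sum>j<n. \<psi> (Y j \<omega>))\<^sup>2 \<partial>M) = real n * (\<integral>y. (\<psi> y)\<^sup>2 \<partial>Q)"
proof -
  interpret prob_space M by fact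
  have Ym[measurable]: "Y i \<in> measurable M Q" for i by (rule iid_seq_measurable[OF M Y])
  have dY: "distr M Q (Y i) = Q" for i using Y by (simp add: iid_seq_def)
  have E: "(\<integral>\<omega>. u (Y i \<omega>) \<partial>M) = (\<integral>y. u y \<partial>Q)" if [measurable]: "u \<in> borel_measurable Q" for u :: "'a \<Rightarrow> real" and i
    using integral_distr[OF Ym[of i] that] by (simp add: dY)
  have I: "integrable M (\<lambda>\<omega>. u (Y i \<omega>))" if "integrable Q u" for u :: "'a \<Rightarrow> real" and i
    using integrable_distr_eq[OF Ym[of i], of u] that by (simp add: dY)
  have I2: "integrable M (\<lambda>\<omega>. (\<psi> (Y i \<omega>))\<^sup>2)" for i by (rule I[OF int2])
  have I1: "integrable M (\<lambda>\<omega>. \<psi> (Y i \<omega>))" for i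
    by (rule square_integrable_imp_integrable[OF _ I2]) simp
  have prod: "integrable M (\<lambda>\<omega>. \<psi> (Y i \<omega>) * \<psi> (Y j \<omega>)) \<and>
     (\<integral>\<omega>. \<psi> (Y i \<omega>) * \<psi> (Y j \<omega>) \<partial>M) = (if i = j then (\<integral>y. (\<psi> y)\<^sup>2 \<partial>Q) else 0)" for i j
  proof (cases "i = j")
    case True
    then show ?thesis using I2[of i] E[of "\<lambda>y. (\<psi> y)\<^sup>2" i] by (simp add: power2_eq_square)
  next
    case False
    have "indep_vars (\<lambda>_. Q) Y {i, j}"
      using Y by (auto simp: iid_seq_def intro: indep_vars_subset)
    then have iv: "indep_vars (\<lambda>_. borel) (\<lambda>k \<omega>. \<psi> (Y k \<omega>)) {i, j}"
      by (rule indep_vars_compose2) simp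
    show ?thesis
      using indep_vars_lebesgue_integral[OF _ iv] indep_vars_integrable[OF _ iv] I1 False
      by (simp add: E mean)
  qed
  have sq: "(\<Sum>j<n. \<psi> (Y j \<omega>))\<^sup>2 = (\<Sum>i<n. \<Sum>j<n. \<psi> (Y i \<omega>) * \<psi> (Y j \<omega>))" for \<omega>
    by (simp add: power2_eq_square sum_product)
  show "integrable M (\<lambda>\<omega>. (\<Sum>j<n. \<psi> (Y j \<omega>))\<^sup>2)"
    unfolding sq using prod by (intro Bochner_Integration.integrable_sum) auto
  show "(\<integral>\<omega>. (\<Sum>j<n. \<psi> (Y j \<omega>))\<^sup>2 \<partial>M) = real n * (\<integral>y. (\<psi> y)\<^sup>2 \<partial>Q)"
    unfolding sq using prod by (simp add: Bochner_Integration.integral_sum)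
qed

lemma iid_mean_chebyshev:
  fixes \<psi> :: "'a \<Rightarrow> real"
  assumes M: "prob_space M" and Y: "iid_seq M Q Y"
    and \<psi>[measurable]: "\<psi> \<in> borel_measurable Q" and int2: "integrable Q (\<lambda>y. (\<psi> y)\<^sup>2)"
    and mean: "(\<integral>y. \<psi> y \<partial>Q) = 0" and "c > 0" "n > 0"
  shows "measure M {\<omega>\<in>space M. c \<le> \<bar>sqrt (real n) * empirical (\<lambda>j. Y j \<omega>) n \<psi>\<bar>} \<le> (\<integral>y. (\<psi> y)\<^sup>2 \<partial>Q) / c\<^sup>2"
proof -
  interpret prob_space M by fact
  have Ym[measurable]: "Y i \<in> measurable M Q" for i by (rule iid_seq_measurable[OF M Y])
  let ?u = "\<lambda>\<omega>. (\<Sum>j<n. \<psi> (Y j \<omega>))\<^sup>2 / real n"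
  have u: "(sqrt (real n) * empirical (\<lambda>j. Y j \<omega>) n \<psi>)\<^sup>2 = ?u \<omega>" for \<omega>
  proof -
    have "(sqrt (real n) * (s / real n))\<^sup>2 = (sqrt (real n))\<^sup>2 * (s / real n)\<^sup>2" for s
      by (rule power_mult_distrib)
    also have "\<dots> s = s\<^sup>2 / real n" for s
      using \<open>n > 0\<close> by (simp add: power_divide) (simp add: power2_eq_square)
    finally have "(sqrt (real n) * (s / real n))\<^sup>2 = s\<^sup>2 / real n" for s .
    then show ?thesis by (simp add: empirical_def)
  qed
  have "{\<omega>\<in>space M. c \<le> \<bar>sqrt (real n) * empirical (\<lambda>j. Y j \<omega>) n \<psi>\<bar>} = {\<omega>\<in>space M. c\<^sup>2 \<le> ?u \<omega>}"
    unfolding u[symmetric] using \<open>c > 0\<close> by (auto simp: abs_le_square_iff[symmetric])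
  also have "measure M \<dots> \<le> (\<integral>\<omega>. ?u \<omega> \<partial>M) / c\<^sup>2"
    using iid_sum_second_moment(1)[OF M Y \<psi> int2 mean, of n] \<open>c > 0\<close>
    by (intro integral_Markov_inequality_measure[of _ _ "space M"]) auto
  also have "(\<integral>\<omega>. ?u \<omega> \<partial>M) = (\<integral>y. (\<psi> y)\<^sup>2 \<partial>Q)"
    using iid_sum_second_moment(2)[OF M Y \<psi> int2 mean, of n] \<open>n > 0\<close> by simp
  finally show ?thesis .
qed

text \<open>Chebyshev's inequality with \<open>C\<close> chosen so that \<open>v / C\<^sup>2 \<le> \<epsilon>\<close>, \<open>v\<close> being the second moment.\<close>

lemma iid_mean_stochastically_bounded:
  fixes \<psi> :: "'a \<Rightarrow> real"
  assumes M: "prob_space M" and Y: "iid_seq M Q Y"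
    and \<psi>[measurable]: "\<psi> \<in> borel_measurable Q" and int2: "integrable Q (\<lambda>y. (\<psi> y)\<^sup>2)"
    and mean: "(\<integral>y. \<psi> y \<partial>Q) = 0" and "\<epsilon> > 0"
  shows "\<exists>C>0. whp M \<epsilon> (\<lambda>n \<omega>. \<bar>sqrt (real n) * empirical (\<lambda>j. Y j \<omega>) n \<psi>\<bar> \<le> C)"
proof -
  interpret prob_space M by fact
  have Ym[measurable]: "Y i \<in> measurable M Q" for i by (rule iid_seq_measurable[OF M Y])
  define v where "v = (\<integral>y. (\<psi> y)\<^sup>2 \<partial>Q)"
  have "0 \<le> v" by (simp add: v_def)
  \<comment> \<open>The 1 keeps \<open>C\<close> positive if the second moment vanishes.\<close>
  define C where "C = sqrt ((v + 1) / \<epsilon>)"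
  have C: "C > 0" "v / C\<^sup>2 \<le> \<epsilon>" using \<open>0 \<le> v\<close> \<open>\<epsilon> > 0\<close> by (auto simp: C_def field_simps)
  have "whp M \<epsilon> (\<lambda>n \<omega>. \<bar>sqrt (real n) * empirical (\<lambda>j. Y j \<omega>) n \<psi>\<bar> \<le> C)"
    unfolding whp_def using eventually_gt_at_top[of 0]
  proof eventually_elim
    case (elim n)
    let ?B = "{\<omega>\<in>space M. C \<le> \<bar>sqrt (real n) * empirical (\<lambda>j. Y j \<omega>) n \<psi>\<bar>}"
    have "?B \<in> sets M" by (simp add: empirical_def)
    moreover have "measure M ?B \<le> \<epsilon>"
      using iid_mean_chebyshev[OF M Y \<psi> int2 mean C(1) elim] C(2) by (simp add: v_def)
    ultimately show ?case by (intro bexI[of _ ?B]) auto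
  qed
  with C(1) show ?thesis by blast
qed

lemma iid_mean_whp:
  fixes \<psi> :: "'a \<Rightarrow> real"
  assumes M: "prob_space M" and Y: "iid_seq M Q Y"
    and \<psi>[measurable]: "\<psi> \<in> borel_measurable Q" and int2: "integrable Q (\<lambda>y. (\<psi> y)\<^sup>2)"
    and "\<eta> > 0" "\<epsilon> > 0"
  shows "whp M \<epsilon> (\<lambda>n \<omega>. \<bar>empirical (\<lambda>j. Y j \<omega>) n \<psi> - (\<integral>y. \<psi> y \<partial>Q)\<bar> \<le> \<eta>)"
proof -
  interpret prob_space M by fact
  have "prob_space Q"
    using prob_space_distr[OF iid_seq_measurable[OF M Y, of 0]] Y by (simp add: iid_seq_def)
  then interpret Q: prob_space Q .
  define \<mu> where "\<mu> = (\<integral>y. \<psi> y \<partial>Q)"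
  have int1: "integrable Q \<psi>" by (rule Q.square_integrable_imp_integrable[OF \<psi> int2])
  have "integrable Q (\<lambda>y. (\<psi> y - \<mu>)\<^sup>2)"
    using int1 int2 by (simp add: power2_diff)
  moreover have "(\<integral>y. \<psi> y - \<mu> \<partial>Q) = 0" using int1 by (simp add: \<mu>_def Q.prob_space)
  ultimately obtain C where C: "C > 0"
    "whp M \<epsilon> (\<lambda>n \<omega>. \<bar>sqrt (real n) * empirical (\<lambda>j. Y j \<omega>) n (\<lambda>y. \<psi> y - \<mu>)\<bar> \<le> C)"
    using iid_mean_stochastically_bounded[OF M Y, of "\<lambda>y. \<psi> y - \<mu>"] \<open>\<epsilon> > 0\<close> by auto
  have "filterlim (\<lambda>n. sqrt (real n)) at_top sequentially"
    by (rule filterlim_compose[OF sqrt_at_top filterlim_real_sequentially])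
  then have "\<forall>\<^sub>F n in sequentially. C / \<eta> \<le> sqrt (real n)" by (simp add: filterlim_at_top)
  then have "\<forall>\<^sub>F n in sequentially. \<forall>\<omega>\<in>space M.
      \<bar>sqrt (real n) * empirical (\<lambda>j. Y j \<omega>) n (\<lambda>y. \<psi> y - \<mu>)\<bar> \<le> C \<longrightarrow>
      \<bar>empirical (\<lambda>j. Y j \<omega>) n \<psi> - \<mu>\<bar> \<le> \<eta>"
    using eventually_gt_at_top[of 0]
  proof eventually_elim
    case (elim n)
    show ?case
    proof (intro ballI impI)
      fix \<omega>
      let ?e = "empirical (\<lambda>j. Y j \<omega>) n \<psi> - \<mu>"
      assume "\<bar>sqrt (real n) * empirical (\<lambda>j. Y j \<omega>) n (\<lambda>y. \<psi> y - \<mu>)\<bar> \<le> C"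
      moreover have "empirical (\<lambda>j. Y j \<omega>) n (\<lambda>y. \<psi> y - \<mu>) = ?e"
        using elim by (simp add: empirical_def sum_subtractf diff_divide_distrib)
      ultimately have "sqrt (real n) * \<bar>?e\<bar> \<le> C" by (simp add: abs_mult)
      moreover have "C / \<eta> * \<bar>?e\<bar> \<le> sqrt (real n) * \<bar>?e\<bar>" by (rule mult_right_mono[OF elim(1)]) simp
      ultimately have "C / \<eta> * \<bar>?e\<bar> \<le> C" by simp
      then show "\<bar>?e\<bar> \<le> \<eta>" using C(1) \<open>\<eta> > 0\<close> by (simp add: field_simps)
    qed
  qed
  from whp_mono_eventually[OF C(2) this] show ?thesis by (simp add: \<mu>_def)
qed

text \<open>This is the form in which the Donsker property is used: up to a small probability and a
  small uniform error, the empirical process takes only finitely many values. Up to a small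
  probability the limit law is concentrated on a compact set, which has a finite net, and weak
  convergence keeps the process near this net. The members of the net need not have any
  regularity, however. They are therefore exchanged for paths that the process actually takes
  nearby, which inherit whatever holds for all finite sample averages of the class.\<close>

lemma donsker_finite_net:
  assumes P: "prob_space P" and D: "donsker P F" and F: "F \<noteq> {}" and "\<delta> > 0" "\<epsilon> > 0"
  shows "\<exists>\<Psi>. finite \<Psi> \<and>
     (\<forall>\<psi>\<in>\<Psi>. \<exists>m. \<exists>x\<in>space (iid_space P). \<psi> = empirical_process P F m x) \<and>
     whp (iid_space P) \<epsilon> (\<lambda>m x. \<exists>\<psi>\<in>\<Psi>. \<forall>\<phi>\<in>F. \<bar>empirical_process P F m x \<phi> - \<psi> \<phi>\<bar> \<le> \<delta>)"
proof -
  let ?S = "iid_space P" and ?G = "empirical_process P F"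
  define mX where "mX = linfty F"
  define d where "d = mdist mX"
  interpret S: prob_space ?S by (rule prob_space_iid_space[OF P])
  interpret MS: Metric_space "mspace (mX)" "mdist (mX)" by (rule Metric_space_mspace_mdist)
  have top: "mtopology_of (mX) = MS.mtopology" by (simp add: mtopology_of_def)
  have G: "?G m x \<in> mspace (mX)" if "x \<in> space ?S" for m x
    using D that unfolding donsker_def mX_def by blast
  obtain L where tight: "tight_prob_on (mtopology_of (mX)) L"
    and conv: "HJ_weak_conv ?S (mtopology_of (mX)) ?G L"
    using D unfolding donsker_def mX_def by blast
  interpret L: prob_space L using tight by (simp add: tight_prob_on_def)
  obtain K where K: "compactin (mtopology_of (mX)) K" "K \<in> sets L" "measure L K \<ge> 1 - \<epsilon>/2"
    using tight \<open>\<epsilon> > 0\<close> unfolding tight_prob_on_def by (meson half_gt_zero)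
  have "MS.mtotally_bounded K" using K(1) unfolding top by (rule MS.compactin_imp_mtotally_bounded)
  then obtain C where C: "finite C" "C \<subseteq> K" "K \<subseteq> (\<Union>c\<in>C. MS.mball c (\<delta>/4))"
    unfolding MS.mtotally_bounded_def using \<open>\<delta> > 0\<close> by (meson zero_less_divide_iff zero_less_numeral)
  have Ksub: "K \<subseteq> mspace (mX)" using K(1) unfolding top using compactin_subset_topspace by fastforce
  \<comment> \<open>A continuous test function \<open>H\<close> with values in \<open>[0, 1]\<close>: it is 0 on the compact set, which
    the balls of radius \<open>\<delta> / 4\<close> cover, and 1 at distance at least \<open>\<delta> / 2\<close> from all centres.\<close>
  define hh where "hh c z = max 0 (min 1 (d c z / (\<delta>/4) - 1))" for c z
  define H where "H z = (\<Prod>c\<in>C. hh c z)" for z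
  have hh01: "0 \<le> hh c z" "hh c z \<le> 1" for c z by (auto simp: hh_def)
  have H01: "0 \<le> H z" "H z \<le> 1" for z
    unfolding H_def using hh01 by (auto intro: prod_nonneg prod_le_1)
  have H0: "H z = 0" if "z \<in> K" for z
  proof -
    obtain c where c: "c \<in> C" "z \<in> MS.mball c (\<delta>/4)" using C(3) \<open>z \<in> K\<close> by blast
    then have "d c z < \<delta>/4" by (simp add: d_def)
    then have "hh c z = 0" using \<open>\<delta> > 0\<close> by (simp add: hh_def field_simps)
    then show ?thesis using c(1) C(1) by (auto simp: H_def)
  qed
  have H1: "\<exists>c\<in>C. d c z \<le> \<delta>/2" if "H z < 1" for z
  proof (rule ccontr)
    assume "\<not> ?thesis"
    then have "hh c z = 1" if "c \<in> C" for c using that \<open>\<delta> > 0\<close> by (auto simp: hh_def field_simps)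
    then show False using that by (simp add: H_def)
  qed
  have Hc: "continuous_map (mtopology_of (mX)) euclideanreal H"
    unfolding continuous_map_atin limitin_canonical_iff H_def
  proof (intro ballI tendsto_prod)
    fix z c assume z: "z \<in> topspace (mtopology_of (mX))" and c: "c \<in> C"
    have "continuous_map (mtopology_of (mX)) euclideanreal (\<lambda>z. d c z)"
      unfolding d_def using c C(2) Ksub by (intro continuous_map_mdist) (auto simp: top)
    then have "(d c \<longlongrightarrow> d c z) (atin (mtopology_of (mX)) z)"
      using z unfolding continuous_map_atin limitin_canonical_iff by blast
    then show "(hh c \<longlongrightarrow> hh c z) (atin (mtopology_of (mX)) z)"
      unfolding hh_def using \<open>\<delta> > 0\<close> by (intro tendsto_intros) auto
  qed
  have "bounded (H ` topspace (mtopology_of (mX)))"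
    using H01 by (intro boundedI[of _ 1]) auto
  then have lim: "(\<lambda>m. outer_expectation ?S (\<lambda>x. H (?G m x))) \<longlonglongrightarrow> (\<integral>z. H z \<partial>L)"
    using conv Hc unfolding HJ_weak_conv_def by blast
  have "(\<integral>z. H z \<partial>L) \<le> (\<integral>z. indicator (space L - K) z \<partial>L)"
  \<comment> \<open>A nonintegrable function has integral 0, which settles that case.\<close>
  proof (cases "integrable L H")
    case True
    moreover have "integrable L (\<lambda>z. indicator (space L - K) z :: real)"
      using K(2) by (intro integrable_real_indicator) (auto simp: L.emeasure_eq_measure)
    ultimately show ?thesis
      by (rule integral_mono) (use H0 H01 in \<open>auto simp: indicator_def\<close>)
  qed (simp add: not_integrable_integral_eq)
  also have "\<dots> = 1 - measure L K" using K(2) by (simp add: L.prob_compl)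
  also have "\<dots> < \<epsilon>" using K(3) \<open>\<epsilon> > 0\<close> by simp
  finally have "\<forall>\<^sub>F m in sequentially. outer_expectation ?S (\<lambda>x. H (?G m x)) < \<epsilon>"
    using order_tendstoD(2)[OF lim] by blast
  then have near: "whp ?S \<epsilon> (\<lambda>m x. \<exists>c\<in>C. d c (?G m x) \<le> \<delta>/2)"
    unfolding whp_def
  proof eventually_elim
    case (elim m)
    let ?U = "{integral\<^sup>L ?S U | U. integrable ?S U \<and> (\<forall>\<omega>\<in>space ?S. H (?G m \<omega>) \<le> U \<omega>)}"
    have "integral\<^sup>L ?S (\<lambda>_. 1::real) \<in> ?U" using H01 by (intro CollectI exI[of _ "\<lambda>_. 1"]) auto
    then have "\<exists>v\<in>?U. v < \<epsilon>"
      using elim cInf_lessD[of ?U \<epsilon>] unfolding outer_expectation_def by blast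
    \<comment> \<open>The outer expectation is below \<open>\<epsilon>\<close>, so that some integrable majorant \<open>U\<close> of \<open>H\<close> has mean
      below \<open>\<epsilon>\<close>; by Markov's inequality \<open>U \<ge> 1\<close> is a measurable event of probability at most
      \<open>\<epsilon>\<close>, and off this event \<open>H < 1\<close>.\<close>
    then obtain U where U: "integrable ?S U" "\<And>x. x \<in> space ?S \<Longrightarrow> H (?G m x) \<le> U x" "integral\<^sup>L ?S U < \<epsilon>"
      by blast
    let ?B = "{x\<in>space ?S. U x \<ge> 1}"
    have "measure ?S ?B \<le> integral\<^sup>L ?S U / 1"
      using U(1,2) H01 by (intro integral_Markov_inequality_measure[of _ _ "space ?S"] AE_I2)
        (auto intro: order_trans)
    then have "measure ?S ?B \<le> \<epsilon>" using U(3) by simp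
    moreover have "?B \<in> sets ?S" using U(1) by measurable
    moreover have "\<exists>c\<in>C. d c (?G m x) \<le> \<delta>/2" if "x \<in> space ?S - ?B" for x
      using that U(2)[of x] by (intro H1) auto
    ultimately show ?case by blast
  qed
  \<comment> \<open>For each centre that some path comes close to, choose one such path; the distance doubles
    from \<open>\<delta> / 2\<close> to \<open>\<delta>\<close>.\<close>
  define near_path where "near_path c \<psi> \<longleftrightarrow> (\<exists>m. \<exists>x\<in>space ?S. \<psi> = ?G m x) \<and> d c \<psi> \<le> \<delta>/2" for c \<psi>
  define \<Psi> where "\<Psi> = (\<lambda>c. SOME \<psi>. near_path c \<psi>) ` {c\<in>C. \<exists>\<psi>. near_path c \<psi>}"
  have "finite \<Psi>" using C(1) by (simp add: \<Psi>_def)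
  moreover have "\<forall>\<psi>\<in>\<Psi>. \<exists>m. \<exists>x\<in>space ?S. \<psi> = ?G m x"
  proof
    fix \<psi> assume "\<psi> \<in> \<Psi>"
    then obtain c where "\<psi> = (SOME \<psi>. near_path c \<psi>)" "\<exists>\<psi>. near_path c \<psi>"
      unfolding \<Psi>_def by blast
    then have "near_path c \<psi>" using someI_ex[of "near_path c"] by simp
    then show "\<exists>m. \<exists>x\<in>space ?S. \<psi> = ?G m x" by (simp add: near_path_def)
  qed
  moreover have "whp ?S \<epsilon> (\<lambda>m x. \<exists>\<psi>\<in>\<Psi>. \<forall>\<phi>\<in>F. \<bar>?G m x \<phi> - \<psi> \<phi>\<bar> \<le> \<delta>)"
  proof (rule whp_mono[OF near])
    fix m x assume x: "x \<in> space ?S" and "\<exists>c\<in>C. d c (?G m x) \<le> \<delta>/2"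
    then obtain c where c: "c \<in> C" "d c (?G m x) \<le> \<delta>/2" by blast
    then have ex: "near_path c (?G m x)" using x by (auto simp: near_path_def)
    define \<psi> where "\<psi> = (SOME \<psi>. near_path c \<psi>)"
    have \<psi>: "near_path c \<psi>" unfolding \<psi>_def by (rule someI[of "near_path c", OF ex])
    have \<psi>in: "\<psi> \<in> \<Psi>" using ex c(1) unfolding \<Psi>_def \<psi>_def by blast
    have m\<psi>: "\<psi> \<in> mspace (mX)" using \<psi> G by (auto simp: near_path_def)
    have mc: "c \<in> mspace (mX)" using c(1) C(2) Ksub by blast
    have "d (?G m x) \<psi> \<le> d (?G m x) c + d c \<psi>"
      unfolding d_def by (rule MS.triangle[OF G[OF x] mc m\<psi>])
    also have "\<dots> \<le> \<delta>"
      using c(2) \<psi> MS.commute[of "?G m x" c] by (simp add: d_def near_path_def)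
    finally have "\<forall>\<phi>\<in>F. dist (?G m x \<phi>) (\<psi> \<phi>) \<le> \<delta>"
      using funspace_mdist_le[OF G[OF x, unfolded mX_def] m\<psi>[unfolded mX_def] F, where a = \<delta>]
      unfolding d_def mX_def mdist_euclidean_metric by blast
    then show "\<exists>\<psi>\<in>\<Psi>. \<forall>\<phi>\<in>F. \<bar>?G m x \<phi> - \<psi> \<phi>\<bar> \<le> \<delta>"
      using \<psi>in by (auto simp: dist_real_def)
  qed simp
  ultimately show ?thesis by blast
qed

section \<open>Gaussian smoothing and weak convergence\<close>

lemma std_normal_density_prod:
  fixes z :: "'a::euclidean_space"
  shows "(\<Prod>b\<in>Basis. std_normal_density (z \<bullet> b)) = exp (- (norm z)\<^sup>2 / 2) / sqrt (2 * pi) ^ DIM('a)"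
proof -
  have "(\<Prod>b\<in>(Basis::'a set). std_normal_density (z \<bullet> b)) =
      (1 / sqrt (2 * pi)) ^ DIM('a) * exp (\<Sum>b\<in>Basis. - (z \<bullet> b)\<^sup>2 / 2)"
    by (simp add: std_normal_density_def prod.distrib exp_sum prod_dividef power_divide)
  also have "(\<Sum>b\<in>Basis. - (z \<bullet> b)\<^sup>2 / 2) = - (norm z)\<^sup>2 / 2"
    unfolding norm_conv_dist euclidean_dist_l2[of z 0] L2_set_def
    by (simp add: sum_nonneg sum_negf flip: sum_divide_distrib)
  finally show ?thesis by (simp add: power_divide)
qed

text \<open>The standard normal distribution on an arbitrary Euclidean space, so that the results on
  weak convergence need no coordinates.\<close>

definition std_gauss :: "'a::euclidean_space measure" where
  "std_gauss = density lborel (\<lambda>z. ennreal (exp (- (norm z)\<^sup>2 / 2) / sqrt (2 * pi) ^ DIM('a)))"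

lemma std_normal_vec_eq: "std_normal_vec = (std_gauss :: (real ^ 'd::finite) measure)"
  by (simp add: std_normal_vec_def std_gauss_def)

lemma sets_std_gauss [measurable_cong, simp]: "sets std_gauss = sets borel"
  and space_std_gauss [simp]: "space std_gauss = UNIV"
  by (simp_all add: std_gauss_def)

lemma prob_space_std_gauss: "prob_space (std_gauss :: 'a::euclidean_space measure)"
proof (rule prob_spaceI)
  have "emeasure (std_gauss :: 'a measure) (space std_gauss) =
      (\<integral>\<^sup>+z. (\<Prod>b\<in>Basis. ennreal (std_normal_density (z \<bullet> b))) \<partial>(lborel :: 'a measure))"
    unfolding std_gauss_def
    by (simp add: emeasure_density std_normal_density_prod prod_ennreal)
  also have "\<dots> = (\<Prod>b\<in>(Basis::'a set). \<integral>\<^sup>+x. ennreal (std_normal_density x) \<partial>lborel)"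
    by (rule nn_integral_lborel_prod) auto
  also have "\<dots> = 1"
    using prob_space.emeasure_space_1[OF prob_space_normal_density[of 1 0]]
    by (simp add: emeasure_density)
  finally show "emeasure (std_gauss :: 'a measure) (space std_gauss) = 1" .
qed

lemma char_std_gauss:
  fixes t :: "'a::euclidean_space"
  shows "(CLINT z|std_gauss. iexp (t \<bullet> z)) = exp (- (norm t)\<^sup>2 / 2)"
proof -
  interpret P: product_sigma_finite "\<lambda>_::'a. lborel :: real measure"
    by standard
  let ?g = "\<lambda>b x. std_normal_density x *\<^sub>R iexp ((t \<bullet> b) * x)"
  have int: "integrable lborel (?g b)" for b :: 'a
    using integrable_std_normal_moment[of 0]
    by (rule Bochner_Integration.integrable_bound) auto
  have "(CLINT z|std_gauss. iexp (t \<bullet> z)) =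
    (CLINT z|lborel. (\<Prod>b\<in>Basis. std_normal_density (z \<bullet> b)) *\<^sub>R iexp (t \<bullet> z))"
    unfolding std_gauss_def std_normal_density_prod
    by (rule integral_density) (simp_all add: divide_nonneg_nonneg)
  also have "\<dots> = (CLINT z|lborel. (\<Prod>b\<in>Basis. ?g b (z \<bullet> b)))"
  proof (intro Bochner_Integration.integral_cong refl)
    fix z :: 'a
    have "iexp (t \<bullet> z) = (\<Prod>b\<in>Basis. iexp ((t \<bullet> b) * (z \<bullet> b)))"
      by (subst euclidean_inner) (simp add: exp_sum sum_distrib_left)
    then show "(\<Prod>b\<in>Basis. std_normal_density (z \<bullet> b)) *\<^sub>R iexp (t \<bullet> z) =
        (\<Prod>b\<in>Basis. ?g b (z \<bullet> b))"
      by (simp only: scaleR_conv_of_real prod.distrib of_real_prod)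
  qed
  also have "\<dots> = (CLINT f|(\<Pi>\<^sub>M b\<in>Basis. lborel). (\<Prod>b\<in>Basis. ?g b (f b)))"
    unfolding lborel_eq[where 'a='a]
    by (subst integral_distr) (simp_all add: inner_sum_left_Basis cong: prod.cong)
  also have "\<dots> = (\<Prod>b\<in>Basis. CLINT x|lborel. ?g b x)"
    by (rule P.product_integral_prod[OF finite_Basis]) (rule int)
  also have "\<dots> = (\<Prod>b\<in>Basis. char std_normal_distribution (t \<bullet> b))"
    unfolding char_def by (subst integral_density) simp_all
  also have "\<dots> = (\<Prod>b\<in>Basis. complex_of_real (exp (- (t \<bullet> b)\<^sup>2 / 2)))"
    by (simp add: char_std_normal_distribution)
  also have "\<dots> = of_real (exp (\<Sum>b\<in>Basis. - (t \<bullet> b)\<^sup>2 / 2))"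
    by (simp add: exp_sum)
  also have "(\<Sum>b\<in>Basis. - (t \<bullet> b)\<^sup>2 / 2) = - (norm t)\<^sup>2 / 2"
    unfolding norm_conv_dist euclidean_dist_l2[of t 0] L2_set_def
    by (simp add: sum_nonneg sum_negf flip: sum_divide_distrib)
  finally show ?thesis .
qed

text \<open>The bump \<open>exp (- (norm v)\<^sup>2 / 2)\<close> is the characteristic function of the standard normal
  law. By Fubini's theorem the mean of a bump at a random vector is therefore a Gaussian average
  of values of the characteristic function of that vector, and converges by dominated
  convergence as soon as the characteristic functions converge pointwise.\<close>

lemma gaussian_bump_convergence:
  fixes T :: "nat \<Rightarrow> 'w \<Rightarrow> 'a::euclidean_space" and L :: "'a measure"
  assumes M: "prob_space M" and T[measurable]: "\<And>k. T k \<in> borel_measurable M"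
    and L: "prob_space L" and sL[measurable_cong]: "sets L = sets borel"
    and ch: "\<And>t. (\<lambda>k. CLINT \<omega>|M. iexp (t \<bullet> T k \<omega>)) \<longlonglongrightarrow> (CLINT z|L. iexp (t \<bullet> z))"
  shows "(\<lambda>k. LINT \<omega>|M. exp (- (norm ((T k \<omega> - w) /\<^sub>R s))\<^sup>2 / 2)) \<longlonglongrightarrow>
         (LINT z|L. exp (- (norm ((z - w) /\<^sub>R s))\<^sup>2 / 2))"
proof -
  interpret G: prob_space "std_gauss :: 'a measure" by (rule prob_space_std_gauss)
  have sp_L: "space L = UNIV" using sets_eq_imp_space_eq[OF sL] by simp
  \<comment> \<open>Used for the vectors \<open>T k\<close> and for the limit law, hence the generality in \<open>N\<close> and \<open>U\<close>.\<close>
  have key: "complex_of_real (LINT \<omega>|N. exp (- (norm ((U \<omega> - w) /\<^sub>R s))\<^sup>2 / 2)) =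
      (CLINT y|std_gauss. iexp (- (w \<bullet> y) / s) * (CLINT \<omega>|N. iexp ((y /\<^sub>R s) \<bullet> U \<omega>)))"
    if N: "prob_space N" and U[measurable]: "U \<in> borel_measurable N" for N :: "'b measure" and U :: "'b \<Rightarrow> 'a"
  proof -
    interpret N: prob_space N by (rule N)
    interpret NG: pair_prob_space N "std_gauss :: 'a measure" ..
    have "complex_of_real (LINT \<omega>|N. exp (- (norm ((U \<omega> - w) /\<^sub>R s))\<^sup>2 / 2)) =
        (CLINT \<omega>|N. CLINT y|std_gauss. iexp (((U \<omega> - w) /\<^sub>R s) \<bullet> y))"
      by (simp only: char_std_gauss integral_complex_of_real)
    also have "\<dots> = (CLINT y|std_gauss. CLINT \<omega>|N. iexp (((U \<omega> - w) /\<^sub>R s) \<bullet> y))"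
    proof (rule NG.Fubini_integral[symmetric])
      show "integrable (N \<Otimes>\<^sub>M std_gauss) (\<lambda>(\<omega>, y). iexp (((U \<omega> - w) /\<^sub>R s) \<bullet> y))"
        by (rule NG.P.integrable_const_bound[of _ 1]) (auto simp: split_beta)
    qed
    also have "\<dots> = (CLINT y|std_gauss. CLINT \<omega>|N. iexp (- (w \<bullet> y) / s) * iexp ((y /\<^sub>R s) \<bullet> U \<omega>))"
    proof (intro Bochner_Integration.integral_cong refl)
      fix y \<omega>
      have "((U \<omega> - w) /\<^sub>R s) \<bullet> y = - (w \<bullet> y) / s + (y /\<^sub>R s) \<bullet> U \<omega>"
        by (simp add: inner_diff_left inner_commute[of y] divide_inverse algebra_simps)
      then show "iexp (((U \<omega> - w) /\<^sub>R s) \<bullet> y) = iexp (- (w \<bullet> y) / s) * iexp ((y /\<^sub>R s) \<bullet> U \<omega>)"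
        by (simp only: of_real_add distrib_left exp_add)
    qed
    finally show ?thesis by simp
  qed
  have "(\<lambda>k. CLINT y|std_gauss. iexp (- (w \<bullet> y) / s) * (CLINT \<omega>|M. iexp ((y /\<^sub>R s) \<bullet> T k \<omega>))) \<longlonglongrightarrow>
      (CLINT y|std_gauss. iexp (- (w \<bullet> y) / s) * (CLINT z|L. iexp ((y /\<^sub>R s) \<bullet> z)))"
  proof (rule integral_dominated_convergence[where w = "\<lambda>_. 1"])
    interpret M: prob_space M by (rule M)
    interpret L: prob_space L by (rule L)
    show "(\<lambda>y. iexp (- (w \<bullet> y) / s) * (CLINT \<omega>|M. iexp ((y /\<^sub>R s) \<bullet> T k \<omega>))) \<in> borel_measurable std_gauss" for k
      by measurable
    show "(\<lambda>y. iexp (- (w \<bullet> y) / s) * (CLINT z|L. iexp ((y /\<^sub>R s) \<bullet> z))) \<in> borel_measurable std_gauss"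
      by measurable
    show "AE y in std_gauss. cmod (iexp (- (w \<bullet> y) / s) * (CLINT \<omega>|M. iexp ((y /\<^sub>R s) \<bullet> T k \<omega>))) \<le> 1" for k
    proof (rule AE_I2)
      fix y
      have "cmod (CLINT \<omega>|M. iexp ((y /\<^sub>R s) \<bullet> T k \<omega>)) \<le> (LINT \<omega>|M. cmod (iexp ((y /\<^sub>R s) \<bullet> T k \<omega>)))"
        by (rule integral_norm_bound)
      then show "cmod (iexp (- (w \<bullet> y) / s) * (CLINT \<omega>|M. iexp ((y /\<^sub>R s) \<bullet> T k \<omega>))) \<le> 1"
        by (simp add: norm_mult M.prob_space)
    qed
    show "AE y in std_gauss. (\<lambda>k. iexp (- (w \<bullet> y) / s) * (CLINT \<omega>|M. iexp ((y /\<^sub>R s) \<bullet> T k \<omega>))) \<longlonglongrightarrow>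
       iexp (- (w \<bullet> y) / s) * (CLINT z|L. iexp ((y /\<^sub>R s) \<bullet> z))"
      by (intro AE_I2 tendsto_intros ch)
  qed simp
  then have "(\<lambda>k. complex_of_real (LINT \<omega>|M. exp (- (norm ((T k \<omega> - w) /\<^sub>R s))\<^sup>2 / 2))) \<longlonglongrightarrow>
         complex_of_real (LINT z|L. exp (- (norm ((z - w) /\<^sub>R s))\<^sup>2 / 2))"
    by (simp only: key[OF M T] key[OF L, of "\<lambda>z. z"] measurable_ident_sets[OF sL])
  then show ?thesis by (simp only: tendsto_of_real_iff)
qed

text \<open>Smoothing by a Gaussian vector of standard deviation \<open>s\<close> is convolution with a Gaussian
  bump: substitute \<open>w = z + s y\<close>, where the sign of \<open>y\<close> does not matter.\<close>

lemma integral_gaussian_kernel: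
  fixes H :: "'a::euclidean_space \<Rightarrow> real"
  assumes [measurable]: "H \<in> borel_measurable borel" and s: "s > 0"
  shows "(LINT w|lborel. H w * exp (- (norm ((z - w) /\<^sub>R s))\<^sup>2 / 2)) =
     (s * sqrt (2 * pi)) ^ DIM('a) * (LINT y|std_gauss. H (z + s *\<^sub>R y))"
proof -
  have inv: "inverse s * (s * r) = r" for r using s by simp
  have "(LINT w|lborel. H w * exp (- (norm ((z - w) /\<^sub>R s))\<^sup>2 / 2)) =
    (LINT y|lborel. s ^ DIM('a) * (H (z + s *\<^sub>R y) * exp (- (norm y)\<^sup>2 / 2)))"
    using s
    by (subst lborel_affine[of s z]) (simp_all add: integral_density integral_distr inv)
  also have "\<dots> = (LINT y|lborel. (s * sqrt (2 * pi)) ^ DIM('a) *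
      ((exp (- (norm y)\<^sup>2 / 2) / sqrt (2 * pi) ^ DIM('a)) *\<^sub>R H (z + s *\<^sub>R y)))"
    by (intro Bochner_Integration.integral_cong refl) (simp add: power_mult_distrib)
  also have "\<dots> = (s * sqrt (2 * pi)) ^ DIM('a) * (LINT y|std_gauss. H (z + s *\<^sub>R y))"
    unfolding std_gauss_def by (subst integral_density) (simp_all add: divide_nonneg_nonneg)
  finally show ?thesis .
qed

text \<open>Uniform continuity on a ball of radius \<open>R + 1\<close> suffices: two points at distance below 1,
  one of which lies outside this ball, both lie where \<open>H\<close> vanishes.\<close>

lemma compact_support_uniformly_continuous:
  fixes H :: "'a::euclidean_space \<Rightarrow> real"
  assumes "continuous_on UNIV H" "\<And>z. norm z > R \<Longrightarrow> H z = 0"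
  shows "uniformly_continuous_on UNIV H" "\<exists>B\<ge>0. \<forall>z. \<bar>H z\<bar> \<le> B"
proof -
  have K: "compact (cball (0::'a) (R+1))" by simp
  have uc: "uniformly_continuous_on (cball 0 (R+1)) H"
    by (rule compact_uniformly_continuous[OF continuous_on_subset[OF assms(1)] K]) simp
  show "uniformly_continuous_on UNIV H"
    unfolding uniformly_continuous_on_def
  proof (intro allI impI)
    fix e :: real assume "e > 0"
    from uc[unfolded uniformly_continuous_on_def, rule_format, OF this]
    obtain d where d: "d > 0"
      "\<And>x x'. x \<in> cball 0 (R+1) \<Longrightarrow> x' \<in> cball 0 (R+1) \<Longrightarrow> dist x' x < d \<Longrightarrow> dist (H x') (H x) < e"
      by blast
    have "dist (H x') (H x) < e" if "dist x' x < min d 1" for x x'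
    proof (cases "x \<in> cball 0 (R+1) \<and> x' \<in> cball 0 (R+1)")
      case False
      then have "norm x > R + 1 \<or> norm x' > R + 1" by auto
      moreover have "norm x - norm x' < 1" "norm x' - norm x < 1"
        using that norm_triangle_ineq2[of x x'] norm_triangle_ineq2[of x' x]
        by (simp_all add: dist_norm norm_minus_commute)
      ultimately have "norm x > R" "norm x' > R" by linarith+
      then show ?thesis using assms(2) \<open>e > 0\<close> by simp
    qed (use d that in auto)
    then show "\<exists>d>0. \<forall>x\<in>UNIV. \<forall>x'\<in>UNIV. dist x' x < d \<longrightarrow> dist (H x') (H x) < e"
      using d(1) by (intro exI[of _ "min d 1"]) auto
  qed
  have "bounded (H ` cball 0 (R+1))"
    by (intro compact_imp_bounded compact_continuous_image continuous_on_subset[OF assms(1)] K) simp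
  then obtain B where "\<forall>y\<in>H ` cball 0 (R+1). norm y \<le> B" unfolding bounded_iff by blast
  then have B: "\<bar>H z\<bar> \<le> B" if "norm z \<le> R + 1" for z using that by (simp add: dist_norm)
  have "\<bar>H z\<bar> \<le> max 0 B" for z
  proof (cases "norm z \<le> R + 1")
    case True
    then show ?thesis using B by (simp add: le_max_iff_disj)
  next
    case False
    then show ?thesis using assms(2)[of z] by simp
  qed
  then show "\<exists>B\<ge>0. \<forall>z. \<bar>H z\<bar> \<le> B" by (intro exI[of _ "max 0 B"]) auto
qed

lemma norm_tail_small:
  fixes L :: "'a::euclidean_space measure"
  assumes "prob_space L" and sL[measurable_cong]: "sets L = sets borel" and "\<epsilon> > 0"
  shows "\<exists>r>0. measure L {z. norm z > r} \<le> \<epsilon>"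
proof -
  interpret prob_space L by fact
  have m: "{z. norm z > real n} \<in> sets L" for n unfolding sL by measurable
  have "(\<lambda>n. measure L {z. norm z > real n}) \<longlonglongrightarrow> measure L (\<Inter>n. {z. norm z > real n})"
  proof (rule finite_Lim_measure_decseq)
    show "range (\<lambda>n. {z. norm z > real n}) \<subseteq> sets L" using m by blast
    show "decseq (\<lambda>n. {z :: 'a. norm z > real n})" unfolding decseq_def by fastforce
  qed
  also have "(\<Inter>n. {z. norm z > real n}) = ({} :: 'a set)"
  proof -
    have "\<not> (\<forall>n. real n < norm z)" for z :: 'a
    proof -
      obtain n where "norm z < real n" using reals_Archimedean2 by blast
      then have "\<not> real n < norm z" by simp
      then show ?thesis by blast
    qed
    then show ?thesis by blast
  qed
  finally have "(\<lambda>n. measure L {z. norm z > real n}) \<longlonglongrightarrow> 0" by simp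
  from order_tendstoD(2)[OF this \<open>\<epsilon> > 0\<close>]
  have "\<forall>\<^sub>F n in sequentially. measure L {z. norm z > real n} < \<epsilon> \<and> 0 < n"
    using eventually_gt_at_top[of 0] by eventually_elim simp
  from eventually_happens'[OF sequentially_bot this]
  obtain n where "measure L {z. norm z > real n} < \<epsilon>" "0 < n" by blast
  then show ?thesis by (intro exI[of _ "real n"]) auto
qed

text \<open>Choose \<open>s\<close> so small that a Gaussian step of size \<open>s\<close> moves beyond the modulus of
  continuity only with small probability.\<close>

lemma gaussian_smoothing_uniform:
  fixes H :: "'a::euclidean_space \<Rightarrow> real"
  assumes uc: "uniformly_continuous_on UNIV H" and B: "\<And>z. \<bar>H z\<bar> \<le> B" "B \<ge> 0" and "e > 0"
  shows "\<exists>s>0. \<forall>z. \<bar>(LINT y|std_gauss. H (z + s *\<^sub>R y)) - H z\<bar> \<le> e"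
proof -
  interpret G: prob_space "std_gauss :: 'a measure" by (rule prob_space_std_gauss)
  have [measurable]: "H \<in> borel_measurable borel"
    using uc by (intro borel_measurable_continuous_onI uniformly_continuous_imp_continuous)
  from uc[unfolded uniformly_continuous_on_def, rule_format, of "e/2"] \<open>e > 0\<close>
  obtain d where d: "d > 0" "\<And>x x'. dist x' x < d \<Longrightarrow> dist (H x') (H x) < e/2" by auto
  \<comment> \<open>Steps longer than \<open>r\<close> contribute at most \<open>2 B e / (4 B + 4) \<le> e / 2\<close>; the other \<open>e / 2\<close>
    comes from the continuity modulus.\<close>
  obtain r where r: "r > 0" "measure (std_gauss :: 'a measure) {z. norm z > r} \<le> e / (4 * B + 4)"
    using norm_tail_small[OF prob_space_std_gauss sets_std_gauss, of "e / (4 * B + 4)"] \<open>e > 0\<close> B(2) by auto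
  define s where "s = d / (r + 1)"
  have s: "s > 0" "s * r < d" using d r by (auto simp: s_def field_simps)
  have "\<bar>(LINT y|std_gauss. H (z + s *\<^sub>R y)) - H z\<bar> \<le> e" for z
  proof -
    have int: "integrable std_gauss (\<lambda>y. H (z + s *\<^sub>R y))"
      by (rule G.integrable_const_bound[of _ B]) (use B in auto)
    have "\<bar>(LINT y|std_gauss. H (z + s *\<^sub>R y)) - H z\<bar> = \<bar>LINT y|std_gauss. H (z + s *\<^sub>R y) - H z\<bar>"
      using int G.prob_space by simp
    also have "\<dots> \<le> (LINT y|std_gauss. \<bar>H (z + s *\<^sub>R y) - H z\<bar>)" by (rule integral_abs_bound)
    also have "\<dots> \<le> (LINT y|std_gauss. e/2 + 2 * B * indicator {y :: 'a. norm y > r} y)"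
    proof (rule integral_mono)
      show "integrable std_gauss (\<lambda>y. \<bar>H (z + s *\<^sub>R y) - H z\<bar>)" using int by simp
      show "integrable std_gauss (\<lambda>y. e/2 + 2 * B * indicator {y :: 'a. norm y > r} y)"
        by (intro Bochner_Integration.integrable_add integrable_mult_right integrable_real_indicator)
          (auto simp: G.emeasure_eq_measure)
      fix y :: 'a
      show "\<bar>H (z + s *\<^sub>R y) - H z\<bar> \<le> e/2 + 2 * B * indicator {y. norm y > r} y"
      proof (cases "norm y > r")
        case True
        then show ?thesis using B(1)[of z] B(1)[of "z + s *\<^sub>R y"] \<open>e > 0\<close> by simp
      next
        case False
        then have "s * norm y \<le> s * r" using s by simp
        then have "s * norm y < d" using s(2) by linarith
        then have "dist (z + s *\<^sub>R y) z < d" using s(1) by (simp add: dist_norm)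
        then show ?thesis using d(2)[of "z + s *\<^sub>R y" z] False by (simp add: dist_real_def)
      qed
    qed
    also have "\<dots> = e/2 + 2 * B * measure (std_gauss :: 'a measure) {y. norm y > r}"
      using G.prob_space by (subst Bochner_Integration.integral_add)
        (auto simp: G.emeasure_eq_measure intro!: integrable_mult_right integrable_real_indicator)
    also have "\<dots> \<le> e/2 + 2 * B * (e / (4 * B + 4))"
      using r(2) B(2) by (intro add_left_mono mult_left_mono) auto
    also have "2 * B * (e / (4 * B + 4)) \<le> e/2"
      using B(2) \<open>e > 0\<close> by (simp add: field_simps)
    finally show ?thesis by simp
  qed
  with s(1) show ?thesis by blast
qed

text \<open>A smoothed function \<open>Hs\<close> of compact support is an integral over Gaussian bumps with a
  compactly supported weight. Convergence of the means of all bumps thus gives convergence of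
  the means of \<open>Hs\<close> by dominated convergence, and \<open>Hs\<close> is uniformly close to \<open>H\<close>. The integrable
  majorant comes from compact support.\<close>

lemma char_convergence_imp_compact_support_convergence:
  fixes T :: "nat \<Rightarrow> 'w \<Rightarrow> 'a::euclidean_space" and L :: "'a measure" and H :: "'a \<Rightarrow> real"
  assumes M: "prob_space M" and T[measurable]: "\<And>k. T k \<in> borel_measurable M"
    and L: "prob_space L" and sL[measurable_cong]: "sets L = sets borel"
    and ch: "\<And>t. (\<lambda>k. CLINT \<omega>|M. iexp (t \<bullet> T k \<omega>)) \<longlonglongrightarrow> (CLINT z|L. iexp (t \<bullet> z))"
    and H: "continuous_on UNIV H" "\<And>z. norm z > R \<Longrightarrow> H z = 0"
  shows "(\<lambda>k. LINT \<omega>|M. H (T k \<omega>)) \<longlonglongrightarrow> (LINT z|L. H z)"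
proof -
  interpret M: prob_space M by fact
  interpret L: prob_space L by fact
  obtain B where B: "B \<ge> 0" "\<And>z. \<bar>H z\<bar> \<le> B"
    using compact_support_uniformly_continuous(2)[OF H] by blast
  have uc: "uniformly_continuous_on UNIV H" by (rule compact_support_uniformly_continuous(1)[OF H])
  have Hm[measurable]: "H \<in> borel_measurable borel" using H(1) by (rule borel_measurable_continuous_onI)
  have fin: "emeasure lborel (cball (0::'a) R) < \<top>"
    using emeasure_bounded_finite[OF bounded_cball, of "0::'a" R] by simp
  define Hs where "Hs s z = (LINT y|std_gauss. H (z + s *\<^sub>R y))" for s z
  define bump where "bump s z w = exp (- (norm ((z - w) /\<^sub>R s))\<^sup>2 / 2)" for s and z w :: 'a
  have bump_m[measurable]: "(\<lambda>(z, w). bump s z w) \<in> borel_measurable (borel \<Otimes>\<^sub>M borel)" for s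
    unfolding bump_def by measurable
  have bump01: "0 \<le> bump s z w" "bump s z w \<le> 1" for s z w by (auto simp: bump_def)
  have Hdom: "\<bar>H w * c\<bar> \<le> B * indicator (cball 0 R) w" if "0 \<le> c" "c \<le> 1" for w c
    using H(2)[of w] B(2)[of w] that mult_mono[of "\<bar>H w\<bar>" B c 1]
    by (cases "norm w > R") (auto simp: abs_mult)
  \<comment> \<open>Fubini's theorem exchanges the integral over the centres \<open>w\<close> of the bumps with the
    expectation.\<close>
  have key: "(s * sqrt (2 * pi)) ^ DIM('a) * (LINT \<omega>|N. Hs s (U \<omega>)) =
      (LINT w|lborel. H w * (LINT \<omega>|N. bump s (U \<omega>) w))"
    and Hs_int: "integrable N (\<lambda>\<omega>. Hs s (U \<omega>))"
    if N: "prob_space N" and U[measurable]: "U \<in> borel_measurable N" and s: "s > 0"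
    for N :: "'b measure" and U :: "'b \<Rightarrow> 'a" and s
  proof -
    interpret N: prob_space N by (rule N)
    interpret NL: pair_sigma_finite N "lborel :: 'a measure" ..
    have [measurable]: "(\<lambda>(\<omega>, w). bump s (U \<omega>) w) \<in> borel_measurable (N \<Otimes>\<^sub>M lborel)"
      using measurable_compose[OF _ bump_m[of s], of "\<lambda>(\<omega>, w). (U \<omega>, w)" "N \<Otimes>\<^sub>M lborel"]
      by (simp add: case_prod_beta')
    have int: "integrable (N \<Otimes>\<^sub>M lborel) (\<lambda>(\<omega>, w). H w * bump s (U \<omega>) w)"
    proof (rule Bochner_Integration.integrable_bound)
      have "emeasure (N \<Otimes>\<^sub>M lborel) (space N \<times> cball (0::'a) R) < \<infinity>"
        by (subst lborel.emeasure_pair_measure_Times)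
          (auto simp: N.emeasure_space_1 fin)
      then show "integrable (N \<Otimes>\<^sub>M lborel) (\<lambda>x. B * indicator (space N \<times> cball (0::'a) R) x)"
        by (intro integrable_mult_right integrable_real_indicator) auto
      show "AE x in N \<Otimes>\<^sub>M lborel. norm (case x of (\<omega>, w) \<Rightarrow> H w * bump s (U \<omega>) w)
           \<le> norm (B * indicator (space N \<times> cball (0::'a) R) x)"
      proof (rule AE_I2)
        fix x assume x: "x \<in> space (N \<Otimes>\<^sub>M (lborel :: 'a measure))"
        obtain \<omega> w where "x = (\<omega>, w)" by (cases x)
        then show "norm (case x of (\<omega>, w) \<Rightarrow> H w * bump s (U \<omega>) w)
           \<le> norm (B * indicator (space N \<times> cball (0::'a) R) x)"
          using Hdom[OF bump01, of w s "U \<omega>" w] x B(1) by (simp add: space_pair_measure indicator_def)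
      qed
    qed measurable
    have "(s * sqrt (2 * pi)) ^ DIM('a) * Hs s z = (LINT w|lborel. H w * bump s z w)" for z
      unfolding Hs_def bump_def by (rule integral_gaussian_kernel[symmetric, OF Hm s])
    then have "(s * sqrt (2 * pi)) ^ DIM('a) * (LINT \<omega>|N. Hs s (U \<omega>)) =
        (LINT \<omega>|N. LINT w|lborel. H w * bump s (U \<omega>) w)"
      by (simp flip: Bochner_Integration.integral_mult_right_zero)
    also have "\<dots> = (LINT w|lborel. LINT \<omega>|N. H w * bump s (U \<omega>) w)"
      by (rule NL.Fubini_integral[symmetric, OF int])
    finally show "(s * sqrt (2 * pi)) ^ DIM('a) * (LINT \<omega>|N. Hs s (U \<omega>)) =
      (LINT w|lborel. H w * (LINT \<omega>|N. bump s (U \<omega>) w))" by simp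
    interpret G: prob_space "std_gauss :: 'a measure" by (rule prob_space_std_gauss)
    show "integrable N (\<lambda>\<omega>. Hs s (U \<omega>))"
    proof (rule N.integrable_const_bound[of _ B])
      show "(\<lambda>\<omega>. Hs s (U \<omega>)) \<in> borel_measurable N"
        unfolding Hs_def by measurable
      have "\<bar>Hs s z\<bar> \<le> B" for z
      proof -
        have "\<bar>Hs s z\<bar> \<le> (LINT y|std_gauss. \<bar>H (z + s *\<^sub>R y)\<bar>)"
          unfolding Hs_def by (rule integral_abs_bound)
        also have "\<dots> \<le> (LINT y|(std_gauss :: 'a measure). B)"
          by (intro integral_mono G.integrable_const_bound[of _ B]) (use B in auto)
        finally show ?thesis using G.prob_space by simp
      qed
      then show "AE \<omega> in N. norm (Hs s (U \<omega>)) \<le> B" by simp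
    qed
  qed
  have lim_s: "(\<lambda>k. LINT \<omega>|M. Hs s (T k \<omega>)) \<longlonglongrightarrow> (LINT z|L. Hs s z)" if s: "s > 0" for s
  proof -
    have Lm: "(\<lambda>z. z) \<in> borel_measurable L" by (rule measurable_ident_sets[OF sL])
    have "(\<lambda>k. LINT w|lborel. H w * (LINT \<omega>|M. bump s (T k \<omega>) w)) \<longlonglongrightarrow>
        (LINT w|lborel. H w * (LINT z|L. bump s z w))"
    proof (rule integral_dominated_convergence[where w = "\<lambda>w. B * indicator (cball 0 R) w"])
      show "integrable lborel (\<lambda>w::'a. B * indicator (cball 0 R) w)"
        by (intro integrable_mult_right integrable_real_indicator) (auto simp: fin)
      have [measurable]: "(\<lambda>(w, \<omega>). bump s (T k \<omega>) w) \<in> borel_measurable (lborel \<Otimes>\<^sub>M M)" for k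
        using measurable_compose[OF _ bump_m[of s], of "\<lambda>(w, \<omega>). (T k \<omega>, w)" "lborel \<Otimes>\<^sub>M M"]
        by (simp add: case_prod_beta')
      have [measurable]: "(\<lambda>(w, z). bump s z w) \<in> borel_measurable (lborel \<Otimes>\<^sub>M L)"
        using measurable_compose[OF _ bump_m[of s], of "\<lambda>(w, z). (z, w)" "lborel \<Otimes>\<^sub>M L"]
        by (simp add: case_prod_beta')
      show "(\<lambda>w. H w * (LINT \<omega>|M. bump s (T k \<omega>) w)) \<in> borel_measurable lborel" for k by measurable
      show "(\<lambda>w. H w * (LINT z|L. bump s z w)) \<in> borel_measurable lborel" by measurable
      show "AE w in lborel. (\<lambda>k. H w * (LINT \<omega>|M. bump s (T k \<omega>) w)) \<longlonglongrightarrow> H w * (LINT z|L. bump s z w)"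
        unfolding bump_def
        by (intro AE_I2 tendsto_intros gaussian_bump_convergence[OF M T L sL ch])
      show "AE w in lborel. norm (H w * (LINT \<omega>|M. bump s (T k \<omega>) w)) \<le> B * indicator (cball 0 R) w" for k
      proof (rule AE_I2)
        fix w
        have m: "(\<lambda>\<omega>. bump s (T k \<omega>) w) \<in> borel_measurable M" unfolding bump_def by measurable
        have "0 \<le> (LINT \<omega>|M. bump s (T k \<omega>) w)" using bump01 by simp
        moreover have "(LINT \<omega>|M. bump s (T k \<omega>) w) \<le> 1"
        proof (rule M.integral_le_const)
          show "integrable M (\<lambda>\<omega>. bump s (T k \<omega>) w)"
            by (rule M.integrable_const_bound[of _ 1]) (use m bump01 in auto)
        qed (use bump01 in auto)
        ultimately show "norm (H w * (LINT \<omega>|M. bump s (T k \<omega>) w)) \<le> B * indicator (cball 0 R) w"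
          using Hdom by simp
      qed
    qed measurable
    then have "(\<lambda>k. (s * sqrt (2 * pi)) ^ DIM('a) * (LINT \<omega>|M. Hs s (T k \<omega>))) \<longlonglongrightarrow>
         (s * sqrt (2 * pi)) ^ DIM('a) * (LINT z|L. Hs s z)"
      by (simp only: key[OF M T s] key[OF L Lm s])
    then show ?thesis by (rule tendsto_mult_left_iff[THEN iffD1, rotated]) (use s in simp)
  qed
  show ?thesis
  proof (rule LIMSEQ_I)
    fix e :: real assume "e > 0"
    obtain s where s: "s > 0" "\<And>z. \<bar>Hs s z - H z\<bar> \<le> e/4"
      using gaussian_smoothing_uniform[OF uc B(2,1), of "e/4"] \<open>e > 0\<close> unfolding Hs_def by auto
    have close: "\<bar>(LINT \<omega>|N. Hs s (U \<omega>)) - (LINT \<omega>|N. H (U \<omega>))\<bar> \<le> e/4"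
      if N: "prob_space N" and U[measurable]: "U \<in> borel_measurable N" for N :: "'b measure" and U :: "'b \<Rightarrow> 'a"
    proof -
      interpret N: prob_space N by (rule N)
      have i: "integrable N (\<lambda>\<omega>. H (U \<omega>))" by (rule N.integrable_const_bound[of _ B]) (use B in auto)
      note i' = Hs_int[OF N U s(1)]
      have "\<bar>(LINT \<omega>|N. Hs s (U \<omega>)) - (LINT \<omega>|N. H (U \<omega>))\<bar> = \<bar>LINT \<omega>|N. Hs s (U \<omega>) - H (U \<omega>)\<bar>"
        using i i' by simp
      also have "\<dots> \<le> (LINT \<omega>|N. \<bar>Hs s (U \<omega>) - H (U \<omega>)\<bar>)" by (rule integral_abs_bound)
      also have "\<dots> \<le> e/4" using i i' s(2) by (intro N.integral_le_const) auto
      finally show ?thesis .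
    qed
    obtain n0 where "\<forall>k\<ge>n0. norm ((LINT \<omega>|M. Hs s (T k \<omega>)) - (LINT z|L. Hs s z)) < e/4"
      using LIMSEQ_D[OF lim_s[OF s(1)], of "e/4"] \<open>e > 0\<close> by auto
    then have n0: "\<bar>(LINT \<omega>|M. Hs s (T k \<omega>)) - (LINT z|L. Hs s z)\<bar> < e/4" if "k \<ge> n0" for k
      using that by simp
    have "norm ((LINT \<omega>|M. H (T k \<omega>)) - (LINT z|L. H z)) < e" if "k \<ge> n0" for k
      using n0[OF that] close[OF M T, of k] close[OF L measurable_ident_sets[OF sL]] \<open>e > 0\<close>
      unfolding real_norm_def by linarith
    then show "\<exists>n0. \<forall>k\<ge>n0. norm ((LINT \<omega>|M. H (T k \<omega>)) - (LINT z|L. H z)) < e" by blast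
  qed
qed

text \<open>Slutsky's lemma: a uniformly continuous bounded function hardly distinguishes \<open>Z k\<close> from
  \<open>T k\<close> off an event of small probability.\<close>

lemma compact_support_convergence_perturb:
  fixes T Z :: "nat \<Rightarrow> 'w \<Rightarrow> 'a::euclidean_space" and H :: "'a \<Rightarrow> real"
  assumes M: "prob_space M" and T[measurable]: "\<And>k. T k \<in> borel_measurable M"
    and Z[measurable]: "\<And>k. Z k \<in> borel_measurable M"
    and close: "\<And>\<epsilon> \<delta>. \<epsilon> > 0 \<Longrightarrow> \<delta> > 0 \<Longrightarrow> whp M \<epsilon> (\<lambda>k \<omega>. norm (Z k \<omega> - T k \<omega>) \<le> \<delta>)"
    and H: "continuous_on UNIV H" "\<And>z. norm z > R \<Longrightarrow> H z = 0"
    and lim: "(\<lambda>k. LINT \<omega>|M. H (T k \<omega>)) \<longlonglongrightarrow> l"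
  shows "(\<lambda>k. LINT \<omega>|M. H (Z k \<omega>)) \<longlonglongrightarrow> l"
proof -
  interpret M: prob_space M by fact
  obtain B where B: "B \<ge> 0" "\<And>z. \<bar>H z\<bar> \<le> B"
    using compact_support_uniformly_continuous(2)[OF H] by blast
  have uc: "uniformly_continuous_on UNIV H" by (rule compact_support_uniformly_continuous(1)[OF H])
  have Hm[measurable]: "H \<in> borel_measurable borel" using H(1) by (rule borel_measurable_continuous_onI)
  have iZ: "integrable M (\<lambda>\<omega>. H (Z k \<omega>))" and iT: "integrable M (\<lambda>\<omega>. H (T k \<omega>))" for k
    by (auto intro!: M.integrable_const_bound[of _ B] simp: B)
  have "(\<lambda>k. (LINT \<omega>|M. H (Z k \<omega>)) - (LINT \<omega>|M. H (T k \<omega>))) \<longlonglongrightarrow> 0"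
  proof (rule tendstoI)
    fix e :: real assume "e > 0"
    from uc[unfolded uniformly_continuous_on_def, rule_format, of "e/2"] \<open>e > 0\<close>
    obtain d where d: "d > 0" "\<And>x x'. dist x' x < d \<Longrightarrow> dist (H x') (H x) < e/2" by auto
    have "whp M (e / (8 * B + 8)) (\<lambda>k \<omega>. norm (Z k \<omega> - T k \<omega>) \<le> d/2)"
      by (rule close) (use \<open>e > 0\<close> B(1) d(1) in auto)
    then show "\<forall>\<^sub>F k in sequentially. dist ((LINT \<omega>|M. H (Z k \<omega>)) - (LINT \<omega>|M. H (T k \<omega>))) 0 < e"
      unfolding whp_def
    proof eventually_elim
      case (elim k)
      then obtain A where A: "A \<in> sets M" "measure M A \<le> e / (8 * B + 8)"
        "\<And>\<omega>. \<omega> \<in> space M - A \<Longrightarrow> norm (Z k \<omega> - T k \<omega>) \<le> d/2" by blast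
      have iA: "integrable M (\<lambda>\<omega>. 2 * B * indicator A \<omega>)"
        by (intro integrable_mult_right integrable_real_indicator) (use A in \<open>auto simp: M.emeasure_eq_measure\<close>)
      have "\<bar>(LINT \<omega>|M. H (Z k \<omega>)) - (LINT \<omega>|M. H (T k \<omega>))\<bar> = \<bar>LINT \<omega>|M. H (Z k \<omega>) - H (T k \<omega>)\<bar>"
        using iZ iT by simp
      also have "\<dots> \<le> (LINT \<omega>|M. \<bar>H (Z k \<omega>) - H (T k \<omega>)\<bar>)" by (rule integral_abs_bound)
      also have "\<dots> \<le> (LINT \<omega>|M. e/2 + 2 * B * indicator A \<omega>)"
      proof (rule integral_mono)
        show "integrable M (\<lambda>\<omega>. \<bar>H (Z k \<omega>) - H (T k \<omega>)\<bar>)" using iZ iT by simp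
        show "integrable M (\<lambda>\<omega>. e/2 + 2 * B * indicator A \<omega>)" using iA by simp
        fix \<omega> assume \<omega>: "\<omega> \<in> space M"
        show "\<bar>H (Z k \<omega>) - H (T k \<omega>)\<bar> \<le> e/2 + 2 * B * indicator A \<omega>"
        proof (cases "\<omega> \<in> A")
          case True
          then show ?thesis using B(2)[of "Z k \<omega>"] B(2)[of "T k \<omega>"] \<open>e > 0\<close> by simp
        next
          case False
          then have "dist (Z k \<omega>) (T k \<omega>) < d" using A(3)[of \<omega>] \<omega> d(1) by (simp add: dist_norm)
          then show ?thesis using d(2)[of "Z k \<omega>" "T k \<omega>"] False by (simp add: dist_real_def)
        qed
      qed
      also have "\<dots> = e/2 + 2 * B * measure M A"
        using iA A(1) M.prob_space by (subst Bochner_Integration.integral_add) auto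
      also have "\<dots> \<le> e/2 + 2 * B * (e / (8 * B + 8))"
        using A(2) B(1) by (intro add_left_mono mult_left_mono) auto
      also have "2 * B * (e / (8 * B + 8)) \<le> e/4"
        using B(1) \<open>e > 0\<close> by (simp add: field_simps)
      finally show ?case using \<open>e > 0\<close> by (simp add: dist_real_def)
    qed
  qed
  from tendsto_add[OF this lim] show ?thesis by simp
qed

text \<open>The bound involves the cutoff \<open>c\<close> only through its mean, and so can be controlled by
  convergence of the means of \<open>c\<close>.\<close>

lemma cutoff_error:
  fixes H c :: "'a::topological_space \<Rightarrow> real"
  assumes N: "prob_space N" and U[measurable]: "U \<in> borel_measurable N"
    and [measurable]: "H \<in> borel_measurable borel" "c \<in> borel_measurable borel"
    and B: "B > 0" "\<And>z. \<bar>H z\<bar> \<le> B" and c01: "\<And>z. 0 \<le> c z" "\<And>z. c z \<le> 1"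
  shows "\<bar>(LINT \<omega>|N. H (U \<omega>)) - (LINT \<omega>|N. H (U \<omega>) * c (U \<omega>))\<bar> \<le> B * (1 - (LINT \<omega>|N. c (U \<omega>)))"
proof -
  interpret N: prob_space N by (rule N)
  have i1: "integrable N (\<lambda>\<omega>. H (U \<omega>))" by (rule N.integrable_const_bound[of _ B]) (use B in auto)
  have i2: "integrable N (\<lambda>\<omega>. c (U \<omega>))" by (rule N.integrable_const_bound[of _ 1]) (use c01 in auto)
  have i3: "integrable N (\<lambda>\<omega>. H (U \<omega>) * c (U \<omega>))"
  proof (rule N.integrable_const_bound[of _ "B * 1"])
    show "AE \<omega> in N. norm (H (U \<omega>) * c (U \<omega>)) \<le> B * 1"
      unfolding real_norm_def abs_mult using c01 B
      by (intro AE_I2 mult_mono) (auto intro: less_imp_le)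
  qed simp
  have "\<bar>(LINT \<omega>|N. H (U \<omega>)) - (LINT \<omega>|N. H (U \<omega>) * c (U \<omega>))\<bar> = \<bar>LINT \<omega>|N. H (U \<omega>) - H (U \<omega>) * c (U \<omega>)\<bar>"
    using i1 i3 by simp
  also have "\<dots> \<le> (LINT \<omega>|N. \<bar>H (U \<omega>) - H (U \<omega>) * c (U \<omega>)\<bar>)" by (rule integral_abs_bound)
  also have "\<dots> \<le> (LINT \<omega>|N. B * (1 - c (U \<omega>)))"
  proof (rule integral_mono)
    fix \<omega>
    have "\<bar>H (U \<omega>) - H (U \<omega>) * c (U \<omega>)\<bar> = \<bar>H (U \<omega>)\<bar> * (1 - c (U \<omega>))"
      using c01(2)[of "U \<omega>"] abs_mult[of "H (U \<omega>)" "1 - c (U \<omega>)"] by (simp add: algebra_simps)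
    also have "\<dots> \<le> B * (1 - c (U \<omega>))" using c01(2)[of "U \<omega>"] B(2) by (intro mult_right_mono) auto
    finally show "\<bar>H (U \<omega>) - H (U \<omega>) * c (U \<omega>)\<bar> \<le> B * (1 - c (U \<omega>))" .
  qed (use i1 i2 i3 in simp_all)
  also have "\<dots> = B * (1 - (LINT \<omega>|N. c (U \<omega>)))" using i2 N.prob_space by simp
  finally show ?thesis .
qed

text \<open>No mass escapes to infinity because the limit is a probability measure: a cutoff function
  \<open>c\<close> that carries almost all the mass of \<open>L\<close> is itself an admissible test function, so that the
  laws of \<open>Z k\<close> eventually have almost all their mass where \<open>c\<close> is large.\<close>

lemma compact_support_convergence_imp_weak:
  fixes Z :: "nat \<Rightarrow> 'w \<Rightarrow> 'a::euclidean_space" and L :: "'a measure" and H :: "'a \<Rightarrow> real"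
  assumes M: "prob_space M" and Z[measurable]: "\<And>k. Z k \<in> borel_measurable M"
    and L: "prob_space L" and sL[measurable_cong]: "sets L = sets borel"
    and conv: "\<And>(H :: 'a \<Rightarrow> real) R. continuous_on UNIV H \<Longrightarrow> (\<And>z. norm z > R \<Longrightarrow> H z = 0) \<Longrightarrow>
        (\<lambda>k. LINT \<omega>|M. H (Z k \<omega>)) \<longlonglongrightarrow> (LINT z|L. H z)"
    and H: "continuous_on UNIV H" "bounded (range H)"
  shows "(\<lambda>k. LINT \<omega>|M. H (Z k \<omega>)) \<longlonglongrightarrow> (LINT z|L. H z)"
proof (rule LIMSEQ_I)
  fix e :: real assume "e > 0"
  obtain B where B: "B > 0" "\<And>z. \<bar>H z\<bar> \<le> B"
    using H(2) unfolding bounded_pos by auto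
  have Hm[measurable]: "H \<in> borel_measurable borel" using H(1) by (rule borel_measurable_continuous_onI)
  interpret L: prob_space L by fact
  obtain r where r: "r > 0" "measure L {z. norm z > r} \<le> e / (8 * B)"
    using norm_tail_small[OF L sL, of "e / (8 * B)"] \<open>e > 0\<close> B(1) by auto
  define c where "c z = max 0 (min 1 (r + 1 - norm z))" for z :: 'a
  have c01: "0 \<le> c z" "c z \<le> 1" for z by (auto simp: c_def)
  have c0: "c z = 0" if "norm z > r + 1" for z using that by (simp add: c_def)
  have cc: "continuous_on UNIV c" unfolding c_def by (intro continuous_intros)
  have cm[measurable]: "c \<in> borel_measurable borel" using cc by (rule borel_measurable_continuous_onI)
  have Lm: "(\<lambda>z. z) \<in> borel_measurable L" by (rule measurable_ident_sets[OF sL])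
  have cL: "1 - (LINT z|L. c z) \<le> e / (8 * B)"
  proof -
    have mr: "{z. norm z > r} \<in> sets L" unfolding sL by measurable
    have i2: "integrable L c" by (rule L.integrable_const_bound[of _ 1]) (use c01 Lm in auto)
    have "1 - (LINT z|L. c z) = (LINT z|L. 1 - c z)" using i2 L.prob_space by simp
    also have "\<dots> \<le> (LINT z|L. indicator {z. norm z > r} z)"
    proof (rule integral_mono)
      show "integrable L (\<lambda>z. 1 - c z)" using i2 by simp
      show "integrable L (\<lambda>z. indicator {z. norm z > r} z :: real)"
        using mr by (intro integrable_real_indicator) (simp_all add: L.emeasure_eq_measure)
      show "1 - c z \<le> indicator {z. norm z > r} z" for z
        using c01(1)[of z] by (cases "norm z > r") (simp_all add: c_def)
    qed
    also have "\<dots> = measure L {z. norm z > r}" using mr by simp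
    finally show ?thesis using r(2) by simp
  qed
  have lim1: "(\<lambda>k. LINT \<omega>|M. c (Z k \<omega>)) \<longlonglongrightarrow> (LINT z|L. c z)"
    by (rule conv[OF cc c0])
  have lim2: "(\<lambda>k. LINT \<omega>|M. H (Z k \<omega>) * c (Z k \<omega>)) \<longlonglongrightarrow> (LINT z|L. H z * c z)"
    by (rule conv[OF continuous_on_mult[OF H(1) cc], of "r + 1"]) (simp add: c0)
  have pos: "0 < e / (8 * B)" "0 < e/4" using \<open>e > 0\<close> B(1) by auto
  have "\<forall>\<^sub>F k in sequentially. \<bar>(LINT \<omega>|M. H (Z k \<omega>)) - (LINT z|L. H z)\<bar> < e"
    using tendstoD[OF lim1 pos(1)] tendstoD[OF lim2 pos(2)]
  proof (eventually_elim)
    fix k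
    assume 1: "dist (LINT \<omega>|M. c (Z k \<omega>)) (LINT z|L. c z) < e / (8 * B)"
      and 2: "dist (LINT \<omega>|M. H (Z k \<omega>) * c (Z k \<omega>)) (LINT z|L. H z * c z) < e/4"
    have "1 - (LINT \<omega>|M. c (Z k \<omega>)) \<le> e / (8 * B) + e / (8 * B)"
      using 1 cL unfolding dist_real_def abs_less_iff by linarith
    then have "B * (1 - (LINT \<omega>|M. c (Z k \<omega>))) \<le> B * (e / (8 * B) + e / (8 * B))"
      using B(1) by (intro mult_left_mono) auto
    also have "\<dots> = e/4" using B(1) by (simp add: field_simps)
    finally have 3: "B * (1 - (LINT \<omega>|M. c (Z k \<omega>))) \<le> e/4" .
    have "B * (1 - (LINT z|L. c z)) \<le> B * (e / (8 * B))"
      using B(1) cL by (intro mult_left_mono) auto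
    also have "\<dots> = e/8" using B(1) by (simp add: field_simps)
    finally show "\<bar>(LINT \<omega>|M. H (Z k \<omega>)) - (LINT z|L. H z)\<bar> < e"
      using 2 3 cutoff_error[OF M Z[of k] Hm cm B c01] cutoff_error[OF L Lm Hm cm B c01] \<open>e > 0\<close>
      unfolding dist_real_def abs_le_iff abs_less_iff by linarith
  qed
  then show "\<exists>n0. \<forall>k\<ge>n0. norm ((LINT \<omega>|M. H (Z k \<omega>)) - (LINT z|L. H z)) < e"
    by (simp add: eventually_sequentially)
qed

section \<open>The central limit theorem for two independent samples\<close>

lemma exp_minus_approx:
  fixes x :: real
  assumes "0 \<le> x"
  shows "\<bar>(1 - x) - exp (- x)\<bar> \<le> x\<^sup>2 / 2"
proof -
  have lower: "1 - x \<le> exp (- x)" using exp_ge_add_one_self[of "-x"] by simp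
  have "(\<lambda>x::real. 1 - x + x\<^sup>2 / 2 - exp (- x)) 0 \<le> (\<lambda>x. 1 - x + x\<^sup>2 / 2 - exp (- x)) x"
  proof (rule DERIV_nonneg_imp_nondecreasing[OF assms])
    fix y :: real assume "0 \<le> y"
    have "((\<lambda>x. 1 - x + x\<^sup>2 / 2 - exp (- x)) has_real_derivative (y - 1 + exp (- y))) (at y)"
      by (auto intro!: derivative_eq_intros)
    moreover have "0 \<le> y - 1 + exp (- y)" using exp_ge_add_one_self[of "-y"] by simp
    ultimately show "\<exists>d. ((\<lambda>x. 1 - x + x\<^sup>2 / 2 - exp (- x)) has_real_derivative d) (at y) \<and> 0 \<le> d" by blast
  qed
  then show ?thesis using lower by (simp add: abs_le_iff)
qed

text \<open>The classical proof of the central limit theorem, with an explicit error. The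
  characteristic function of the normed sum is the power \<open>z ^ n\<close>, and the normal one is \<open>w ^ n\<close>;
  both bases have modulus at most 1, so that the powers differ by at most \<open>n\<close> times the
  difference of the bases, which are both compared with \<open>1 - v / (2 n)\<close>. The minimum in the
  bound keeps the integral finite with only second moments and still lets it tend to 0.\<close>

lemma iid_char_bound:
  fixes \<psi> :: "'a \<Rightarrow> real"
  assumes M: "prob_space M" and Y: "iid_seq M Q Y"
    and \<psi>[measurable]: "\<psi> \<in> borel_measurable Q" and int2: "integrable Q (\<lambda>y. (\<psi> y)\<^sup>2)"
    and mean: "(\<integral>y. \<psi> y \<partial>Q) = 0" and n: "n > 0"
  shows "cmod ((CLINT \<omega>|M. iexp ((\<Sum>j<n. \<psi> (Y j \<omega>)) / sqrt (real n))) -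
            of_real (exp (- (\<integral>y. (\<psi> y)\<^sup>2 \<partial>Q) / 2)))
     \<le> (\<integral>y. min (6 * (\<psi> y)\<^sup>2) (\<bar>\<psi> y\<bar> ^ 3 / sqrt (real n)) \<partial>Q) / 6 + (\<integral>y. (\<psi> y)\<^sup>2 \<partial>Q)\<^sup>2 / (8 * real n)"
proof -
  interpret M: prob_space M by fact
  have Ym[measurable]: "Y i \<in> measurable M Q" for i by (rule iid_seq_measurable[OF M Y])
  have dY: "distr M Q (Y i) = Q" for i using Y by (simp add: iid_seq_def)
  have "prob_space Q" using M.prob_space_distr[OF Ym, of 0] by (simp add: dY)
  then interpret Q: prob_space Q .
  interpret D: real_distribution "distr Q borel \<psi>" by simp
  have int1: "integrable Q \<psi>" by (rule Q.square_integrable_imp_integrable[OF \<psi> int2])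
  define v where "v = (\<integral>y. (\<psi> y)\<^sup>2 \<partial>Q)"
  have v: "0 \<le> v" by (simp add: v_def)
  define t where "t = 1 / sqrt (real n)"
  have t: "t > 0" "t\<^sup>2 = 1 / real n" using n by (auto simp: t_def power_divide)
  define z where "z = char (distr Q borel \<psi>) t"
  define w where "w = complex_of_real (exp (- (v / (2 * real n))))"
  have "M.indep_vars (\<lambda>_. Q) Y {..<n}"
    using Y by (auto simp: iid_seq_def intro: M.indep_vars_subset)
  then have iv: "M.indep_vars (\<lambda>_. borel) (\<lambda>j \<omega>. \<psi> (Y j \<omega>)) {..<n}"
    by (rule M.indep_vars_compose2) simp
  have "(CLINT \<omega>|M. iexp ((\<Sum>j<n. \<psi> (Y j \<omega>)) / sqrt (real n))) =
      char (distr M borel (\<lambda>\<omega>. \<Sum>j<n. \<psi> (Y j \<omega>))) t"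
    by (simp add: char_def integral_distr t_def)
  also have "\<dots> = (\<Prod>j<n. char (distr M borel (\<lambda>\<omega>. \<psi> (Y j \<omega>))) t)"
    by (rule M.char_distr_sum[OF iv])
  also have "\<dots> = z ^ n"
  proof -
    have "distr M borel (\<lambda>\<omega>. \<psi> (Y j \<omega>)) = distr Q borel \<psi>" for j
      using distr_distr[OF \<psi> Ym[of j]] by (simp add: dY comp_def)
    then show ?thesis by (simp add: z_def)
  qed
  finally have eq: "(CLINT \<omega>|M. iexp ((\<Sum>j<n. \<psi> (Y j \<omega>)) / sqrt (real n))) = z ^ n" .
  have "w ^ n = complex_of_real (exp (real n * (- (v / (2 * real n)))))"
    unfolding w_def by (simp only: exp_of_nat_mult of_real_power)
  then have wn: "complex_of_real (exp (- v / 2)) = w ^ n" using n by simp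
  have "cmod z \<le> 1" unfolding z_def by (rule D.cmod_char_le_1)
  moreover have "cmod w \<le> 1" using v by (simp add: w_def)
  ultimately have "cmod (z ^ n - w ^ n) \<le> real n * cmod (z - w)" by (rule norm_power_diff)
  also have "\<dots> \<le> real n * (cmod (z - (1 - t\<^sup>2 * v / 2)) + cmod ((1 - t\<^sup>2 * v / 2) - w))"
    using norm_triangle_ineq[of "z - (1 - t\<^sup>2 * v / 2)" "(1 - t\<^sup>2 * v / 2) - w"]
    by (intro mult_left_mono) auto
  also have "\<dots> \<le> real n * (t\<^sup>2 / 6 * (\<integral>y. min (6 * (\<psi> y)\<^sup>2) (t * \<bar>\<psi> y\<bar> ^ 3) \<partial>Q) + (v / (2 * real n))\<^sup>2 / 2)"
  proof (intro mult_left_mono add_mono)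
    show "cmod (z - (1 - t\<^sup>2 * v / 2)) \<le> t\<^sup>2 / 6 * (\<integral>y. min (6 * (\<psi> y)\<^sup>2) (t * \<bar>\<psi> y\<bar> ^ 3) \<partial>Q)"
      using Q.char_approx3'[OF \<psi> int1 int2 mean _ refl, of v t] t(1) unfolding z_def
      by (simp add: mean v_def)
    have "(1 - t\<^sup>2 * v / 2) - w = complex_of_real ((1 - v / (2 * real n)) - exp (- (v / (2 * real n))))"
      unfolding w_def t by simp
    then show "cmod ((1 - t\<^sup>2 * v / 2) - w) \<le> (v / (2 * real n))\<^sup>2 / 2"
      using exp_minus_approx[of "v / (2 * real n)"] v by (simp only: norm_of_real) simp
  qed simp
  also have "\<dots> = (\<integral>y. min (6 * (\<psi> y)\<^sup>2) (t * \<bar>\<psi> y\<bar> ^ 3) \<partial>Q) / 6 + v\<^sup>2 / (8 * real n)"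
    using n by (simp add: t(2) distrib_left power_divide power_mult_distrib) (simp add: power2_eq_square)
  finally show ?thesis unfolding eq v_def[symmetric] wn by (simp add: t_def)
qed

text \<open>The frequencies \<open>u k\<close> need not converge: the error bound for \<open>u k \<bullet> \<psi>\<close> is dominated by one
  in which \<open>norm (u k)\<close> is replaced by \<open>C\<close>, and that one tends to 0 by dominated convergence.\<close>

lemma iid_char_limit:
  fixes \<psi> :: "'a \<Rightarrow> 'e::euclidean_space"
  assumes M: "prob_space M" and Y: "iid_seq M Q Y"
    and \<psi>[measurable]: "\<psi> \<in> borel_measurable Q" and int2: "integrable Q (\<lambda>y. (norm (\<psi> y))\<^sup>2)"
    and mean: "(\<integral>y. \<psi> y \<partial>Q) = 0"
    and n: "filterlim n at_top sequentially" and u: "\<And>k. norm (u k) \<le> C"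
  shows "(\<lambda>k. (CLINT \<omega>|M. iexp ((\<Sum>j<n k. u k \<bullet> \<psi> (Y j \<omega>)) / sqrt (real (n k)))) -
            of_real (exp (- (\<integral>y. (u k \<bullet> \<psi> y)\<^sup>2 \<partial>Q) / 2))) \<longlonglongrightarrow> 0"
proof -
  interpret M: prob_space M by fact
  have Ym[measurable]: "Y i \<in> measurable M Q" for i by (rule iid_seq_measurable[OF M Y])
  have "prob_space Q" using M.prob_space_distr[OF Ym, of 0] Y by (simp add: iid_seq_def)
  then interpret Q: prob_space Q .
  have C: "0 \<le> C" using u[of 0] norm_ge_zero order_trans by blast
  have int1: "integrable Q \<psi>"
    using Q.square_integrable_imp_integrable[of "\<lambda>y. norm (\<psi> y)"] int2
    by (simp add: integrable_norm_iff)
  define S where "S = (\<integral>y. (norm (\<psi> y))\<^sup>2 \<partial>Q)"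
  \<comment> \<open>The integrand of the error bound for any projection of length at most \<open>C\<close>.\<close>
  define D where "D n y = min (6 * C\<^sup>2 * (norm (\<psi> y))\<^sup>2) (C ^ 3 * norm (\<psi> y) ^ 3 / sqrt (real n))" for n :: nat and y
  have D0: "0 \<le> D n y" for n y using C by (simp add: D_def)
  have Dm[measurable]: "D n \<in> borel_measurable Q" for n unfolding D_def by measurable
  have Dint: "integrable Q (D n)" for n
  proof (rule Bochner_Integration.integrable_bound)
    show "integrable Q (\<lambda>y. 6 * C\<^sup>2 * (norm (\<psi> y))\<^sup>2)" using int2 by simp
    show "AE y in Q. norm (D n y) \<le> norm (6 * C\<^sup>2 * (norm (\<psi> y))\<^sup>2)"
      using D0[of n] by (intro AE_I2) (simp add: D_def)
  qed simp
  have bound: "cmod ((CLINT \<omega>|M. iexp ((\<Sum>j<n k. u k \<bullet> \<psi> (Y j \<omega>)) / sqrt (real (n k)))) -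
            of_real (exp (- (\<integral>y. (u k \<bullet> \<psi> y)\<^sup>2 \<partial>Q) / 2))) \<le>
       (\<integral>y. D (n k) y \<partial>Q) / 6 + (C\<^sup>2 * S)\<^sup>2 / 8 * (1 / real (n k))" if nk: "n k > 0" for k
  proof -
    have uy: "\<bar>u k \<bullet> \<psi> y\<bar> \<le> C * norm (\<psi> y)" for y
      using Cauchy_Schwarz_ineq2[of "u k" "\<psi> y"] mult_right_mono[OF u[of k], of "norm (\<psi> y)"] by simp
    then have uy2: "(u k \<bullet> \<psi> y)\<^sup>2 \<le> C\<^sup>2 * (norm (\<psi> y))\<^sup>2" for y
      by (metis abs_ge_zero power2_abs power_mono power_mult_distrib)
    have uy3: "\<bar>u k \<bullet> \<psi> y\<bar> ^ 3 \<le> C ^ 3 * norm (\<psi> y) ^ 3" for y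
      using power_mono[OF uy abs_ge_zero, of y 3] by (simp add: power_mult_distrib)
    have i2: "integrable Q (\<lambda>y. (u k \<bullet> \<psi> y)\<^sup>2)"
    proof (rule Bochner_Integration.integrable_bound)
      show "integrable Q (\<lambda>y. C\<^sup>2 * (norm (\<psi> y))\<^sup>2)" using int2 by simp
    qed (use uy2 in \<open>auto intro: order_trans\<close>)
    have m0: "(\<integral>y. u k \<bullet> \<psi> y \<partial>Q) = 0" using int1 mean by (simp add: inner_commute[of "u k"])
    let ?d = "\<lambda>y. min (6 * (u k \<bullet> \<psi> y)\<^sup>2) (\<bar>u k \<bullet> \<psi> y\<bar> ^ 3 / sqrt (real (n k)))"
    have dD: "?d y \<le> D (n k) y" for y
      unfolding D_def using uy2[of y] uy3[of y] by (intro min.mono divide_right_mono) auto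
    have d0: "0 \<le> ?d y" for y by simp
    have di: "integrable Q ?d"
      by (rule Bochner_Integration.integrable_bound[OF Dint[of "n k"]])
        (use dD d0 D0 in \<open>auto intro!: AE_I2\<close>)
    have "(\<integral>y. ?d y \<partial>Q) \<le> (\<integral>y. D (n k) y \<partial>Q)" by (rule integral_mono[OF di Dint dD])
    moreover have "(\<integral>y. (u k \<bullet> \<psi> y)\<^sup>2 \<partial>Q)\<^sup>2 \<le> (C\<^sup>2 * S)\<^sup>2"
    proof (rule power_mono)
      show "(\<integral>y. (u k \<bullet> \<psi> y)\<^sup>2 \<partial>Q) \<le> C\<^sup>2 * S"
        unfolding S_def using integral_mono[OF i2 _ uy2] int2 by simp
    qed simp
    then have "(\<integral>y. (u k \<bullet> \<psi> y)\<^sup>2 \<partial>Q)\<^sup>2 / (8 * real (n k)) \<le> (C\<^sup>2 * S)\<^sup>2 / 8 * (1 / real (n k))"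
      using nk by (simp add: divide_right_mono)
    ultimately show ?thesis
      using iid_char_bound[OF M Y _ i2 m0 nk] by simp
  qed
  have lim0: "(\<lambda>n. \<integral>y. D n y \<partial>Q) \<longlonglongrightarrow> (\<integral>y. 0 \<partial>Q)"
  proof (rule integral_dominated_convergence[where w = "\<lambda>y. 6 * C\<^sup>2 * (norm (\<psi> y))\<^sup>2"])
    show "AE y in Q. norm (D n y) \<le> 6 * C\<^sup>2 * (norm (\<psi> y))\<^sup>2" for n
      using D0[of n] by (intro AE_I2) (simp add: D_def)
    show "AE y in Q. (\<lambda>n. D n y) \<longlonglongrightarrow> 0"
    proof (rule AE_I2)
      fix y
      have "(\<lambda>n. C ^ 3 * norm (\<psi> y) ^ 3 / sqrt (real n)) \<longlonglongrightarrow> 0"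
        by (rule tendsto_divide_0[OF tendsto_const filterlim_at_top_imp_at_infinity])
          (rule filterlim_compose[OF sqrt_at_top filterlim_real_sequentially])
      then show "(\<lambda>n. D n y) \<longlonglongrightarrow> 0"
        by (rule tendsto_sandwich[OF _ _ tendsto_const, rotated 2])
          (use D0 in \<open>auto simp: D_def\<close>)
    qed
  qed (use int2 in simp_all)
  have "(\<lambda>k. (\<integral>y. D (n k) y \<partial>Q) / 6 + (C\<^sup>2 * S)\<^sup>2 / 8 * (1 / real (n k))) \<longlonglongrightarrow> 0 / 6 + (C\<^sup>2 * S)\<^sup>2 / 8 * 0"
    using filterlim_compose[OF lim0 n] filterlim_compose[OF lim_1_over_n n]
    by (intro tendsto_intros) simp_all
  then have lim: "(\<lambda>k. (\<integral>y. D (n k) y \<partial>Q) / 6 + (C\<^sup>2 * S)\<^sup>2 / 8 * (1 / real (n k))) \<longlonglongrightarrow> 0" by simp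
  have "\<forall>\<^sub>F k in sequentially. n k > 0"
    by (rule eventually_compose_filterlim[OF eventually_gt_at_top n])
  then show ?thesis
    by (intro Lim_null_comparison[OF eventually_mono[OF _ bound] lim])
qed

text \<open>Functions of the two variables generate smaller \<sigma>-algebras, and may take values in a
  common type even if the variables do not.\<close>

lemma indep_rvs_compose:
  assumes M: "prob_space M" and ind: "indep_rvs M N1 Z1 N2 Z2"
    and f: "f \<in> measurable N1 K1" and g: "g \<in> measurable N2 K2"
  shows "prob_space.indep_var M K1 (\<lambda>\<omega>. f (Z1 \<omega>)) K2 (\<lambda>\<omega>. g (Z2 \<omega>))"
proof -
  interpret prob_space M by fact
  have Z: "Z1 \<in> measurable M N1" "Z2 \<in> measurable M N2"
    and i: "indep_set {Z1 -` A \<inter> space M | A. A \<in> sets N1} {Z2 -` B \<inter> space M | B. B \<in> sets N2}"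
    using ind by (auto simp: indep_rvs_def)
  have sub1: "{(\<lambda>\<omega>. f (Z1 \<omega>)) -` A \<inter> space M | A. A \<in> sets K1} \<subseteq> {Z1 -` A \<inter> space M | A. A \<in> sets N1}"
  proof safe
    fix A assume "A \<in> sets K1"
    then have "f -` A \<inter> space N1 \<in> sets N1" using f by (rule measurable_sets[rotated])
    moreover have "(\<lambda>\<omega>. f (Z1 \<omega>)) -` A \<inter> space M = Z1 -` (f -` A \<inter> space N1) \<inter> space M"
      using measurable_space[OF Z(1)] by auto
    ultimately show "\<exists>B. (\<lambda>\<omega>. f (Z1 \<omega>)) -` A \<inter> space M = Z1 -` B \<inter> space M \<and> B \<in> sets N1" by blast
  qed
  have sub2: "{(\<lambda>\<omega>. g (Z2 \<omega>)) -` A \<inter> space M | A. A \<in> sets K2} \<subseteq> {Z2 -` A \<inter> space M | A. A \<in> sets N2}"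
  proof safe
    fix A assume "A \<in> sets K2"
    then have "g -` A \<inter> space N2 \<in> sets N2" using g by (rule measurable_sets[rotated])
    moreover have "(\<lambda>\<omega>. g (Z2 \<omega>)) -` A \<inter> space M = Z2 -` (g -` A \<inter> space N2) \<inter> space M"
      using measurable_space[OF Z(2)] by auto
    ultimately show "\<exists>B. (\<lambda>\<omega>. g (Z2 \<omega>)) -` A \<inter> space M = Z2 -` B \<inter> space M \<and> B \<in> sets N2" by blast
  qed
  have "indep_set {(\<lambda>\<omega>. f (Z1 \<omega>)) -` A \<inter> space M | A. A \<in> sets K1}
          {(\<lambda>\<omega>. g (Z2 \<omega>)) -` A \<inter> space M | A. A \<in> sets K2}"
    using i sub1 sub2 unfolding indep_sets2_eq by (meson subset_iff)
  then have "indep_sets (\<lambda>b. {case_bool (\<lambda>\<omega>. f (Z1 \<omega>)) (\<lambda>\<omega>. g (Z2 \<omega>)) b -` A \<inter> space M |A. A \<in> sets (case_bool K1 K2 b)}) UNIV"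
    unfolding indep_set_def
  proof (rule back_subst[of "\<lambda>F. indep_sets F UNIV"], intro ext)
    fix b show "(case b of True \<Rightarrow> {(\<lambda>\<omega>. f (Z1 \<omega>)) -` A \<inter> space M | A. A \<in> sets K1}
        | False \<Rightarrow> {(\<lambda>\<omega>. g (Z2 \<omega>)) -` A \<inter> space M | A. A \<in> sets K2}) =
      {case_bool (\<lambda>\<omega>. f (Z1 \<omega>)) (\<lambda>\<omega>. g (Z2 \<omega>)) b -` A \<inter> space M |A. A \<in> sets (case_bool K1 K2 b)}"
      by (cases b) simp_all
  qed
  moreover have "(\<lambda>\<omega>. f (Z1 \<omega>)) \<in> measurable M K1" "(\<lambda>\<omega>. g (Z2 \<omega>)) \<in> measurable M K2"
    using measurable_compose[OF Z(1) f] measurable_compose[OF Z(2) g] by auto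
  ultimately show ?thesis
    unfolding indep_var_def indep_vars_def2 by (auto split: bool.split)
qed

text \<open>By independence the characteristic function at \<open>t\<close> is a product of two factors, one for
  each sample, at frequencies \<open>u k = S t / sqrt n\<close> and \<open>v k = S t / sqrt m\<close> with
  \<open>S = \<Sigma>\<^sup>-\<^sup>1\<^sup>/\<^sup>2\<close>. Since \<open>norm (S t)\<close> is at most of order \<open>sqrt (min m n)\<close>, these frequencies
  remain bounded, so that each factor is close to its Gaussian counterpart. The exponents of
  these add up to \<open>- (S t) \<bullet> \<Sigma> (S t) / 2 = - (norm t)\<^sup>2 / 2\<close> exactly, for every \<open>k\<close>, which is
  why the individual factors do not have to converge.\<close>

lemma two_sample_char_limit:
  fixes \<psi> :: "'y \<Rightarrow> real ^ 'd::finite" and w :: "'x \<Rightarrow> real ^ 'd"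
  assumes M: "prob_space M" and X: "iid_seq M P X" and Y: "iid_seq M Q Y"
    and ind: "indep_rvs M (iid_space P) (\<lambda>\<omega> i. X i \<omega>) (iid_space Q) (\<lambda>\<omega> j. Y j \<omega>)"
    and \<psi>[measurable]: "\<psi> \<in> borel_measurable Q" and \<psi>2: "integrable Q (\<lambda>y. (norm (\<psi> y))\<^sup>2)"
    and \<psi>0: "(\<integral>y. \<psi> y \<partial>Q) = 0"
    and w[measurable]: "w \<in> borel_measurable P" and w2: "integrable P (\<lambda>x. (norm (w x))\<^sup>2)"
    and w0: "(\<integral>x. w x \<partial>P) = 0"
    and V: "pos_def V" "\<And>u. u \<bullet> (V *v u) = (\<integral>y. (u \<bullet> \<psi> y)\<^sup>2 \<partial>Q)"
    and W: "pos_def W" "\<And>u. u \<bullet> (W *v u) = (\<integral>x. (u \<bullet> w x)\<^sup>2 \<partial>P)"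
    and m: "filterlim m at_top sequentially" and n: "filterlim n at_top sequentially"
    and pos: "\<And>k. m k > 0" "\<And>k. n k > 0"
    and Sdef: "\<And>k. \<Sigma> k = (1 / real (n k)) *\<^sub>R V + (1 / real (m k)) *\<^sub>R W"
    and Sbound: "\<And>k t. norm (inv_sqrt_matrix (\<Sigma> k) *v t) \<le> K * sqrt (real (min (m k) (n k))) * norm t"
    and Spd: "\<And>k. pos_def (\<Sigma> k)"
  shows "(\<lambda>k. CLINT \<omega>|M. iexp (t \<bullet> (inv_sqrt_matrix (\<Sigma> k) *v
            ((1 / real (n k)) *\<^sub>R (\<Sum>j<n k. \<psi> (Y j \<omega>)) + (1 / real (m k)) *\<^sub>R (\<Sum>i<m k. w (X i \<omega>))))))
        \<longlonglongrightarrow> exp (- (norm t)\<^sup>2 / 2)"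
proof -
  interpret prob_space M by fact
  have Ym[measurable]: "Y i \<in> measurable M Q" for i by (rule iid_seq_measurable[OF M Y])
  have Xm[measurable]: "X i \<in> measurable M P" for i by (rule iid_seq_measurable[OF M X])
  define s where "s k = inv_sqrt_matrix (\<Sigma> k) *v t" for k
  define u where "u k = (1 / sqrt (real (n k))) *\<^sub>R s k" for k
  define v where "v k = (1 / sqrt (real (m k))) *\<^sub>R s k" for k
  define A where "A k = (CLINT \<omega>|M. iexp ((\<Sum>j<n k. u k \<bullet> \<psi> (Y j \<omega>)) / sqrt (real (n k))))" for k
  define B where "B k = (CLINT \<omega>|M. iexp ((\<Sum>i<m k. v k \<bullet> w (X i \<omega>)) / sqrt (real (m k))))" for k
  define a where "a k = complex_of_real (exp (- (\<integral>y. (u k \<bullet> \<psi> y)\<^sup>2 \<partial>Q) / 2))" for k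
  define b where "b k = complex_of_real (exp (- (\<integral>x. (v k \<bullet> w x)\<^sup>2 \<partial>P) / 2))" for k
  have K0: "0 \<le> K * norm t"
  proof -
    have "0 \<le> sqrt (real (min (m 0) (n 0))) * (K * norm t)"
      using Sbound[of 0 t] norm_ge_zero[of "inv_sqrt_matrix (\<Sigma> 0) *v t"] by (simp only: mult_ac)
    moreover have "0 < sqrt (real (min (m 0) (n 0)))" using pos by simp
    ultimately show ?thesis by (metis mult_pos_neg not_le)
  qed
  have sc: "norm ((1 / sqrt (real l)) *\<^sub>R s k) \<le> K * norm t" if "l > 0" "min (m k) (n k) \<le> l" for k l
  proof -
    have "norm (s k) \<le> (K * norm t) * sqrt (real (min (m k) (n k)))"
      using Sbound[of k t] by (simp add: s_def mult_ac)
    also have "\<dots> \<le> (K * norm t) * sqrt (real l)" using that K0 by (intro mult_left_mono) auto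
    finally show ?thesis using that by (simp add: field_simps)
  qed
  have u: "norm (u k) \<le> K * norm t" and v: "norm (v k) \<le> K * norm t" for k
    unfolding u_def v_def by (rule sc; simp add: pos)+
  have Alim: "(\<lambda>k. A k - a k) \<longlonglongrightarrow> 0"
    unfolding A_def a_def by (rule iid_char_limit[OF M Y \<psi> \<psi>2 \<psi>0 n u])
  have Blim: "(\<lambda>k. B k - b k) \<longlonglongrightarrow> 0"
    unfolding B_def b_def by (rule iid_char_limit[OF M X w w2 w0 m v])
  have B1: "cmod (B k) \<le> 1" for k
  proof -
    have "cmod (B k) \<le> (LINT \<omega>|M. cmod (iexp ((\<Sum>i<m k. v k \<bullet> w (X i \<omega>)) / sqrt (real (m k)))))"
      unfolding B_def by (rule integral_norm_bound)
    then show ?thesis by (simp add: prob_space)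
  qed
  have a1: "cmod (a k) \<le> 1" for k by (simp add: a_def)
  have ab: "a k * b k = exp (- (norm t)\<^sup>2 / 2)" for k
  proof -
    have nn: "sqrt (real (n k)) * sqrt (real (n k)) = real (n k)" "sqrt (real (m k)) * sqrt (real (m k)) = real (m k)" by auto
    have "u k \<bullet> (V *v u k) + v k \<bullet> (W *v v k) = s k \<bullet> (\<Sigma> k *v s k)"
      using nn by (simp add: u_def v_def Sdef matrix_vector_mult_add_rdistrib matrix_vector_mult_scaleR
          scaleR_matrix_vector_assoc[symmetric] inner_add_right)
    also have "\<dots> = (norm t)\<^sup>2"
      unfolding s_def by (simp add: inv_sqrt_matrix_sandwich[OF Spd] dot_square_norm)
    finally have e: "u k \<bullet> (V *v u k) + v k \<bullet> (W *v v k) = (norm t)\<^sup>2" .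
    have "a k * b k = complex_of_real (exp (- (u k \<bullet> (V *v u k) + v k \<bullet> (W *v v k)) / 2))"
      unfolding a_def b_def V(2)[symmetric] W(2)[symmetric]
      by (simp only: of_real_mult[symmetric] exp_add[symmetric]) (simp add: add_divide_distrib diff_divide_distrib)
    then show ?thesis by (simp only: e)
  qed
  have AB: "(CLINT \<omega>|M. iexp (t \<bullet> (inv_sqrt_matrix (\<Sigma> k) *v
            ((1 / real (n k)) *\<^sub>R (\<Sum>j<n k. \<psi> (Y j \<omega>)) + (1 / real (m k)) *\<^sub>R (\<Sum>i<m k. w (X i \<omega>)))))) = B k * A k" for k
  proof -
    define F where "F x = (\<Sum>i<m k. v k \<bullet> w (x i)) / sqrt (real (m k))" for x :: "nat \<Rightarrow> 'x"
    define G where "G y = (\<Sum>j<n k. u k \<bullet> \<psi> (y j)) / sqrt (real (n k))" for y :: "nat \<Rightarrow> 'y"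
    have [measurable]: "F \<in> borel_measurable (iid_space P)" "G \<in> borel_measurable (iid_space Q)"
      unfolding F_def G_def by measurable
    have iv: "indep_var borel (\<lambda>\<omega>. iexp (F (\<lambda>i. X i \<omega>))) borel (\<lambda>\<omega>. iexp (G (\<lambda>j. Y j \<omega>)))"
      by (rule indep_rvs_compose[OF M ind, of "\<lambda>x. iexp (F x)" borel "\<lambda>y. iexp (G y)" borel]) measurable
    have [measurable]: "(\<lambda>\<omega>. F (\<lambda>i. X i \<omega>)) \<in> borel_measurable M" "(\<lambda>\<omega>. G (\<lambda>i. Y i \<omega>)) \<in> borel_measurable M"
      unfolding F_def G_def by measurable
    have "t \<bullet> (inv_sqrt_matrix (\<Sigma> k) *v z) = s k \<bullet> z" for z
      unfolding s_def by (rule pos_def_inner[OF inv_sqrt_matrix(1)[OF Spd]])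
    then have "t \<bullet> (inv_sqrt_matrix (\<Sigma> k) *v
            ((1 / real (n k)) *\<^sub>R (\<Sum>j<n k. \<psi> (Y j \<omega>)) + (1 / real (m k)) *\<^sub>R (\<Sum>i<m k. w (X i \<omega>)))) =
        F (\<lambda>i. X i \<omega>) + G (\<lambda>j. Y j \<omega>)" for \<omega>
      by (simp add: F_def G_def u_def v_def inner_add_right inner_sum_right sum_divide_distrib sum_distrib_left)
    then have "(CLINT \<omega>|M. iexp (t \<bullet> (inv_sqrt_matrix (\<Sigma> k) *v
            ((1 / real (n k)) *\<^sub>R (\<Sum>j<n k. \<psi> (Y j \<omega>)) + (1 / real (m k)) *\<^sub>R (\<Sum>i<m k. w (X i \<omega>)))))) =
        (CLINT \<omega>|M. iexp (F (\<lambda>i. X i \<omega>)) * iexp (G (\<lambda>j. Y j \<omega>)))"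
      by (simp only: of_real_add distrib_left exp_add)
    also have "\<dots> = (CLINT \<omega>|M. iexp (F (\<lambda>i. X i \<omega>))) * (CLINT \<omega>|M. iexp (G (\<lambda>j. Y j \<omega>)))"
      by (rule indep_var_lebesgue_integral[OF iv]) (rule integrable_iexp; measurable)+
    finally show ?thesis by (simp add: A_def B_def F_def G_def)
  qed
  have "(\<lambda>k. B k * A k - exp (- (norm t)\<^sup>2 / 2)) \<longlonglongrightarrow> 0"
  proof (rule Lim_null_comparison[where g = "\<lambda>k. cmod (A k - a k) + cmod (B k - b k)"])
    show "(\<lambda>k. cmod (A k - a k) + cmod (B k - b k)) \<longlonglongrightarrow> 0"
      using tendsto_add[OF tendsto_norm_zero[OF Alim] tendsto_norm_zero[OF Blim]] by simp
    have "cmod (B k * A k - a k * b k) \<le> cmod (A k - a k) + cmod (B k - b k)" for k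
    proof -
      have "B k * A k - a k * b k = B k * (A k - a k) + a k * (B k - b k)" by (simp add: algebra_simps)
      then have "cmod (B k * A k - a k * b k) \<le> cmod (B k) * cmod (A k - a k) + cmod (a k) * cmod (B k - b k)"
        using norm_triangle_ineq[of "B k * (A k - a k)" "a k * (B k - b k)"] by (simp add: norm_mult)
      also have "\<dots> \<le> 1 * cmod (A k - a k) + 1 * cmod (B k - b k)"
        by (intro add_mono mult_right_mono B1 a1) auto
      finally show ?thesis by simp
    qed
    then show "\<forall>\<^sub>F k in sequentially. norm (B k * A k - exp (- (norm t)\<^sup>2 / 2)) \<le> cmod (A k - a k) + cmod (B k - b k)"
      unfolding ab by simp
  qed
  then show ?thesis unfolding AB by (simp add: LIM_zero_iff)
qed

section \<open>Vector integrals, joint measurability and joint limits\<close>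

lemma integral_vec_nth:
  assumes "integrable N (F :: _ \<Rightarrow> real ^ 'd)"
  shows "integrable N (\<lambda>x. F x $ i)" "(\<integral>x. F x \<partial>N) $ i = (\<integral>x. F x $ i \<partial>N)"
  using integrable_bounded_linear[OF bounded_linear_vec_nth assms]
    integral_bounded_linear[OF bounded_linear_vec_nth assms] by simp_all

lemma integral_mat_nth:
  assumes "integrable N (F :: _ \<Rightarrow> real ^ 'd ^ 'e)"
  shows "integrable N (\<lambda>x. F x $ i $ j)" "(\<integral>x. F x \<partial>N) $ i $ j = (\<integral>x. F x $ i $ j \<partial>N)"
  using integrable_bounded_linear[OF bounded_linear_compose[OF bounded_linear_vec_nth bounded_linear_vec_nth] assms]
    integral_bounded_linear[OF bounded_linear_compose[OF bounded_linear_vec_nth bounded_linear_vec_nth] assms]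
  by simp_all

text \<open>By continuity in \<open>y\<close>, \<open>F\<close> is a limit of countably valued approximations in \<open>y\<close>: replace
  \<open>y\<close> by a point \<open>d (L l y)\<close> of a countable dense set at distance below \<open>1 / (l + 1)\<close>, chosen
  measurably as the first one in an enumeration, and let \<open>l\<close> tend to infinity.\<close>

lemma caratheodory_measurable:
  fixes F :: "'x \<Rightarrow> 'y::{metric_space, second_countable_topology} \<Rightarrow> real"
  assumes Fm: "\<And>y. (\<lambda>x. F x y) \<in> borel_measurable N"
    and Fc: "\<And>x. x \<in> space N \<Longrightarrow> continuous_on UNIV (F x)"
    and Q: "space Q = UNIV" "sets borel \<subseteq> sets Q"
  shows "(\<lambda>(x, y). F x y) \<in> borel_measurable (N \<Otimes>\<^sub>M Q)"
proof -
  from countable_dense_exists[where 'a = 'y]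
  obtain D :: "'y set" where D': "countable D \<and> (\<forall>X. open X \<longrightarrow> X \<noteq> {} \<longrightarrow> (\<exists>d\<in>D. d \<in> X))"
    by (rule exE)
  note D = conjunct1[OF D'] conjunct2[OF D', rule_format]
  define d where "d = from_nat_into D"
  have dense: "\<exists>k. dist y (d k) < e" if "e > 0" for y e
  proof -
    have "ball y e \<noteq> {}" using \<open>e > 0\<close> by simp
    from D(2)[OF open_ball this] obtain z where z: "z \<in> D" "z \<in> ball y e" by blast
    obtain k where "d k = z"
      using from_nat_into_surj[OF D(1) z(1)] unfolding d_def by blast
    then show ?thesis using z(2) by (intro exI[of _ k]) simp
  qed
  define L where "L l y = (LEAST k. dist y (d k) < 1 / real (Suc l))" for l y
  have L: "dist y (d (L l y)) < 1 / real (Suc l)" for l y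
    unfolding L_def by (rule LeastI_ex[OF dense]) simp
  \<comment> \<open>\<open>Q\<close> may have more measurable sets than the Borel sets, so measurability is transferred by
    hand.\<close>
  have bQ: "U \<in> borel_measurable Q" if "U \<in> borel_measurable borel" for U :: "'y \<Rightarrow> real"
  proof (rule measurableI)
    fix A :: "real set" assume "A \<in> sets borel"
    then have "U -` A \<in> sets borel" using measurable_sets[OF that] by simp
    then show "U -` A \<inter> space Q \<in> sets Q" using Q by auto
  qed simp
  have Lm: "L l \<in> measurable Q (count_space UNIV)" for l
    unfolding L_def
  proof (rule measurable_Least)
    fix k
    have "(\<lambda>y. dist y (d k)) \<in> borel_measurable Q"
      by (intro bQ borel_measurable_continuous_onI continuous_intros)
    then show "(\<lambda>y. dist y (d k) < 1 / real (Suc l)) \<in> measurable Q (count_space UNIV)"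
      by (intro borel_measurable_pred_less) simp_all
  qed
  show ?thesis
  proof (rule borel_measurable_LIMSEQ_real)
    fix z assume z: "z \<in> space (N \<Otimes>\<^sub>M Q)"
    obtain x y where xy: "z = (x, y)" by (cases z)
    have "(\<lambda>l. dist (d (L l y)) y) \<longlonglongrightarrow> 0"
    proof (rule tendsto_sandwich[OF _ _ tendsto_const LIMSEQ_inverse_real_of_nat])
      have "dist (d (L l y)) y \<le> inverse (real (Suc l))" for l
        using L[of y l] unfolding dist_commute[of y] inverse_eq_divide by (rule less_imp_le)
      then show "\<forall>\<^sub>F l in sequentially. dist (d (L l y)) y \<le> inverse (real (Suc l))" by simp
    qed simp
    then have "(\<lambda>l. d (L l y)) \<longlonglongrightarrow> y" by (rule tendsto_dist_iff[THEN iffD2])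
    moreover have "x \<in> space N" using z xy by (simp add: space_pair_measure)
    then have "isCont (F x) y" using Fc continuous_on_eq_continuous_at[OF open_UNIV] by blast
    ultimately have "(\<lambda>l. F x (d (L l y))) \<longlonglongrightarrow> F x y" by (rule isCont_tendsto_compose[rotated])
    then show "(\<lambda>l. (\<lambda>(x, y). F x (d (L l y))) z) \<longlonglongrightarrow> (\<lambda>(x, y). F x y) z"
      by (simp add: xy)
  next
    fix l
    have "(\<lambda>z. F (fst z) (d (L l (snd z)))) \<in> borel_measurable (N \<Otimes>\<^sub>M Q)"
      by (rule measurable_compose_countable[of "\<lambda>k z. F (fst z) (d k)",
            OF measurable_compose[OF measurable_fst Fm] measurable_compose[OF measurable_snd Lm]])
    then show "(\<lambda>(x, y). F x (d (L l y))) \<in> borel_measurable (N \<Otimes>\<^sub>M Q)" by (simp add: case_prod_beta')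
  qed
qed

text \<open>Sequences suffice for the double limit: if it fails, pick for every \<open>k\<close> a bad pair with
  both components beyond \<open>k\<close>.\<close>

lemma tendsto_prod_sequentiallyI:
  fixes F :: "nat \<times> nat \<Rightarrow> 'a::metric_space"
  assumes "\<And>m n. (\<And>k. k < m k) \<Longrightarrow> (\<And>k. k < n k) \<Longrightarrow> (\<lambda>k. F (m k, n k)) \<longlonglongrightarrow> l"
  shows "(F \<longlongrightarrow> l) (sequentially \<times>\<^sub>F sequentially)"
proof (rule tendstoI, rule ccontr)
  fix e :: real assume "e > 0"
  assume "\<not> (\<forall>\<^sub>F p in sequentially \<times>\<^sub>F sequentially. dist (F p) l < e)"
  then have "\<forall>k. \<exists>p. k < fst p \<and> k < snd p \<and> \<not> dist (F p) l < e"
    unfolding eventually_prod_sequentially by (metis Suc_le_eq fst_conv snd_conv)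
  from choice[OF this] obtain p where
    p: "\<forall>k. k < fst (p k) \<and> k < snd (p k) \<and> \<not> dist (F (p k)) l < e" ..
  have "(\<lambda>k. F (fst (p k), snd (p k))) \<longlonglongrightarrow> l" by (rule assms) (use p in auto)
  from tendstoD[OF this \<open>e > 0\<close>] have "\<forall>\<^sub>F k in sequentially. dist (F (p k)) l < e" by simp
  then have "\<forall>\<^sub>F k in sequentially. False" using p by (auto elim: eventually_mono)
  then show False by simp
qed

section \<open>The Monte Carlo model\<close>

text \<open>The hypotheses on densities and function classes; the samples and the estimator enter
  later. \<open>\<theta>s\<close> stands for \<open>\<theta>\<^sup>*\<close>.\<close>

locale mc_model =
  fixes \<Theta> :: "(real ^ 'd::finite) set"
    and f :: "real ^ 'd \<Rightarrow> 'x \<Rightarrow> 'y::{metric_space, second_countable_topology} \<Rightarrow> real"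
    and \<mu> P :: "'x measure" and \<nu> Q :: "'y measure"
    and h :: "'x \<Rightarrow> real" and g :: "'y \<Rightarrow> real"
    and \<theta>s :: "real ^ 'd" and \<rho> :: real
    and E :: "'x \<Rightarrow> real ^ 'd"
  assumes Y_space: "space \<nu> = UNIV" "sets borel \<subseteq> sets \<nu>"
    and f_density: "\<And>\<theta>. \<theta> \<in> \<Theta> \<Longrightarrow> is_prob_density (\<mu> \<Otimes>\<^sub>M \<nu>) (\<lambda>(x, y). f \<theta> x y)"
    and marg_pos: "\<And>\<theta> y. \<theta> \<in> \<Theta> \<Longrightarrow> integrable \<mu> (\<lambda>x. f \<theta> x y) \<and> 0 < marg_density \<mu> f \<theta> y"
    and h_density: "is_prob_density \<mu> h" and P_def: "P = density \<mu> (\<lambda>x. ennreal (h x))"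
    and g_density: "is_prob_density \<nu> g" and Q_def: "Q = density \<nu> (\<lambda>y. ennreal (g y))"
    and importance: "\<And>\<theta> y. \<theta> \<in> \<Theta> \<Longrightarrow> (\<integral>x. f \<theta> x y / h x \<partial>P) = marg_density \<mu> f \<theta> y"
    and A1_smooth: "\<And>x y. x \<in> space \<mu> \<Longrightarrow>
          second_partials_exist_on (\<lambda>\<theta>. f \<theta> x y) (interior \<Theta>) \<and>
          continuous_on (interior \<Theta>) (hess (\<lambda>\<theta>. f \<theta> x y))"
    and A1_integral: "\<And>y. second_partials_under_integral \<mu> (\<lambda>\<theta> x. cond_density \<mu> f \<theta> x y) (interior \<Theta>)"
    and A2: "\<And>x. x \<in> space \<mu> \<Longrightarrow>
          continuous_on UNIV (\<lambda>y. grad (\<lambda>\<theta>. cond_density \<mu> f \<theta> x y) \<theta>s)"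
    and A3_interior: "\<theta>s \<in> interior \<Theta>"
    and A4: "\<rho> > 0" "cball \<theta>s \<rho> \<subseteq> \<Theta>"
          "glivenko_cantelli_mat Q
             {(\<lambda>y. hess (\<lambda>\<theta>. ln (marg_density \<mu> f \<theta> y)) \<theta>') | \<theta>'. \<theta>' \<in> cball \<theta>s \<rho>}"
    and A5: "glivenko_cantelli P (range (\<lambda>y x. cond_density \<mu> f \<theta>s x y / h x))"
    and A6_donsker: "donsker_vec P
             (range (\<lambda>y x. grad (\<lambda>\<theta>. cond_density \<mu> f \<theta> x y) \<theta>s /\<^sub>R h x))"
    and A6_envelope: "envelope_vec P
             (range (\<lambda>y x. grad (\<lambda>\<theta>. cond_density \<mu> f \<theta> x y) \<theta>s /\<^sub>R h x)) E"
          "finite_second_moment P E"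
    and A7: "glivenko_cantelli_mat P
             {(\<lambda>x. hess (\<lambda>\<theta>. cond_density \<mu> f \<theta> x y) \<theta>' /\<^sub>R h x) | y \<theta>'. \<theta>' \<in> cball \<theta>s \<rho>}"

context mc_model
begin

abbreviation cond where "cond \<equiv> cond_density \<mu> f"
abbreviation marg where "marg \<equiv> marg_density \<mu> f"

abbreviation log_marg_hess :: "'d \<Rightarrow> 'd \<Rightarrow> real ^ 'd \<Rightarrow> 'y \<Rightarrow> real" where
  "log_marg_hess i j \<theta> y \<equiv> partial_deriv i (partial_deriv j (\<lambda>\<theta>. ln (marg \<theta> y))) \<theta>"

text \<open>The quantity called \<open>a\<^sub>m(\<theta>, y)\<close> above: the Monte Carlo approximation of the marginal
  density relative to that density. It is a function of the path \<open>x\<close> so that properties of the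
  canonical sample space apply directly.\<close>

definition ratio :: "(nat \<Rightarrow> 'x) \<Rightarrow> nat \<Rightarrow> real ^ 'd \<Rightarrow> 'y \<Rightarrow> real" where
  "ratio x m \<theta> y = empirical x m (\<lambda>z. cond \<theta> z y / h z)"

lemma space_P [simp]: "space P = space \<mu>" and sets_P [measurable_cong]: "sets P = sets \<mu>"
  and space_Q [simp]: "space Q = UNIV" and sets_Q [measurable_cong]: "sets Q = sets \<nu>"
  by (simp_all add: P_def Q_def Y_space)

lemma h_measurable [measurable]: "h \<in> borel_measurable \<mu>"
  and h_nonneg: "x \<in> space \<mu> \<Longrightarrow> 0 \<le> h x"
  using h_density by (auto simp: is_prob_density_def)

lemma prob_space_P: "prob_space P"
  using h_density by (auto simp: P_def is_prob_density_def emeasure_density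
      intro!: prob_spaceI cong: nn_integral_cong)

lemma prob_space_Q: "prob_space Q"
  using g_density by (auto simp: Q_def is_prob_density_def emeasure_density
      intro!: prob_spaceI cong: nn_integral_cong)

lemma AE_g_pos: "AE y in Q. 0 < g y"
proof -
  have "g \<in> borel_measurable \<nu>" using g_density by (simp add: is_prob_density_def)
  then show ?thesis unfolding Q_def by (subst AE_density) auto
qed

lemma iid_path_in_space: "x \<in> space (iid_space P) \<Longrightarrow> x i \<in> space \<mu>"
  by (auto simp: space_PiM PiE_def Pi_def)

lemma in_Theta: "\<theta> \<in> interior \<Theta> \<Longrightarrow> \<theta> \<in> \<Theta>"
  using interior_subset by blast

lemma ball_in_interior: "ball \<theta>s \<rho> \<subseteq> interior \<Theta>"
  by (rule interior_maximal) (use A4(2) ball_subset_cball in auto)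

lemma f_nonneg: "\<theta> \<in> \<Theta> \<Longrightarrow> x \<in> space \<mu> \<Longrightarrow> 0 \<le> f \<theta> x y"
  using f_density[of \<theta>] Y_space by (auto simp: is_prob_density_def space_pair_measure)

subsection \<open>Importance sampling and mean values\<close>

text \<open>\<open>P\<close> does not see the set where \<open>h\<close> vanishes, so \<open>G / h\<close> has the right mean only if \<open>G\<close>
  vanishes there as well; on that set the quotient is 0 by convention.\<close>

lemma importance_integral:
  assumes G: "integrable \<mu> G" and zero: "AE x in \<mu>. h x = 0 \<longrightarrow> G x = 0"
  shows "(\<integral>x. G x / h x \<partial>P) = (\<integral>x. G x \<partial>\<mu>)"
proof -
  have [measurable]: "G \<in> borel_measurable \<mu>" using G by simp
  have "(\<integral>x. G x / h x \<partial>P) = (\<integral>x. h x *\<^sub>R (G x / h x) \<partial>\<mu>)"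
    unfolding P_def by (rule integral_density) (use h_nonneg in auto)
  also have "\<dots> = (\<integral>x. G x \<partial>\<mu>)"
    by (rule integral_cong_AE) (use zero in \<open>auto elim!: eventually_mono\<close>)
  finally show ?thesis .
qed

text \<open>The importance sampling identity equates the integral of \<open>f\<close> over the set where \<open>h\<close> is
  positive with the integral of \<open>f\<close> over the whole space. As \<open>f\<close> is nonnegative, it vanishes
  almost everywhere where \<open>h\<close> does.\<close>

lemma f_zero_off_support:
  assumes \<theta>: "\<theta> \<in> \<Theta>"
  shows "AE x in \<mu>. h x = 0 \<longrightarrow> f \<theta> x y = 0"
proof -
  let ?F = "\<lambda>x. f \<theta> x y"
  have int: "integrable \<mu> ?F" using marg_pos[OF \<theta>] by simp
  then have [measurable]: "?F \<in> borel_measurable \<mu>" by simp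
  have int0: "integrable \<mu> (\<lambda>x. ?F x * indicator {x. h x = 0} x)"
    by (rule Bochner_Integration.integrable_bound[OF int]) (auto simp: indicator_def)
  have int1: "integrable \<mu> (\<lambda>x. ?F x - ?F x * indicator {x. h x = 0} x)" using int int0 by simp
  have "marg \<theta> y = (\<integral>x. (?F x - ?F x * indicator {x. h x = 0} x) / h x \<partial>P)"
    unfolding importance[OF \<theta>, symmetric]
    by (rule Bochner_Integration.integral_cong) (auto simp: indicator_def)
  also have "\<dots> = (\<integral>x. ?F x - ?F x * indicator {x. h x = 0} x \<partial>\<mu>)"
    by (rule importance_integral[OF int1]) simp
  also have "\<dots> = marg \<theta> y - (\<integral>x. ?F x * indicator {x. h x = 0} x \<partial>\<mu>)"
    using int int0 by (simp add: marg_density_def)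
  finally have "(\<integral>x. ?F x * indicator {x. h x = 0} x \<partial>\<mu>) = 0" by simp
  then have "AE x in \<mu>. ?F x * indicator {x. h x = 0} x = 0"
    by (subst (asm) integral_nonneg_eq_0_iff_AE[OF int0])
      (use f_nonneg[OF \<theta>] in \<open>auto intro!: AE_I2 simp: indicator_def\<close>)
  then show ?thesis by eventually_elim (auto simp: indicator_def split: if_splits)
qed

lemma cond_partials:
  assumes "x \<in> space \<mu>"
  shows "second_partials_exist_on (\<lambda>\<theta>. cond \<theta> x y) (interior \<Theta>)"
  using A1_integral[of y] assms by (simp add: second_partials_under_integral_def)

text \<open>Derivatives inherit this; the null set may depend on the parameter, but
  \<open>AE_zero_partial_deriv\<close> needs no more.\<close>

lemma
  assumes \<theta>: "\<theta> \<in> interior \<Theta>"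
  shows cond_zero_off_support: "AE x in \<mu>. h x = 0 \<longrightarrow> cond \<theta> x y = 0"
    and cond_grad_zero_off_support:
      "AE x in \<mu>. h x = 0 \<longrightarrow> partial_deriv j (\<lambda>\<theta>. cond \<theta> x y) \<theta> = 0"
    and cond_hess_zero_off_support:
      "AE x in \<mu>. h x = 0 \<longrightarrow> partial_deriv i (partial_deriv j (\<lambda>\<theta>. cond \<theta> x y)) \<theta> = 0"
proof -
  have 0: "AE x in \<mu>. h x = 0 \<longrightarrow> cond \<theta> x y = 0" if "\<theta> \<in> interior \<Theta>" for \<theta>
    using f_zero_off_support[OF in_Theta[OF that], of y]
    by eventually_elim (simp add: cond_density_def)
  have 1: "AE x in \<mu>. h x = 0 \<longrightarrow> partial_deriv j (\<lambda>\<theta>. cond \<theta> x y) \<theta> = 0" if "\<theta> \<in> interior \<Theta>" for \<theta>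
    by (rule AE_zero_partial_deriv[OF open_interior that 0])
      (use cond_partials that in \<open>auto simp: second_partials_exist_on_def\<close>)
  show "AE x in \<mu>. h x = 0 \<longrightarrow> cond \<theta> x y = 0" by (rule 0[OF \<theta>])
  show "AE x in \<mu>. h x = 0 \<longrightarrow> partial_deriv j (\<lambda>\<theta>. cond \<theta> x y) \<theta> = 0" by (rule 1[OF \<theta>])
  show "AE x in \<mu>. h x = 0 \<longrightarrow> partial_deriv i (partial_deriv j (\<lambda>\<theta>. cond \<theta> x y)) \<theta> = 0"
    by (rule AE_zero_partial_deriv[OF open_interior \<theta> 1])
      (use cond_partials \<theta> in \<open>auto simp: second_partials_exist_on_def\<close>)
qed

lemma integral_cond: "\<theta> \<in> \<Theta> \<Longrightarrow> (\<integral>x. cond \<theta> x y \<partial>\<mu>) = 1"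
  using marg_pos[of \<theta> y] by (simp add: cond_density_def flip: marg_density_def)

text \<open>The conditional density integrates to 1 for every \<open>\<theta>\<close>. Differentiating this constant under
  the integral sign gives 0, and dividing by \<open>h\<close> turns integrals with respect to \<open>\<mu>\<close> into means
  under \<open>P\<close>.\<close>

lemma
  assumes \<theta>: "\<theta> \<in> interior \<Theta>"
  shows mean_ratio: "(\<integral>x. cond \<theta> x y / h x \<partial>P) = 1"
    and mean_ratio_grad: "(\<integral>x. partial_deriv j (\<lambda>\<theta>. cond \<theta> x y) \<theta> / h x \<partial>P) = 0"
    and mean_ratio_hess: "(\<integral>x. partial_deriv i (partial_deriv j (\<lambda>\<theta>. cond \<theta> x y)) \<theta> / h x \<partial>P) = 0"
proof -
  have "integrable \<mu> (\<lambda>x. cond \<theta> x y)"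
    using marg_pos[OF in_Theta[OF \<theta>], of y] by (simp add: cond_density_def)
  from importance_integral[OF this cond_zero_off_support[OF \<theta>]]
  show "(\<integral>x. cond \<theta> x y / h x \<partial>P) = 1" by (simp add: integral_cond[OF in_Theta[OF \<theta>]])
  have u1: "(\<integral>x. cond \<theta> x y \<partial>\<mu>) = 1" if "\<theta> \<in> interior \<Theta>" for \<theta>
    by (rule integral_cond[OF in_Theta[OF that]])
  have D1: "partial_deriv j (\<lambda>\<theta>. \<integral>x. cond \<theta> x y \<partial>\<mu>) \<theta> = 0" if "\<theta> \<in> interior \<Theta>" for \<theta>
    using partial_deriv_cong_open(1)[OF open_interior that, of "\<lambda>\<theta>. \<integral>x. cond \<theta> x y \<partial>\<mu>" "\<lambda>_. 1"] u1
    by simp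
  have D2: "partial_deriv i (partial_deriv j (\<lambda>\<theta>. \<integral>x. cond \<theta> x y \<partial>\<mu>)) \<theta> = 0"
    using partial_deriv_cong_open(1)[OF open_interior \<theta>,
        of "partial_deriv j (\<lambda>\<theta>. \<integral>x. cond \<theta> x y \<partial>\<mu>)" "\<lambda>_. 0"] D1 by simp
  have int: "integrable \<mu> (\<lambda>x. grad (\<lambda>\<theta>. cond \<theta> x y) \<theta>)"
    "grad (\<lambda>\<theta>. \<integral>x. cond \<theta> x y \<partial>\<mu>) \<theta> = (\<integral>x. grad (\<lambda>\<theta>. cond \<theta> x y) \<theta> \<partial>\<mu>)"
    "integrable \<mu> (\<lambda>x. hess (\<lambda>\<theta>. cond \<theta> x y) \<theta>)"
    "hess (\<lambda>\<theta>. \<integral>x. cond \<theta> x y \<partial>\<mu>) \<theta> = (\<integral>x. hess (\<lambda>\<theta>. cond \<theta> x y) \<theta> \<partial>\<mu>)"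
    using A1_integral[of y] \<theta> by (simp_all add: second_partials_under_integral_def)
  have i1: "integrable \<mu> (\<lambda>x. partial_deriv j (\<lambda>\<theta>. cond \<theta> x y) \<theta>)"
    using integral_vec_nth(1)[OF int(1), of j] by (simp add: grad_def)
  show "(\<integral>x. partial_deriv j (\<lambda>\<theta>. cond \<theta> x y) \<theta> / h x \<partial>P) = 0"
    using integral_vec_nth(2)[OF int(1), of j] D1[OF \<theta>] arg_cong[OF int(2), of "\<lambda>v. v $ j"]
    by (simp add: importance_integral[OF i1 cond_grad_zero_off_support[OF \<theta>]] grad_def)
  have i2: "integrable \<mu> (\<lambda>x. partial_deriv i (partial_deriv j (\<lambda>\<theta>. cond \<theta> x y)) \<theta>)"
    using integral_mat_nth(1)[OF int(3), of i j] by (simp add: hess_def)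
  show "(\<integral>x. partial_deriv i (partial_deriv j (\<lambda>\<theta>. cond \<theta> x y)) \<theta> / h x \<partial>P) = 0"
    using integral_mat_nth(2)[OF int(3), of i j] D2 arg_cong[OF int(4), of "\<lambda>v. v $ i $ j"]
    by (simp add: importance_integral[OF i2 cond_hess_zero_off_support[OF \<theta>]] hess_def)
qed

subsection \<open>Derivatives of the log marginal density and of the ratio\<close>

text \<open>Smoothness is known for \<open>f\<close> and for the conditional density. Near \<open>\<theta>0\<close> pick a point \<open>x\<close>
  with \<open>f \<theta>0 x y > 0\<close>; then \<open>ln (marg \<theta> y) = ln (f \<theta> x y) - ln (cond \<theta> x y)\<close> in a neighbourhood.\<close>

lemma log_marg_second_partials:
  shows "second_partials_exist_on (\<lambda>\<theta>. ln (marg \<theta> y)) (interior \<Theta>)"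
proof -
  have "\<exists>U. open U \<and> \<theta>0 \<in> U \<and> U \<subseteq> interior \<Theta> \<and> second_partials_exist_on (\<lambda>\<theta>. ln (marg \<theta> y)) U"
    if \<theta>0: "\<theta>0 \<in> interior \<Theta>" for \<theta>0
  proof -
    have "\<exists>x\<in>space \<mu>. f \<theta>0 x y > 0"
    proof (rule ccontr)
      assume "\<not> ?thesis"
      then have "f \<theta>0 x y = 0" if "x \<in> space \<mu>" for x
        using f_nonneg[OF in_Theta[OF \<theta>0] that, of y] that by force
      then have "marg \<theta>0 y = 0"
        unfolding marg_density_def by (subst Bochner_Integration.integral_cong[of \<mu> \<mu> _ "\<lambda>_. 0"]) auto
      then show False using marg_pos[OF in_Theta[OF \<theta>0], of y] by simp
    qed
    then obtain x where x: "x \<in> space \<mu>" "f \<theta>0 x y > 0" by blast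
    define U where "U = interior \<Theta> \<inter> (\<lambda>\<theta>. f \<theta> x y) -` {0<..}"
    have f2: "second_partials_exist_on (\<lambda>\<theta>. f \<theta> x y) (interior \<Theta>)"
      and fc: "continuous_on (interior \<Theta>) (\<lambda>\<theta>. f \<theta> x y)"
      using A1_smooth[OF x(1), of y] continuous_hess_imp_continuous(3)[OF open_interior] by auto
    have U: "open U" "\<theta>0 \<in> U" "U \<subseteq> interior \<Theta>"
      using continuous_open_preimage[OF fc open_interior, of "{0<..}"] x(2) \<theta>0 by (auto simp: U_def)
    have mono: "second_partials_exist_on v U" if "second_partials_exist_on v (interior \<Theta>)" for v :: "real ^ 'd \<Rightarrow> real"
      using that U(3) by (auto simp: second_partials_exist_on_def)
    have mpos: "marg \<theta> y > 0" and fpos: "f \<theta> x y > 0" if "\<theta> \<in> U" for \<theta>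
      using that marg_pos[OF in_Theta] U(3) by (auto simp: U_def)
    have "second_partials_exist_on (\<lambda>\<theta>. ln (f \<theta> x y) - ln (cond \<theta> x y)) U"
      by (intro diff_partials(1) ln_partials(1) U mono f2 cond_partials x)
        (use mpos fpos in \<open>auto simp: cond_density_def\<close>)
    moreover have "ln (f \<theta> x y) - ln (cond \<theta> x y) = ln (marg \<theta> y)" if "\<theta> \<in> U" for \<theta>
      using mpos[OF that] fpos[OF that] by (simp add: cond_density_def ln_div)
    ultimately show ?thesis
      using U second_partials_cong_open(1)[OF U(1), of "\<lambda>\<theta>. ln (f \<theta> x y) - ln (cond \<theta> x y)" "\<lambda>\<theta>. ln (marg \<theta> y)"]
      by blast
  qed
  then show ?thesis unfolding second_partials_exist_on_def by blast
qed

lemma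
  assumes x: "\<And>i. x i \<in> space \<mu>"
  shows ratio_partials: "second_partials_exist_on (\<lambda>\<theta>. ratio x m \<theta> y) (interior \<Theta>)"
    and ratio_grad: "\<theta> \<in> interior \<Theta> \<Longrightarrow> partial_deriv j (\<lambda>\<theta>. ratio x m \<theta> y) \<theta> =
          empirical x m (\<lambda>z. partial_deriv j (\<lambda>\<theta>. cond \<theta> z y) \<theta> / h z)"
    and ratio_hess: "\<theta> \<in> interior \<Theta> \<Longrightarrow> partial_deriv i (partial_deriv j (\<lambda>\<theta>. ratio x m \<theta> y)) \<theta> =
          empirical x m (\<lambda>z. partial_deriv i (partial_deriv j (\<lambda>\<theta>. cond \<theta> z y)) \<theta> / h z)"
proof -
  have eq: "ratio x m \<theta> y = (\<Sum>k<m. (1 / (real m * h (x k))) * cond \<theta> (x k) y)" for \<theta>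
    by (simp add: ratio_def empirical_def sum_divide_distrib mult.commute)
  have eq': "empirical x m (\<lambda>z. D z / h z) = (\<Sum>k<m. (1 / (real m * h (x k))) * D (x k))" for D
    by (simp add: empirical_def sum_divide_distrib mult.commute)
  note L = lincomb_partials[where A = "{..<m}" and u = "\<lambda>k \<theta>. cond \<theta> (x k) y"
      and c = "\<lambda>k. 1 / (real m * h (x k))", OF open_interior cond_partials[OF x] finite_lessThan]
  show "second_partials_exist_on (\<lambda>\<theta>. ratio x m \<theta> y) (interior \<Theta>)" unfolding eq by (rule L(1))
  show "\<theta> \<in> interior \<Theta> \<Longrightarrow> partial_deriv j (\<lambda>\<theta>. ratio x m \<theta> y) \<theta> =
          empirical x m (\<lambda>z. partial_deriv j (\<lambda>\<theta>. cond \<theta> z y) \<theta> / h z)"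
    unfolding eq eq' by (rule L(2))
  show "\<theta> \<in> interior \<Theta> \<Longrightarrow> partial_deriv i (partial_deriv j (\<lambda>\<theta>. ratio x m \<theta> y)) \<theta> =
          empirical x m (\<lambda>z. partial_deriv i (partial_deriv j (\<lambda>\<theta>. cond \<theta> z y)) \<theta> / h z)"
    unfolding eq eq' by (rule L(3))
qed

lemma mc_density_eq:
  assumes "\<theta> \<in> \<Theta>"
  shows "mc_density f h x m \<theta> y = marg \<theta> y * ratio x m \<theta> y"
  using marg_pos[OF assms, of y]
  by (simp add: mc_density_def ratio_def empirical_def cond_density_def sum_distrib_left)

lemma ratio_whp:
  assumes "\<eta> > 0" "\<epsilon> > 0"
  shows "whp (iid_space P) \<epsilon> (\<lambda>m x. \<forall>y. \<bar>ratio x m \<theta>s y - 1\<bar> \<le> \<eta>)"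
  by (rule whp_mono[OF glivenko_cantelli_whp[OF prob_space_P A5 assms]])
    (auto simp: ratio_def mean_ratio[OF A3_interior])

lemma ratio_hess_whp:
  assumes "\<eta> > 0" "\<epsilon> > 0"
  shows "whp (iid_space P) \<epsilon> (\<lambda>m x. \<forall>i j y. \<forall>\<theta>\<in>ball \<theta>s \<rho>.
           \<bar>partial_deriv i (partial_deriv j (\<lambda>\<theta>. ratio x m \<theta> y)) \<theta>\<bar> \<le> \<eta>)"
proof -
  note PS = prob_space_iid_space[OF prob_space_P]
  have "whp (iid_space P) \<epsilon> (\<lambda>m x. \<forall>y. \<forall>\<theta>\<in>ball \<theta>s \<rho>.
           \<bar>partial_deriv i (partial_deriv j (\<lambda>\<theta>. ratio x m \<theta> y)) \<theta>\<bar> \<le> \<eta>)" if "\<epsilon> > 0" for i j \<epsilon>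
  proof -
    let ?F = "(\<lambda>\<phi> x. \<phi> x $ i $ j) ` {(\<lambda>x. hess (\<lambda>\<theta>. cond \<theta> x y) \<theta>' /\<^sub>R h x) | y \<theta>'. \<theta>' \<in> cball \<theta>s \<rho>}"
    have gc: "glivenko_cantelli P ?F" using A7 by (simp add: glivenko_cantelli_mat_def)
    show ?thesis
    proof (rule whp_mono[OF glivenko_cantelli_whp[OF prob_space_P gc \<open>\<eta> > 0\<close> that]], intro allI ballI)
      fix m x y \<theta>
      assume x: "x \<in> space (iid_space P)" and \<theta>: "\<theta> \<in> ball \<theta>s \<rho>"
        and le: "\<forall>\<phi>\<in>?F. \<bar>empirical x m \<phi> - (\<integral>z. \<phi> z \<partial>P)\<bar> \<le> \<eta>"
      have \<theta>': "\<theta> \<in> interior \<Theta>" "\<theta> \<in> cball \<theta>s \<rho>" using \<theta> ball_in_interior by auto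
      let ?\<phi> = "\<lambda>z. partial_deriv i (partial_deriv j (\<lambda>\<theta>. cond \<theta> z y)) \<theta> / h z"
      have "?\<phi> = (\<lambda>z. (hess (\<lambda>\<theta>. cond \<theta> z y) \<theta> /\<^sub>R h z) $ i $ j)"
        by (simp add: hess_def divide_inverse mult.commute)
      moreover have "(\<lambda>z. hess (\<lambda>\<theta>. cond \<theta> z y) \<theta> /\<^sub>R h z) \<in>
          {(\<lambda>x. hess (\<lambda>\<theta>. cond \<theta> x y) \<theta>' /\<^sub>R h x) | y \<theta>'. \<theta>' \<in> cball \<theta>s \<rho>}"
        using \<theta>'(2) by (intro CollectI exI[of _ y] exI[of _ \<theta>]) simp
      ultimately have "?\<phi> \<in> ?F" by (rule image_eqI)
      from bspec[OF le this] have "\<bar>empirical x m ?\<phi> - (\<integral>z. ?\<phi> z \<partial>P)\<bar> \<le> \<eta>" .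
      then show "\<bar>partial_deriv i (partial_deriv j (\<lambda>\<theta>. ratio x m \<theta> y)) \<theta>\<bar> \<le> \<eta>"
        using ratio_hess[OF iid_path_in_space[OF x] \<theta>'(1)] mean_ratio_hess[OF \<theta>'(1)] by simp
    qed simp
  qed
  then have "whp (iid_space P) \<epsilon> (\<lambda>m x. \<forall>j y. \<forall>\<theta>\<in>ball \<theta>s \<rho>.
           \<bar>partial_deriv i (partial_deriv j (\<lambda>\<theta>. ratio x m \<theta> y)) \<theta>\<bar> \<le> \<eta>)" if "\<epsilon> > 0" for i \<epsilon>
    by (rule whp_finite_all_UNIV[OF PS that])
  then show ?thesis by (rule whp_finite_all_UNIV[OF PS assms(2)])
qed

subsection \<open>Continuity of the Hessian of the log marginal density\<close>

text \<open>Fix one sample for which the ratio \<open>a\<close> is at least 1/2 at \<open>\<theta>\<^sup>*\<close> and has a Hessian bounded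
  by \<open>\<eta>\<close> on the whole ball; such a sample exists because these properties have positive
  probability. The Monte Carlo density \<open>F\<close> for this sample is a finite combination of the
  functions \<open>f \<theta> (x k) y\<close>, hence twice continuously differentiable, and \<open>ln marg = ln F - ln a\<close>.
  The only term of the Hessian of the right-hand side that could jump at \<open>\<theta>\<^sup>*\<close> is the Hessian of
  \<open>a\<close> divided by \<open>a\<close>, which is at most of order \<open>\<eta>\<close>.\<close>

lemma log_marg_hess_isCont: "isCont (\<lambda>\<theta>. log_marg_hess i j \<theta> y) \<theta>s"
  unfolding continuous_at_eps_delta
proof (intro allI impI)
  fix e :: real assume "e > 0"
  \<comment> \<open>Near \<open>\<theta>\<^sup>*\<close> the ratio exceeds 1/4, so that the term that may jump is at most \<open>4 \<eta> = e / 8\<close>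
    at each of two points; \<open>e / 4\<close> is left for the continuous part.\<close>
  define \<eta> where "\<eta> = e / 32"
  have \<eta>: "\<eta> > 0" using \<open>e > 0\<close> by (simp add: \<eta>_def)
  note PS = prob_space_iid_space[OF prob_space_P]
  have "whp (iid_space P) (1/4 + 1/4) (\<lambda>m x. (\<forall>y. \<bar>ratio x m \<theta>s y - 1\<bar> \<le> 1/2) \<and>
      (\<forall>i j y. \<forall>\<theta>\<in>ball \<theta>s \<rho>. \<bar>partial_deriv i (partial_deriv j (\<lambda>\<theta>. ratio x m \<theta> y)) \<theta>\<bar> \<le> \<eta>))"
    by (intro whp_conj PS ratio_whp ratio_hess_whp \<eta>) auto
  moreover have "1/4 + 1/4 < (1::real)" by simp
  ultimately obtain x m where x: "x \<in> space (iid_space P)"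
    and r12: "(\<forall>y. \<bar>ratio x m \<theta>s y - 1\<bar> \<le> 1/2) \<and>
      (\<forall>i j y. \<forall>\<theta>\<in>ball \<theta>s \<rho>. \<bar>partial_deriv i (partial_deriv j (\<lambda>\<theta>. ratio x m \<theta> y)) \<theta>\<bar> \<le> \<eta>)"
    using whp_imp_exists[OF PS] by blast
  have r1: "\<bar>ratio x m \<theta>s y - 1\<bar> \<le> 1/2" using r12 by blast
  have r2: "\<bar>partial_deriv i (partial_deriv j (\<lambda>\<theta>. ratio x m \<theta> y)) \<theta>\<bar> \<le> \<eta>" if "\<theta> \<in> ball \<theta>s \<rho>" for i j \<theta>
    using r12 that by blast
  note x\<mu> = iid_path_in_space[OF x]
  define a where "a \<theta> = ratio x m \<theta> y" for \<theta>
  define F where "F \<theta> = (\<Sum>k<m. (1 / (real m * h (x k))) * f \<theta> (x k) y)" for \<theta>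
  have a_ex0: "second_partials_exist_on a (interior \<Theta>)" unfolding a_def by (rule ratio_partials[OF x\<mu>])
  have a_ex: "second_partials_exist_on a (ball \<theta>s \<rho>)"
    using a_ex0 ball_in_interior by (auto simp: second_partials_exist_on_def)
  have a_hess: "\<bar>partial_deriv i (partial_deriv j a) \<theta>\<bar> \<le> \<eta>" if "\<theta> \<in> ball \<theta>s \<rho>" for i j \<theta>
    using r2[OF that] by (simp add: a_def[abs_def])
  \<comment> \<open>Bounded second derivatives make the first derivatives continuous.\<close>
  have a1_cont: "continuous_on (ball \<theta>s \<rho>) (partial_deriv j a)" for j
    by (rule bounded_partials_imp_continuous_on[OF open_ball _ a_hess])
      (use a_ex in \<open>auto simp: second_partials_exist_on_def\<close>)
  have a_cont: "continuous_on (ball \<theta>s \<rho>) a"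
    by (rule continuous_partials_imp_continuous_on[OF open_ball _ a1_cont])
      (use a_ex in \<open>auto simp: second_partials_exist_on_def\<close>)
  have f_ex: "second_partials_exist_on (\<lambda>\<theta>. f \<theta> (x k) y) (interior \<Theta>)"
    and f_cont: "continuous_on (interior \<Theta>) (hess (\<lambda>\<theta>. f \<theta> (x k) y))" for k
    using A1_smooth[OF x\<mu>] by auto
  note FL = lincomb_partials[where A = "{..<m}" and u = "\<lambda>k \<theta>. f \<theta> (x k) y"
      and c = "\<lambda>k. 1 / (real m * h (x k))", OF open_interior f_ex finite_lessThan, folded F_def]
  have F_ex: "second_partials_exist_on F (interior \<Theta>)" using FL(1) by (simp add: F_def[abs_def])
  have F_hess: "partial_deriv i (partial_deriv j F) \<theta> =
      (\<Sum>k<m. (1 / (real m * h (x k))) * partial_deriv i (partial_deriv j (\<lambda>\<theta>. f \<theta> (x k) y)) \<theta>)"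
    if "\<theta> \<in> interior \<Theta>" for i j \<theta>
    using FL(3)[OF that] by (simp add: F_def[abs_def])
  have "continuous_on (interior \<Theta>) (\<lambda>\<theta>. \<Sum>k<m. (1 / (real m * h (x k))) * partial_deriv i (partial_deriv j (\<lambda>\<theta>. f \<theta> (x k) y)) \<theta>)" for i j
    by (intro continuous_on_sum continuous_on_mult continuous_on_const
        continuous_hess_imp_continuous(1)[OF open_interior f_ex f_cont])
  then have F2_cont: "continuous_on (interior \<Theta>) (partial_deriv i (partial_deriv j F))" for i j
    by (rule continuous_on_eq) (simp add: F_hess)
  have F_cont_hess: "continuous_on (interior \<Theta>) (hess F)"
    unfolding hess_def by (intro continuous_on_vec_lambda F2_cont)
  note F_cont = continuous_hess_imp_continuous[OF open_interior F_ex F_cont_hess]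
  define U where "U = ball \<theta>s \<rho> \<inter> a -` {1/4<..}"
  have U: "open U" "\<theta>s \<in> U" "U \<subseteq> ball \<theta>s \<rho>"
  proof -
    have "a \<theta>s > 1/4" using r1 unfolding a_def by linarith
    then show "open U" "\<theta>s \<in> U" "U \<subseteq> ball \<theta>s \<rho>"
      using continuous_open_preimage[OF a_cont open_ball, of "{1/4<..}"] A4(1) by (auto simp: U_def)
  qed
  have Ui: "U \<subseteq> interior \<Theta>" using U(3) ball_in_interior by blast
  have mono: "second_partials_exist_on v U" if "second_partials_exist_on v (interior \<Theta>)" for v :: "real ^ 'd \<Rightarrow> real"
    using that Ui by (auto simp: second_partials_exist_on_def)
  have a_pos: "a \<theta> > 1/4" and m_pos: "marg \<theta> y > 0" if "\<theta> \<in> U" for \<theta>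
    using that marg_pos[OF in_Theta] Ui by (auto simp: U_def)
  have F_eq: "F \<theta> = marg \<theta> y * a \<theta>" if "\<theta> \<in> U" for \<theta>
    using mc_density_eq[of \<theta> x m y] that Ui in_Theta
    by (simp add: F_def a_def mc_density_def empirical_def sum_divide_distrib mult.commute subset_eq)
  have F_pos: "F \<theta> > 0" and a_pos0: "a \<theta> > 0" if "\<theta> \<in> U" for \<theta>
    using F_eq[OF that] a_pos[OF that] m_pos[OF that] by auto
  have ln_eq: "ln (marg \<theta> y) = ln (F \<theta>) - ln (a \<theta>)" if "\<theta> \<in> U" for \<theta>
    using F_eq[OF that] a_pos0[OF that] m_pos[OF that] by (simp add: ln_mult)
  \<comment> \<open>The continuous part of the Hessian.\<close>
  define G where "G \<theta> = partial_deriv i (partial_deriv j F) \<theta> / F \<theta>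
      - partial_deriv i F \<theta> * partial_deriv j F \<theta> / (F \<theta>)\<^sup>2
      + partial_deriv i a \<theta> * partial_deriv j a \<theta> / (a \<theta>)\<^sup>2" for \<theta>
  have hess_eq: "log_marg_hess i j \<theta> y = G \<theta> - partial_deriv i (partial_deriv j a) \<theta> / a \<theta>" if "\<theta> \<in> U" for \<theta>
  proof -
    have "log_marg_hess i j \<theta> y = partial_deriv i (partial_deriv j (\<lambda>\<theta>. ln (F \<theta>) - ln (a \<theta>))) \<theta>"
      by (rule second_partials_cong_open(2)[OF U(1) ln_eq that])
    also have "\<dots> = partial_deriv i (partial_deriv j (\<lambda>\<theta>. ln (F \<theta>))) \<theta> - partial_deriv i (partial_deriv j (\<lambda>\<theta>. ln (a \<theta>))) \<theta>"
      by (rule diff_partials(3)[OF U(1) ln_partials(1)[OF U(1) mono[OF F_ex] F_pos]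
            ln_partials(1)[OF U(1) mono[OF a_ex0] a_pos0] that])
    finally show ?thesis
      using ln_partials(3)[OF U(1) mono[OF F_ex] F_pos that, of i j]
        ln_partials(3)[OF U(1) mono[OF a_ex0] a_pos0 that, of i j]
      by (simp add: G_def)
  qed
  have "continuous_on U G"
    unfolding G_def using F_pos a_pos0
    by (intro continuous_intros continuous_on_subset[OF F_cont(1) Ui] continuous_on_subset[OF F_cont(2) Ui]
        continuous_on_subset[OF F_cont(3) Ui] continuous_on_subset[OF a_cont U(3)]
        continuous_on_subset[OF a1_cont U(3)]) (auto simp: less_imp_neq[symmetric])
  then have "isCont G \<theta>s" using U continuous_on_eq_continuous_at by blast
  then obtain d where d: "d > 0" "\<And>\<theta>. dist \<theta> \<theta>s < d \<Longrightarrow> dist (G \<theta>) (G \<theta>s) < e/4"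
    unfolding continuous_at_eps_delta using \<open>e > 0\<close> by (metis zero_less_divide_iff zero_less_numeral)
  obtain r where r: "r > 0" "ball \<theta>s r \<subseteq> U" using U open_contains_ball by blast
  have small: "\<bar>partial_deriv i (partial_deriv j a) \<theta> / a \<theta>\<bar> \<le> e/8" if "\<theta> \<in> U" for \<theta>
  proof -
    have "\<bar>partial_deriv i (partial_deriv j a) \<theta>\<bar> / a \<theta> \<le> \<eta> / (1/4)"
      using a_hess[of \<theta> i j] that U(3) a_pos[OF that] \<eta> by (intro frac_le) auto
    then show ?thesis using a_pos0[OF that] by (simp add: abs_divide \<eta>_def)
  qed
  show "\<exists>d>0. \<forall>\<theta>. dist \<theta> \<theta>s < d \<longrightarrow> dist (log_marg_hess i j \<theta> y) (log_marg_hess i j \<theta>s y) < e"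
  proof (intro exI[of _ "min d r"] conjI allI impI)
    show "min d r > 0" using d r by simp
    fix \<theta> assume \<theta>: "dist \<theta> \<theta>s < min d r"
    then have "\<theta> \<in> U" using r(2) by (auto simp: dist_commute)
    then show "dist (log_marg_hess i j \<theta> y) (log_marg_hess i j \<theta>s y) < e"
      using d(2)[of \<theta>] small[of \<theta>] small[OF U(2)] \<theta> \<open>e > 0\<close>
      unfolding hess_eq[OF \<open>\<theta> \<in> U\<close>] hess_eq[OF U(2)] dist_real_def by linarith
  qed
qed

lemma log_marg_hess_commute: "log_marg_hess i j \<theta>s y = log_marg_hess j i \<theta>s y"
  by (rule mixed_partials_commute[OF open_interior A3_interior log_marg_second_partials log_marg_hess_isCont])

lemma gc_log_marg_hess:
  "glivenko_cantelli Q {log_marg_hess i j \<theta> | \<theta>. \<theta> \<in> cball \<theta>s \<rho>}"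
proof -
  have "(\<lambda>\<phi> y. \<phi> y $ i $ j) ` {(\<lambda>y. hess (\<lambda>\<theta>. ln (marg \<theta> y)) \<theta>') | \<theta>'. \<theta>' \<in> cball \<theta>s \<rho>} =
      {log_marg_hess i j \<theta> | \<theta>. \<theta> \<in> cball \<theta>s \<rho>}"
    by (simp only: Setcompr_eq_image image_image hess_def vec_lambda_beta)
  with A4(3)[unfolded glivenko_cantelli_mat_def, rule_format, of i j] show ?thesis by simp
qed

text \<open>Along a single path on which the uniform law of large numbers holds, the mean Hessian is a
  uniform limit of averages of finitely many functions that are continuous at \<open>\<theta>\<^sup>*\<close>. This takes
  the place of dominated convergence.\<close>

lemma mean_log_marg_hess_cont:
  assumes "e > 0"
  shows "\<exists>r>0. \<forall>\<theta>\<in>ball \<theta>s r. \<bar>(\<integral>y. log_marg_hess i j \<theta> y \<partial>Q) - (\<integral>y. log_marg_hess i j \<theta>s y \<partial>Q)\<bar> \<le> e"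
proof -
  obtain y where "\<forall>\<eta>>0. \<forall>\<^sub>F n in sequentially. \<forall>\<phi>\<in>{log_marg_hess i j \<theta> | \<theta>. \<theta> \<in> cball \<theta>s \<rho>}.
       \<bar>empirical y n \<phi> - (\<integral>z. \<phi> z \<partial>Q)\<bar> \<le> \<eta>"
    using glivenko_cantelli_path[OF prob_space_Q gc_log_marg_hess] by blast
  moreover have "0 < e/3" using assms by simp
  ultimately have "\<forall>\<^sub>F n in sequentially. \<forall>\<phi>\<in>{log_marg_hess i j \<theta> | \<theta>. \<theta> \<in> cball \<theta>s \<rho>}.
       \<bar>empirical y n \<phi> - (\<integral>z. \<phi> z \<partial>Q)\<bar> \<le> e/3" by blast
  from eventually_happens'[OF sequentially_bot this] obtain n where
    n: "\<And>\<theta>. \<theta> \<in> cball \<theta>s \<rho> \<Longrightarrow> \<bar>empirical y n (log_marg_hess i j \<theta>) - (\<integral>z. log_marg_hess i j \<theta> z \<partial>Q)\<bar> \<le> e/3"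
    by blast
  have "isCont (\<lambda>\<theta>. empirical y n (log_marg_hess i j \<theta>)) \<theta>s"
    unfolding empirical_def divide_inverse
    by (intro isCont_mult continuous_const) (rule continuous_sum, rule log_marg_hess_isCont)
  from this[unfolded continuous_at_eps_delta dist_real_def, rule_format, of "e/3"] assms
  obtain d where d: "d > 0"
    "\<And>\<theta>. dist \<theta> \<theta>s < d \<Longrightarrow> \<bar>empirical y n (log_marg_hess i j \<theta>) - empirical y n (log_marg_hess i j \<theta>s)\<bar> < e/3"
    by auto
  have "\<bar>(\<integral>y. log_marg_hess i j \<theta> y \<partial>Q) - (\<integral>y. log_marg_hess i j \<theta>s y \<partial>Q)\<bar> \<le> e"
    if "\<theta> \<in> ball \<theta>s (min d \<rho>)" for \<theta>
  proof -
    have "dist \<theta> \<theta>s < d" "\<theta> \<in> cball \<theta>s \<rho>" "\<theta>s \<in> cball \<theta>s \<rho>"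
      using that A4(1) by (simp_all add: dist_commute)
    from n[OF this(2)] n[OF this(3)] d(2)[OF this(1)] show ?thesis by linarith
  qed
  then show ?thesis using d(1) A4(1) by (intro exI[of _ "min d \<rho>"]) auto
qed

lemma mean_log_marg_hess_cont_uniform:
  assumes "\<eta> > 0"
  shows "\<exists>r>0. r \<le> \<rho> \<and> (\<forall>i j. \<forall>\<xi>\<in>ball \<theta>s r.
     \<bar>(\<integral>y. log_marg_hess i j \<xi> y \<partial>Q) - (\<integral>y. log_marg_hess i j \<theta>s y \<partial>Q)\<bar> \<le> \<eta>)"
proof -
  have "\<forall>i j. \<exists>r>0. \<forall>\<xi>\<in>ball \<theta>s r.
     \<bar>(\<integral>y. log_marg_hess i j \<xi> y \<partial>Q) - (\<integral>y. log_marg_hess i j \<theta>s y \<partial>Q)\<bar> \<le> \<eta>"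
    using mean_log_marg_hess_cont[OF assms] by blast
  then obtain R where R: "\<And>i j. R i j > 0" "\<And>i j \<xi>. \<xi> \<in> ball \<theta>s (R i j) \<Longrightarrow>
     \<bar>(\<integral>y. log_marg_hess i j \<xi> y \<partial>Q) - (\<integral>y. log_marg_hess i j \<theta>s y \<partial>Q)\<bar> \<le> \<eta>" by metis
  define r where "r = min \<rho> (Min (range (\<lambda>(i, j). R i j)))"
  have "r > 0" using R(1) A4(1) by (auto simp: r_def)
  moreover have "r \<le> R i j" for i j
  proof -
    have "Min (range (\<lambda>(i, j). R i j)) \<le> R i j" by (rule Min_le) auto
    then show ?thesis by (simp add: r_def)
  qed
  then have "\<xi> \<in> ball \<theta>s (R i j)" if "\<xi> \<in> ball \<theta>s r" for \<xi> i j
    using that by (auto intro: less_le_trans)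
  moreover have "r \<le> \<rho>" by (simp add: r_def)
  ultimately show ?thesis using R(2) by blast
qed

subsection \<open>Derivatives of the Kullback--Leibler criterion\<close>

text \<open>The factorisation of the Monte Carlo density makes the criterion, up to a constant, the
  sum of the negative log likelihood and of the average of \<open>- ln ratio\<close>. The densities \<open>g (y k)\<close>
  must be positive because \<open>ln (g / f)\<close> would otherwise not depend on \<open>f\<close>.\<close>

lemma mc_KL_partials:
  assumes x: "\<And>i. x i \<in> space \<mu>" and U: "open U" "U \<subseteq> interior \<Theta>"
    and pos: "\<And>\<theta> k. \<theta> \<in> U \<Longrightarrow> k < n \<Longrightarrow> 0 < ratio x m \<theta> (y k)"
    and g: "\<And>k. k < n \<Longrightarrow> 0 < g (y k)"
  shows "second_partials_exist_on (mc_KL f h g x y m n) U"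
    and "\<theta> \<in> U \<Longrightarrow> partial_deriv j (mc_KL f h g x y m n) \<theta> =
      - empirical y n (\<lambda>y. partial_deriv j (\<lambda>\<theta>. ln (marg \<theta> y)) \<theta>)
      - empirical y n (\<lambda>y. partial_deriv j (\<lambda>\<theta>. ratio x m \<theta> y) \<theta> / ratio x m \<theta> y)"
    and "\<theta> \<in> U \<Longrightarrow> partial_deriv i (partial_deriv j (mc_KL f h g x y m n)) \<theta> =
      - empirical y n (\<lambda>y. log_marg_hess i j \<theta> y)
      - empirical y n (\<lambda>y. partial_deriv i (partial_deriv j (\<lambda>\<theta>. ratio x m \<theta> y)) \<theta> / ratio x m \<theta> y
          - partial_deriv i (\<lambda>\<theta>. ratio x m \<theta> y) \<theta> * partial_deriv j (\<lambda>\<theta>. ratio x m \<theta> y) \<theta> / (ratio x m \<theta> y)\<^sup>2)"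
proof -
  define c where "c = (\<Sum>k<n. ln (g (y k))) / real n"
  define L1 where "L1 \<theta> = (\<Sum>k<n. (1 / real n) * ln (marg \<theta> (y k)))" for \<theta>
  define L2 where "L2 \<theta> = (\<Sum>k<n. (1 / real n) * ln (ratio x m \<theta> (y k)))" for \<theta>
  have mono: "second_partials_exist_on v U" if "second_partials_exist_on v (interior \<Theta>)" for v :: "real ^ 'd \<Rightarrow> real"
    using that U(2) by (auto simp: second_partials_exist_on_def)
  note lm = log_marg_second_partials[THEN mono]
  have lr1: "second_partials_exist_on (\<lambda>\<theta>. ln (ratio x m \<theta> (y k))) U" if "k \<in> {..<n}" for k
    by (rule ln_partials(1)[OF U(1) mono[OF ratio_partials[OF x]] pos]) (use that in auto)
  have lr2: "partial_deriv j (\<lambda>\<theta>. ln (ratio x m \<theta> (y k))) \<theta> = partial_deriv j (\<lambda>\<theta>. ratio x m \<theta> (y k)) \<theta> / ratio x m \<theta> (y k)"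
    if "k \<in> {..<n}" "\<theta> \<in> U" for k \<theta> j
    by (rule ln_partials(2)[OF U(1) mono[OF ratio_partials[OF x]] pos]) (use that in auto)
  have lr3: "partial_deriv i (partial_deriv j (\<lambda>\<theta>. ln (ratio x m \<theta> (y k)))) \<theta> =
      partial_deriv i (partial_deriv j (\<lambda>\<theta>. ratio x m \<theta> (y k))) \<theta> / ratio x m \<theta> (y k)
          - partial_deriv i (\<lambda>\<theta>. ratio x m \<theta> (y k)) \<theta> * partial_deriv j (\<lambda>\<theta>. ratio x m \<theta> (y k)) \<theta> / (ratio x m \<theta> (y k))\<^sup>2"
    if "k \<in> {..<n}" "\<theta> \<in> U" for k \<theta> i j
    by (rule ln_partials(3)[OF U(1) mono[OF ratio_partials[OF x]] pos]) (use that in auto)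
  note P1 = lincomb_partials[where A = "{..<n}" and u = "\<lambda>k \<theta>. ln (marg \<theta> (y k))" and c = "\<lambda>_. 1 / real n",
      OF U(1) lm finite_lessThan, folded L1_def[abs_def]]
  have P2: "second_partials_exist_on L2 U"
    "\<And>\<theta> j. \<theta> \<in> U \<Longrightarrow> partial_deriv j L2 \<theta> =
      (\<Sum>k<n. (1 / real n) * partial_deriv j (\<lambda>\<theta>. ln (ratio x m \<theta> (y k))) \<theta>)"
    "\<And>\<theta> i j. \<theta> \<in> U \<Longrightarrow> partial_deriv i (partial_deriv j L2) \<theta> =
      (\<Sum>k<n. (1 / real n) * partial_deriv i (partial_deriv j (\<lambda>\<theta>. ln (ratio x m \<theta> (y k)))) \<theta>)"
    unfolding L2_def[abs_def]
    by (rule lincomb_partials[OF U(1) _ finite_lessThan]; (rule lr1)?; assumption)+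
  have C: "second_partials_exist_on (\<lambda>_. c) U"
    by (simp add: second_partials_exist_on_def has_partial_deriv_def partial_deriv_def[abs_def])
  note D1 = diff_partials[OF U(1) C P1(1)]
  note D2 = diff_partials[OF U(1) D1(1) P2(1)]
  have K: "mc_KL f h g x y m n \<theta> = c - L1 \<theta> - L2 \<theta>" if \<theta>: "\<theta> \<in> U" for \<theta>
  proof -
    have "ln (g (y k) / mc_density f h x m \<theta> (y k)) = ln (g (y k)) - ln (marg \<theta> (y k)) - ln (ratio x m \<theta> (y k))"
      if "k < n" for k
      using pos[OF \<theta> that] g[OF that] marg_pos[of \<theta> "y k"] in_Theta \<theta> U(2)
      by (subst mc_density_eq) (auto simp: ln_div ln_mult)
    then show ?thesis
      by (simp add: mc_KL_def empirical_def c_def L1_def L2_def sum_subtractf diff_divide_distrib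
          sum_divide_distrib)
  qed
  show "second_partials_exist_on (mc_KL f h g x y m n) U"
    using second_partials_cong_open(1)[OF U(1) K] D2(1) by simp
  have emp: "(\<Sum>k<n. (1 / real n) * \<phi> (y k)) = empirical y n \<phi>" for \<phi>
    by (simp add: empirical_def sum_divide_distrib)
  have c2: "partial_deriv i (partial_deriv j (\<lambda>_::real^'d. c)) \<theta> = 0" for i j \<theta>
    by (simp add: partial_deriv_def[abs_def])
  show "partial_deriv j (mc_KL f h g x y m n) \<theta> =
      - empirical y n (\<lambda>y. partial_deriv j (\<lambda>\<theta>. ln (marg \<theta> y)) \<theta>)
      - empirical y n (\<lambda>y. partial_deriv j (\<lambda>\<theta>. ratio x m \<theta> y) \<theta> / ratio x m \<theta> y)" if "\<theta> \<in> U"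
  proof -
    have "partial_deriv j (mc_KL f h g x y m n) \<theta> = partial_deriv j (\<lambda>\<theta>. c - L1 \<theta> - L2 \<theta>) \<theta>"
      by (rule partial_deriv_cong_open(1)[OF U(1) that K])
    also have "\<dots> = partial_deriv j (\<lambda>_. c) \<theta> - partial_deriv j L1 \<theta> - partial_deriv j L2 \<theta>"
      unfolding D2(2)[OF that] D1(2)[OF that] ..
    also have "partial_deriv j L1 \<theta> = empirical y n (\<lambda>y. partial_deriv j (\<lambda>\<theta>. ln (marg \<theta> y)) \<theta>)"
      unfolding P1(2)[OF that] by (rule emp)
    also have "partial_deriv j L2 \<theta> = empirical y n (\<lambda>y. partial_deriv j (\<lambda>\<theta>. ratio x m \<theta> y) \<theta> / ratio x m \<theta> y)"
      unfolding P2(2)[OF that] emp[symmetric] by (rule sum.cong[OF refl]) (simp only: lr2[OF _ that])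
    finally show ?thesis by simp
  qed
  show "partial_deriv i (partial_deriv j (mc_KL f h g x y m n)) \<theta> =
      - empirical y n (\<lambda>y. log_marg_hess i j \<theta> y)
      - empirical y n (\<lambda>y. partial_deriv i (partial_deriv j (\<lambda>\<theta>. ratio x m \<theta> y)) \<theta> / ratio x m \<theta> y
          - partial_deriv i (\<lambda>\<theta>. ratio x m \<theta> y) \<theta> * partial_deriv j (\<lambda>\<theta>. ratio x m \<theta> y) \<theta> / (ratio x m \<theta> y)\<^sup>2)"
    if "\<theta> \<in> U"
  proof -
    have "partial_deriv i (partial_deriv j (mc_KL f h g x y m n)) \<theta> =
        partial_deriv i (partial_deriv j (\<lambda>\<theta>. c - L1 \<theta> - L2 \<theta>)) \<theta>"
      by (rule second_partials_cong_open(2)[OF U(1) K that])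
    also have "\<dots> = partial_deriv i (partial_deriv j (\<lambda>_. c)) \<theta> - partial_deriv i (partial_deriv j L1) \<theta>
        - partial_deriv i (partial_deriv j L2) \<theta>"
      unfolding D2(3)[OF that] D1(3)[OF that] ..
    also have "partial_deriv i (partial_deriv j L1) \<theta> = empirical y n (\<lambda>y. log_marg_hess i j \<theta> y)"
      unfolding P1(3)[OF that] by (rule emp)
    also have "partial_deriv i (partial_deriv j L2) \<theta> =
        empirical y n (\<lambda>y. partial_deriv i (partial_deriv j (\<lambda>\<theta>. ratio x m \<theta> y)) \<theta> / ratio x m \<theta> y
          - partial_deriv i (\<lambda>\<theta>. ratio x m \<theta> y) \<theta> * partial_deriv j (\<lambda>\<theta>. ratio x m \<theta> y) \<theta> / (ratio x m \<theta> y)\<^sup>2)"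
      unfolding P2(3)[OF that] emp[symmetric] by (rule sum.cong[OF refl]) (simp only: lr3[OF _ that])
    finally show ?thesis by (simp add: c2)
  qed
qed

text \<open>Integrating twice: a Hessian of size \<open>\<eta>\<close> on the ball together with value and gradient
  within \<open>\<eta>\<close> of 1 and 0 at the centre keep the gradient below \<open>\<eta> \<kappa>\<close> and the value within \<open>\<eta> \<kappa>\<^sup>2\<close>
  of 1 on the whole ball. The second claim bounds the Hessian of \<open>ln ratio\<close>, the error in the
  Hessian of the criterion.\<close>

lemma ratio_bounds:
  fixes x m
  defines "\<kappa> \<equiv> 1 + real CARD('d) * \<rho>"
  assumes x: "\<And>i. x i \<in> space \<mu>" and \<eta>: "0 \<le> \<eta>" "\<eta> * \<kappa>\<^sup>2 \<le> 1/2"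
    and r0: "\<And>y. \<bar>ratio x m \<theta>s y - 1\<bar> \<le> \<eta>"
    and r1: "\<And>i y. \<bar>partial_deriv i (\<lambda>\<theta>. ratio x m \<theta> y) \<theta>s\<bar> \<le> \<eta>"
    and r2: "\<And>i j y \<theta>. \<theta> \<in> ball \<theta>s \<rho> \<Longrightarrow> \<bar>partial_deriv i (partial_deriv j (\<lambda>\<theta>. ratio x m \<theta> y)) \<theta>\<bar> \<le> \<eta>"
    and \<theta>: "\<theta> \<in> ball \<theta>s \<rho>"
  shows "1/2 \<le> ratio x m \<theta> y"
    and "\<bar>partial_deriv i (partial_deriv j (\<lambda>\<theta>. ratio x m \<theta> y)) \<theta> / ratio x m \<theta> y
          - partial_deriv i (\<lambda>\<theta>. ratio x m \<theta> y) \<theta> * partial_deriv j (\<lambda>\<theta>. ratio x m \<theta> y) \<theta> / (ratio x m \<theta> y)\<^sup>2\<bar>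
      \<le> 4 * \<eta>"
proof -
  let ?D = "real CARD('d)"
  let ?r = "\<lambda>\<theta>. ratio x m \<theta> y"
  have ex: "second_partials_exist_on ?r (ball \<theta>s \<rho>)"
    using ratio_partials[OF x] ball_in_interior by (auto simp: second_partials_exist_on_def)
  have dist: "norm (\<theta> - \<theta>s) \<le> \<rho>" if "\<theta> \<in> ball \<theta>s \<rho>" for \<theta>
    using that by (simp add: dist_norm norm_minus_commute)
  have \<kappa>: "1 \<le> \<kappa>" using A4(1) by (simp add: \<kappa>_def)
  have b1: "\<bar>partial_deriv i ?r \<theta>\<bar> \<le> \<eta> * \<kappa>" if \<theta>: "\<theta> \<in> ball \<theta>s \<rho>" for i \<theta>
  proof -
    have "\<bar>partial_deriv i ?r \<theta> - partial_deriv i ?r \<theta>s\<bar> \<le> \<eta> * ?D * norm (\<theta> - \<theta>s)"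
      by (rule bounded_partials_imp_lipschitz_at[OF _ r2 \<theta>])
        (use ex in \<open>auto simp: second_partials_exist_on_def\<close>)
    also have "\<dots> \<le> \<eta> * ?D * \<rho>" using dist[OF \<theta>] \<eta>(1) by (intro mult_left_mono) auto
    finally show ?thesis using r1[of i y] by (simp add: \<kappa>_def algebra_simps)
  qed
  have "\<bar>?r \<theta> - ?r \<theta>s\<bar> \<le> (\<eta> * \<kappa>) * ?D * norm (\<theta> - \<theta>s)"
    by (rule bounded_partials_imp_lipschitz_at[OF _ b1 \<theta>])
      (use ex in \<open>auto simp: second_partials_exist_on_def\<close>)
  also have "\<dots> \<le> (\<eta> * \<kappa>) * ?D * \<rho>" using dist[OF \<theta>] \<eta>(1) \<kappa> by (intro mult_left_mono) auto
  finally have "\<bar>?r \<theta> - 1\<bar> \<le> \<eta> + \<eta> * \<kappa> * (\<kappa> - 1)" using r0[of y] by (simp add: \<kappa>_def)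
  also have "\<dots> \<le> \<eta> * \<kappa>\<^sup>2"
    using mult_left_mono[OF \<kappa> \<eta>(1)] by (simp add: algebra_simps power2_eq_square)
  finally have "\<bar>?r \<theta> - 1\<bar> \<le> 1/2" using \<eta>(2) by simp
  then show r: "1/2 \<le> ?r \<theta>" by linarith
  have "\<bar>partial_deriv i (partial_deriv j ?r) \<theta> / ?r \<theta>\<bar> \<le> \<eta> / (1/2)"
    using r2[OF \<theta>] r \<eta>(1) by (simp only: abs_divide) (intro frac_le; simp)
  moreover have "\<bar>partial_deriv i ?r \<theta> * partial_deriv j ?r \<theta> / (?r \<theta>)\<^sup>2\<bar> \<le> (\<eta> * \<kappa>) * (\<eta> * \<kappa>) / (1/2)\<^sup>2"
    unfolding abs_divide abs_mult
    using r \<eta>(1) \<kappa> power_mono[OF r, of 2] by (intro frac_le mult_mono b1 \<theta>) auto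
  moreover have "(\<eta> * \<kappa>) * (\<eta> * \<kappa>) / (1/2)\<^sup>2 \<le> 2 * \<eta>"
    using mult_left_mono[OF \<eta>(2) \<eta>(1)] by (simp add: power2_eq_square algebra_simps)
  ultimately have "\<bar>partial_deriv i (partial_deriv j ?r) \<theta> / ?r \<theta>\<bar> +
      \<bar>partial_deriv i ?r \<theta> * partial_deriv j ?r \<theta> / (?r \<theta>)\<^sup>2\<bar> \<le> 4 * \<eta>" by simp
  then show "\<bar>partial_deriv i (partial_deriv j ?r) \<theta> / ?r \<theta>
          - partial_deriv i ?r \<theta> * partial_deriv j ?r \<theta> / (?r \<theta>)\<^sup>2\<bar> \<le> 4 * \<eta>"
    using abs_triangle_ineq4 order_trans by blast
qed

subsection \<open>The mean score and the Donsker class\<close>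

text \<open>The members of the Donsker class, indexed by \<open>y\<close>; for fixed \<open>x\<close> these are also functions
  of \<open>y\<close>, and both points of view are needed.\<close>

definition grad_ratio_fun :: "'d \<Rightarrow> 'y \<Rightarrow> 'x \<Rightarrow> real" where
  "grad_ratio_fun i y x = partial_deriv i (\<lambda>\<theta>. cond \<theta> x y) \<theta>s / h x"

text \<open>The average over \<open>Q\<close> of the gradient of the ratio for a single draw \<open>x\<close>; its covariance
  matrix under \<open>P\<close> is \<open>W\<close>.\<close>

definition mean_score :: "'x \<Rightarrow> real ^ 'd" where
  "mean_score x = (\<integral>y. grad (\<lambda>\<theta>. cond \<theta> x y) \<theta>s /\<^sub>R h x \<partial>Q)"

lemma grad_ratio_class:
  "(\<lambda>\<phi> x. \<phi> x $ i) ` range (\<lambda>y x. grad (\<lambda>\<theta>. cond \<theta> x y) \<theta>s /\<^sub>R h x) = range (grad_ratio_fun i)"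
  by (simp add: image_image grad_def divide_inverse mult.commute grad_ratio_fun_def[abs_def])

lemma grad_ratio_mean: "(\<integral>x. grad_ratio_fun i y x \<partial>P) = 0"
  unfolding grad_ratio_fun_def by (rule mean_ratio_grad[OF A3_interior])

lemma grad_ratio_integrable: "integrable P (grad_ratio_fun i y)"
  using A6_donsker unfolding donsker_vec_def donsker_def grad_ratio_class by blast

lemma grad_ratio_continuous: "x \<in> space \<mu> \<Longrightarrow> continuous_on UNIV (\<lambda>y. grad_ratio_fun i y x)"
  using continuous_on_component[OF A2, of x i] unfolding grad_ratio_fun_def divide_inverse
  by (intro continuous_on_mult_right) (simp add: grad_def)

lemma grad_ratio_bound:
  assumes "x \<in> space \<mu>" shows "\<bar>grad_ratio_fun i y x\<bar> \<le> E x $ i"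
proof -
  have "\<bar>(grad (\<lambda>\<theta>. cond \<theta> x y) \<theta>s /\<^sub>R h x) $ i\<bar> \<le> E x $ i"
    using A6_envelope(1)[unfolded envelope_vec_def, rule_format, OF rangeI, of x] assms by simp
  then show ?thesis by (simp add: grad_def divide_inverse mult.commute grad_ratio_fun_def)
qed

lemma continuous_measurable_Q:
  fixes u :: "'y \<Rightarrow> real"
  assumes "continuous_on UNIV u" shows "u \<in> borel_measurable Q"
proof (rule measurableI)
  fix A :: "real set" assume "A \<in> sets borel"
  then have "u -` A \<in> sets borel"
    using measurable_sets[OF borel_measurable_continuous_onI[OF assms]] by simp
  then show "u -` A \<inter> space Q \<in> sets Q" using Y_space(2) by (auto simp: sets_Q)
qed simp

lemma continuous_bounded_integrable_Q:
  fixes u :: "'y \<Rightarrow> real"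
  assumes "continuous_on UNIV u" "\<And>y. \<bar>u y\<bar> \<le> C" shows "integrable Q u"
proof -
  interpret Q: prob_space Q by (rule prob_space_Q)
  show ?thesis
    by (rule Q.integrable_const_bound[of _ C]) (use assms continuous_measurable_Q in auto)
qed

lemma grad_ratio_integrable_Q: "x \<in> space \<mu> \<Longrightarrow> integrable Q (\<lambda>y. grad_ratio_fun i y x)"
  by (rule continuous_bounded_integrable_Q[OF grad_ratio_continuous grad_ratio_bound])

lemma grad_ratio_measurable_pair:
  "(\<lambda>(x, y). grad_ratio_fun i y x) \<in> borel_measurable (P \<Otimes>\<^sub>M Q)"
proof (rule caratheodory_measurable)
  show "(\<lambda>x. grad_ratio_fun i y x) \<in> borel_measurable P" for y
    using grad_ratio_integrable[of i y] by simp
qed (use grad_ratio_continuous Y_space in \<open>auto simp: sets_Q\<close>)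

lemma mean_score_nth:
  assumes x: "x \<in> space \<mu>"
  shows "mean_score x $ i = (\<integral>y. grad_ratio_fun i y x \<partial>Q)"
proof -
  have "integrable Q (\<lambda>y. \<Sum>i\<in>UNIV. grad_ratio_fun i y x *\<^sub>R (axis i 1 :: real ^ 'd))"
    by (intro Bochner_Integration.integrable_sum integrable_scaleR_left grad_ratio_integrable_Q x)
  moreover have "(\<Sum>i\<in>UNIV. grad_ratio_fun i y x *\<^sub>R (axis i 1 :: real ^ 'd)) =
      grad (\<lambda>\<theta>. cond \<theta> x y) \<theta>s /\<^sub>R h x" for y
    by (simp add: vec_eq_iff grad_def axis_def if_distrib divide_inverse mult.commute grad_ratio_fun_def cong: if_cong)
  ultimately have "integrable Q (\<lambda>y. grad (\<lambda>\<theta>. cond \<theta> x y) \<theta>s /\<^sub>R h x)" by simp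
  from integral_vec_nth(2)[OF this, of i] show ?thesis
    by (simp add: mean_score_def grad_def divide_inverse mult.commute grad_ratio_fun_def)
qed

lemma mean_score_measurable: "(\<lambda>x. mean_score x $ i) \<in> borel_measurable P"
proof -
  interpret Q: prob_space Q by (rule prob_space_Q)
  have "(\<lambda>x. \<integral>y. grad_ratio_fun i y x \<partial>Q) \<in> borel_measurable P"
    by (rule Q.borel_measurable_lebesgue_integral[OF grad_ratio_measurable_pair])
  then show ?thesis by (subst measurable_cong[OF mean_score_nth]) simp_all
qed

lemma mean_score_bound: "x \<in> space \<mu> \<Longrightarrow> \<bar>mean_score x $ i\<bar> \<le> E x $ i"
proof -
  assume x: "x \<in> space \<mu>"
  interpret Q: prob_space Q by (rule prob_space_Q)
  have "\<bar>\<integral>y. grad_ratio_fun i y x \<partial>Q\<bar> \<le> (\<integral>y. \<bar>grad_ratio_fun i y x\<bar> \<partial>Q)" by (rule integral_abs_bound)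
  also have "\<dots> \<le> E x $ i"
    using grad_ratio_integrable_Q[OF x, of i] grad_ratio_bound[OF x, of i]
    by (intro Q.integral_le_const) auto
  finally show "\<bar>mean_score x $ i\<bar> \<le> E x $ i" by (simp add: mean_score_nth[OF x])
qed

lemma envelope_square_integrable: "integrable P (\<lambda>x. (E x $ i)\<^sup>2)"
  and envelope_integrable: "integrable P (\<lambda>x. E x $ i)"
proof -
  interpret P: prob_space P by (rule prob_space_P)
  show 2: "integrable P (\<lambda>x. (E x $ i)\<^sup>2)" using A6_envelope(2) by (simp add: finite_second_moment_def)
  show "integrable P (\<lambda>x. E x $ i)"
    by (rule P.square_integrable_imp_integrable[OF _ 2])
      (use A6_envelope(2) in \<open>simp add: finite_second_moment_def\<close>)
qed

lemma mean_score_second_moment: "finite_second_moment P mean_score"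
  unfolding finite_second_moment_def
proof (intro allI conjI mean_score_measurable)
  fix i
  note m = mean_score_measurable[of i]
  show "integrable P (\<lambda>x. (mean_score x $ i)\<^sup>2)"
  proof (rule Bochner_Integration.integrable_bound[OF envelope_square_integrable[of i]])
    show "(\<lambda>x. (mean_score x $ i)\<^sup>2) \<in> borel_measurable P" using m by simp
    show "AE x in P. norm ((mean_score x $ i)\<^sup>2) \<le> norm ((E x $ i)\<^sup>2)"
    proof (rule AE_I2)
      fix x assume "x \<in> space P"
      then have "\<bar>mean_score x $ i\<bar> \<le> \<bar>E x $ i\<bar>" using mean_score_bound[of x i] by simp
      then show "norm ((mean_score x $ i)\<^sup>2) \<le> norm ((E x $ i)\<^sup>2)" by (simp add: abs_le_square_iff)
    qed
  qed
qed

text \<open>For fixed \<open>y\<close> the mean over \<open>P\<close> is 0, and the envelope justifies the exchange of the two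
  integrals.\<close>

lemma mean_score_mean: "(\<integral>x. mean_score x $ i \<partial>P) = 0"
proof -
  interpret P: prob_space P by (rule prob_space_P)
  interpret Q: prob_space Q by (rule prob_space_Q)
  interpret PQ: pair_prob_space P Q ..
  note m = grad_ratio_measurable_pair[of i]
  have "integrable (P \<Otimes>\<^sub>M Q) (\<lambda>(x, y). grad_ratio_fun i y x)"
  proof (rule PQ.Fubini_integrable[OF m])
    show "integrable P (\<lambda>x. \<integral>y. norm (case (x, y) of (x, y) \<Rightarrow> grad_ratio_fun i y x) \<partial>Q)"
    proof (rule Bochner_Integration.integrable_bound[OF envelope_integrable[of i]])
      have "(\<lambda>(x, y). norm (case (x, y) of (x, y) \<Rightarrow> grad_ratio_fun i y x)) \<in> borel_measurable (P \<Otimes>\<^sub>M Q)"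
        using m by (simp add: case_prod_beta')
      then show "(\<lambda>x. \<integral>y. norm (case (x, y) of (x, y) \<Rightarrow> grad_ratio_fun i y x) \<partial>Q) \<in> borel_measurable P"
        by (rule Q.borel_measurable_lebesgue_integral)
      show "AE x in P. norm (\<integral>y. norm (case (x, y) of (x, y) \<Rightarrow> grad_ratio_fun i y x) \<partial>Q) \<le> norm (E x $ i)"
      proof (rule AE_I2)
        fix x assume "x \<in> space P"
        then have x: "x \<in> space \<mu>" by simp
        have "(\<integral>y. \<bar>grad_ratio_fun i y x\<bar> \<partial>Q) \<le> E x $ i"
          using grad_ratio_integrable_Q[OF x, of i] grad_ratio_bound[OF x, of i]
          by (intro Q.integral_le_const) auto
        moreover have "0 \<le> (\<integral>y. \<bar>grad_ratio_fun i y x\<bar> \<partial>Q)" by simp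
        ultimately show "norm (\<integral>y. norm (case (x, y) of (x, y) \<Rightarrow> grad_ratio_fun i y x) \<partial>Q) \<le> norm (E x $ i)"
          by simp
      qed
    qed
    show "AE x in P. integrable Q (\<lambda>y. case (x, y) of (x, y) \<Rightarrow> grad_ratio_fun i y x)"
      using grad_ratio_integrable_Q by (intro AE_I2) simp
  qed
  then have "(\<integral>y. \<integral>x. grad_ratio_fun i y x \<partial>P \<partial>Q) = (\<integral>x. \<integral>y. grad_ratio_fun i y x \<partial>Q \<partial>P)"
    by (rule PQ.Fubini_integral)
  then have "(\<integral>x. \<integral>y. grad_ratio_fun i y x \<partial>Q \<partial>P) = 0"
    by (simp add: grad_ratio_mean)
  then show ?thesis
    by (subst Bochner_Integration.integral_cong[OF refl mean_score_nth]) simp_all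
qed

lemma ratio_grad_at:
  assumes "x \<in> space (iid_space P)"
  shows "partial_deriv i (\<lambda>\<theta>. ratio x m \<theta> y) \<theta>s = empirical x m (grad_ratio_fun i y)"
  unfolding grad_ratio_fun_def by (rule ratio_grad[OF iid_path_in_space[OF assms] A3_interior])

text \<open>These properties of a realised path are what a net made of such paths inherits. Continuity
  in \<open>y\<close> is the continuity hypothesis on the gradient of the conditional density, boundedness
  comes from the envelope, and the last identity links the mean over \<open>Q\<close> to \<open>W\<close>.\<close>

lemma empirical_grad_ratio:
  assumes x: "x \<in> space (iid_space P)"
  shows "continuous_on UNIV (\<lambda>y. empirical x m (grad_ratio_fun i y))"
    and "\<bar>empirical x m (grad_ratio_fun i y)\<bar> \<le> empirical x m (\<lambda>x. E x $ i)"
    and "(\<integral>y. empirical x m (grad_ratio_fun i y) \<partial>Q) = empirical x m (\<lambda>x. mean_score x $ i)"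
proof -
  note x\<mu> = iid_path_in_space[OF x]
  show "continuous_on UNIV (\<lambda>y. empirical x m (grad_ratio_fun i y))"
    unfolding empirical_def
    by (subst divide_inverse) (intro continuous_on_mult_right continuous_on_sum grad_ratio_continuous x\<mu>)
  have "\<bar>\<Sum>k<m. grad_ratio_fun i y (x k)\<bar> \<le> (\<Sum>k<m. E (x k) $ i)"
    by (rule order_trans[OF sum_abs]) (intro sum_mono grad_ratio_bound x\<mu>)
  then show "\<bar>empirical x m (grad_ratio_fun i y)\<bar> \<le> empirical x m (\<lambda>x. E x $ i)"
    unfolding empirical_def abs_divide abs_of_nat by (rule divide_right_mono) simp
  show "(\<integral>y. empirical x m (grad_ratio_fun i y) \<partial>Q) = empirical x m (\<lambda>x. mean_score x $ i)"
    unfolding empirical_def using grad_ratio_integrable_Q[OF x\<mu>]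
    by (simp add: mean_score_nth[OF x\<mu>] Bochner_Integration.integral_sum del: times_divide_eq_left)
qed

text \<open>The net from \<open>donsker_finite_net\<close> consists of paths of the process, and these are
  continuous and bounded in \<open>y\<close> by the previous lemma. A member of the class may be indexed by
  several \<open>y\<close>, which is why paths are pulled back to functions of \<open>y\<close>.\<close>

lemma donsker_ratio_net:
  assumes "\<delta> > 0" "\<epsilon> > 0"
  shows "\<exists>\<Psi> :: ('y \<Rightarrow> real) set. finite \<Psi> \<and>
     (\<forall>\<psi>\<in>\<Psi>. continuous_on UNIV \<psi> \<and> (\<exists>C. \<forall>y. \<bar>\<psi> y\<bar> \<le> C)) \<and>
     whp (iid_space P) \<epsilon> (\<lambda>m x. \<exists>\<psi>\<in>\<Psi>. \<forall>y. \<bar>sqrt (real m) * empirical x m (grad_ratio_fun i y) - \<psi> y\<bar> \<le> \<delta>)"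
proof -
  let ?F = "range (grad_ratio_fun i)"
  have D: "donsker P ?F"
    using A6_donsker unfolding donsker_vec_def grad_ratio_class by blast
  have proc: "empirical_process P ?F m x (grad_ratio_fun i y) = sqrt (real m) * empirical x m (grad_ratio_fun i y)" for m x y
    by (simp add: empirical_process_def grad_ratio_mean)
  from donsker_finite_net[OF prob_space_P D _ assms]
  obtain \<Psi> where \<Psi>: "finite \<Psi>"
    "\<And>\<psi>. \<psi> \<in> \<Psi> \<Longrightarrow> \<exists>m. \<exists>x\<in>space (iid_space P). \<psi> = empirical_process P ?F m x"
    "whp (iid_space P) \<epsilon> (\<lambda>m x. \<exists>\<psi>\<in>\<Psi>. \<forall>\<phi>\<in>?F. \<bar>empirical_process P ?F m x \<phi> - \<psi> \<phi>\<bar> \<le> \<delta>)"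
    by blast
  let ?\<Psi> = "(\<lambda>\<psi> y. \<psi> (grad_ratio_fun i y)) ` \<Psi>"
  have "continuous_on UNIV \<psi> \<and> (\<exists>C. \<forall>y. \<bar>\<psi> y\<bar> \<le> C)" if "\<psi> \<in> ?\<Psi>" for \<psi>
  proof -
    from that obtain \<psi>0 where "\<psi>0 \<in> \<Psi>" "\<psi> = (\<lambda>y. \<psi>0 (grad_ratio_fun i y))" by blast
    with \<Psi>(2) obtain m x where x: "x \<in> space (iid_space P)"
      and \<psi>: "\<psi> = (\<lambda>y. sqrt (real m) * empirical x m (grad_ratio_fun i y))"
      by (metis proc)
    have "\<bar>\<psi> y\<bar> \<le> sqrt (real m) * empirical x m (\<lambda>x. E x $ i)" for y
      unfolding \<psi> abs_mult using empirical_grad_ratio(2)[OF x] by (simp add: mult_left_mono)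
    moreover have "continuous_on UNIV \<psi>"
      unfolding \<psi> by (intro continuous_on_mult_left empirical_grad_ratio(1) x)
    ultimately show ?thesis by blast
  qed
  moreover have "whp (iid_space P) \<epsilon> (\<lambda>m x. \<exists>\<psi>\<in>?\<Psi>. \<forall>y. \<bar>sqrt (real m) * empirical x m (grad_ratio_fun i y) - \<psi> y\<bar> \<le> \<delta>)"
  proof (rule whp_mono[OF \<Psi>(3)])
    fix m x assume "\<exists>\<psi>\<in>\<Psi>. \<forall>\<phi>\<in>?F. \<bar>empirical_process P ?F m x \<phi> - \<psi> \<phi>\<bar> \<le> \<delta>"
    then obtain \<psi> where "\<psi> \<in> \<Psi>" and le: "\<And>y. \<bar>empirical_process P ?F m x (grad_ratio_fun i y) - \<psi> (grad_ratio_fun i y)\<bar> \<le> \<delta>" by blast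
    then show "\<exists>\<psi>\<in>?\<Psi>. \<forall>y. \<bar>sqrt (real m) * empirical x m (grad_ratio_fun i y) - \<psi> y\<bar> \<le> \<delta>"
      using le unfolding proc by (intro bexI[of _ "\<lambda>y. \<psi> (grad_ratio_fun i y)"]) auto
  qed simp
  ultimately show ?thesis using \<Psi>(1) by (intro exI[of _ ?\<Psi>]) simp
qed

lemma ratio_grad_stochastically_bounded:
  assumes "\<epsilon> > 0"
  shows "\<exists>C>0. whp (iid_space P) \<epsilon> (\<lambda>m x. \<forall>y. \<bar>sqrt (real m) * empirical x m (grad_ratio_fun i y)\<bar> \<le> C)"
proof -
  obtain \<Psi> :: "('y \<Rightarrow> real) set" where \<Psi>: "finite \<Psi>" "\<And>\<psi>. \<psi> \<in> \<Psi> \<Longrightarrow> \<exists>C. \<forall>y. \<bar>\<psi> y\<bar> \<le> C"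
    "whp (iid_space P) \<epsilon> (\<lambda>m x. \<exists>\<psi>\<in>\<Psi>. \<forall>y. \<bar>sqrt (real m) * empirical x m (grad_ratio_fun i y) - \<psi> y\<bar> \<le> 1)"
    using donsker_ratio_net[of 1 \<epsilon> i] assms by auto
  then obtain C where C: "\<And>\<psi> y. \<psi> \<in> \<Psi> \<Longrightarrow> \<bar>\<psi> y\<bar> \<le> C \<psi>" by metis
  define D where "D = (\<Sum>\<psi>\<in>\<Psi>. \<bar>C \<psi>\<bar>) + 1"
  have D: "C \<psi> + 1 \<le> D" if "\<psi> \<in> \<Psi>" for \<psi>
    using member_le_sum[OF that, of "\<lambda>\<psi>. \<bar>C \<psi>\<bar>"] \<Psi>(1) by (simp add: D_def)
  have "0 < D" by (simp add: D_def add_nonneg_pos sum_nonneg)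
  moreover have "whp (iid_space P) \<epsilon> (\<lambda>m x. \<forall>y. \<bar>sqrt (real m) * empirical x m (grad_ratio_fun i y)\<bar> \<le> D)"
  proof (rule whp_mono[OF \<Psi>(3)], rule allI)
    fix m x y assume "\<exists>\<psi>\<in>\<Psi>. \<forall>y. \<bar>sqrt (real m) * empirical x m (grad_ratio_fun i y) - \<psi> y\<bar> \<le> 1"
    then obtain \<psi> where "\<psi> \<in> \<Psi>" "\<bar>sqrt (real m) * empirical x m (grad_ratio_fun i y) - \<psi> y\<bar> \<le> 1" by blast
    then show "\<bar>sqrt (real m) * empirical x m (grad_ratio_fun i y)\<bar> \<le> D"
      using C[of \<psi> y] D[of \<psi>] by linarith
  qed simp
  ultimately show ?thesis by blast
qed

text \<open>The function of \<open>y\<close> that is averaged over the second sample depends on the first sample.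
  Up to an error of \<open>\<eta> / 4\<close> it is one of finitely many fixed functions, and for these the weak
  law of large numbers holds simultaneously. Replacing the random function by its neighbour
  costs \<open>\<eta> / 4\<close> in the average and \<open>\<eta> / 4\<close> in the mean; the law of large numbers accounts for
  the remaining \<open>\<eta> / 2\<close>.\<close>

lemma ratio_grad_equicontinuity:
  assumes M: "prob_space M" and X: "iid_seq M P X" and Y: "iid_seq M Q Y"
    and m: "filterlim m at_top sequentially" and n: "filterlim n at_top sequentially"
    and "\<eta> > 0" "\<epsilon> > 0"
  shows "whp M \<epsilon> (\<lambda>k \<omega>. \<bar>sqrt (real (m k)) *
           (empirical (\<lambda>j. Y j \<omega>) (n k) (\<lambda>y. empirical (\<lambda>i. X i \<omega>) (m k) (grad_ratio_fun i y))
              - empirical (\<lambda>i. X i \<omega>) (m k) (\<lambda>x. mean_score x $ i))\<bar> \<le> \<eta>)"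
proof -
  interpret Q: prob_space Q by (rule prob_space_Q)
  obtain \<Psi> :: "('y \<Rightarrow> real) set" where \<Psi>: "finite \<Psi>" "\<And>\<psi>. \<psi> \<in> \<Psi> \<Longrightarrow> continuous_on UNIV \<psi>"
     "\<And>\<psi>. \<psi> \<in> \<Psi> \<Longrightarrow> \<exists>C. \<forall>y. \<bar>\<psi> y\<bar> \<le> C"
    "whp (iid_space P) (\<epsilon>/2) (\<lambda>m x. \<exists>\<psi>\<in>\<Psi>. \<forall>y. \<bar>sqrt (real m) * empirical x m (grad_ratio_fun i y) - \<psi> y\<bar> \<le> \<eta>/4)"
    using donsker_ratio_net[of "\<eta>/4" "\<epsilon>/2" i] \<open>\<eta> > 0\<close> \<open>\<epsilon> > 0\<close> by auto
  have near: "whp M (\<epsilon>/2) (\<lambda>k \<omega>. \<exists>\<psi>\<in>\<Psi>. \<forall>y. \<bar>sqrt (real (m k)) * empirical (\<lambda>i. X i \<omega>) (m k) (grad_ratio_fun i y) - \<psi> y\<bar> \<le> \<eta>/4)"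
    by (rule whp_compose_index[OF whp_iid[OF M X \<Psi>(4)] m])
  have \<psi>m: "\<psi> \<in> borel_measurable Q" and \<psi>i: "integrable Q \<psi>" and \<psi>2: "integrable Q (\<lambda>y. (\<psi> y)\<^sup>2)" if p: "\<psi> \<in> \<Psi>" for \<psi>
  proof -
    obtain C where C: "\<And>y. \<bar>\<psi> y\<bar> \<le> C" using \<Psi>(3)[OF p] by blast
    show "\<psi> \<in> borel_measurable Q" by (rule continuous_measurable_Q[OF \<Psi>(2)[OF p]])
    show "integrable Q \<psi>" by (rule continuous_bounded_integrable_Q[OF \<Psi>(2)[OF p] C])
    show "integrable Q (\<lambda>y. (\<psi> y)\<^sup>2)"
    proof (rule continuous_bounded_integrable_Q)
      show "continuous_on UNIV (\<lambda>y. (\<psi> y)\<^sup>2)" by (intro continuous_on_power \<Psi>(2) p)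
      show "\<bar>(\<psi> y)\<^sup>2\<bar> \<le> C\<^sup>2" for y
        using power_mono[OF C[of y] abs_ge_zero, of 2] by simp
    qed
  qed
  \<comment> \<open>Shares the probability \<open>\<epsilon> / 2\<close> among the members of the net, also if it is empty.\<close>
  define \<epsilon>' where "\<epsilon>' = \<epsilon> / (2 * (real (card \<Psi>) + 1))"
  have \<epsilon>': "\<epsilon>' > 0" "real (card \<Psi>) * \<epsilon>' \<le> \<epsilon>/2"
    using \<open>\<epsilon> > 0\<close> by (auto simp: \<epsilon>'_def field_simps)
  have "whp M \<epsilon>' (\<lambda>k \<omega>. \<bar>empirical (\<lambda>j. Y j \<omega>) (n k) \<psi> - (\<integral>y. \<psi> y \<partial>Q)\<bar> \<le> \<eta>/2)" if "\<psi> \<in> \<Psi>" for \<psi>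
    by (rule whp_compose_index[OF iid_mean_whp[OF M Y \<psi>m[OF that] \<psi>2[OF that]] n])
      (use \<open>\<eta> > 0\<close> \<epsilon>' in auto)
  from whp_finite_all[OF M \<Psi>(1) this]
  have lln: "whp M (\<epsilon>/2) (\<lambda>k \<omega>. \<forall>\<psi>\<in>\<Psi>. \<bar>empirical (\<lambda>j. Y j \<omega>) (n k) \<psi> - (\<integral>y. \<psi> y \<partial>Q)\<bar> \<le> \<eta>/2)"
    by (rule whp_mono) (use \<epsilon>'(2) in auto)
  show ?thesis
  proof (rule whp_mono[OF whp_conj[OF M near lln]])
    fix k \<omega> assume \<omega>: "\<omega> \<in> space M"
    let ?x = "\<lambda>i. X i \<omega>" and ?y = "\<lambda>j. Y j \<omega>"
    let ?G = "\<lambda>y. sqrt (real (m k)) * empirical ?x (m k) (grad_ratio_fun i y)"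
    assume "(\<exists>\<psi>\<in>\<Psi>. \<forall>y. \<bar>?G y - \<psi> y\<bar> \<le> \<eta>/4) \<and> (\<forall>\<psi>\<in>\<Psi>. \<bar>empirical ?y (n k) \<psi> - (\<integral>y. \<psi> y \<partial>Q)\<bar> \<le> \<eta>/2)"
    then obtain \<psi> where \<psi>: "\<psi> \<in> \<Psi>" "\<And>y. \<bar>?G y - \<psi> y\<bar> \<le> \<eta>/4" "\<bar>empirical ?y (n k) \<psi> - (\<integral>y. \<psi> y \<partial>Q)\<bar> \<le> \<eta>/2" by blast
    have x: "?x \<in> space (iid_space P)"
      using measurable_space[OF iid_seq_process(1)[OF M X] \<omega>] .
    have Gi: "integrable Q ?G"
      by (intro integrable_mult_right continuous_bounded_integrable_Q[OF empirical_grad_ratio(1,2)] x)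
    have "\<bar>empirical ?y (n k) ?G - empirical ?y (n k) \<psi>\<bar> \<le> \<eta>/4"
    proof -
      have "\<bar>\<Sum>j<n k. ?G (?y j) - \<psi> (?y j)\<bar> \<le> (\<Sum>j<n k. \<eta>/4)"
        by (rule order_trans[OF sum_abs]) (intro sum_mono \<psi>(2))
      then have "\<bar>\<Sum>j<n k. ?G (?y j) - \<psi> (?y j)\<bar> / real (n k) \<le> (\<Sum>j<n k. \<eta>/4) / real (n k)"
        by (rule divide_right_mono) simp
      also have "\<dots> \<le> \<eta>/4" using \<open>\<eta> > 0\<close> by simp
      finally show ?thesis
        by (simp only: empirical_def sum_subtractf diff_divide_distrib[symmetric] abs_divide abs_of_nat)
    qed
    moreover have "\<bar>(\<integral>y. ?G y \<partial>Q) - (\<integral>y. \<psi> y \<partial>Q)\<bar> \<le> \<eta>/4"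
    proof -
      have "\<bar>(\<integral>y. ?G y \<partial>Q) - (\<integral>y. \<psi> y \<partial>Q)\<bar> = \<bar>\<integral>y. ?G y - \<psi> y \<partial>Q\<bar>"
        using Gi \<psi>i[OF \<psi>(1)] by (simp add: Bochner_Integration.integral_diff)
      also have "\<dots> \<le> (\<integral>y. \<bar>?G y - \<psi> y\<bar> \<partial>Q)" by (rule integral_abs_bound)
      also have "\<dots> \<le> \<eta>/4"
        using Gi \<psi>i[OF \<psi>(1)] \<psi>(2)
        by (intro Q.integral_le_const integrable_abs Bochner_Integration.integrable_diff) auto
      finally show ?thesis .
    qed
    moreover have "(\<integral>y. ?G y \<partial>Q) = sqrt (real (m k)) * empirical ?x (m k) (\<lambda>x. mean_score x $ i)"
      by (simp add: empirical_grad_ratio(3)[OF x])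
    moreover have "empirical ?y (n k) ?G = sqrt (real (m k)) * empirical ?y (n k) (\<lambda>y. empirical ?x (m k) (grad_ratio_fun i y))"
      by (simp add: empirical_def[of ?y] sum_distrib_left)
    ultimately show "\<bar>sqrt (real (m k)) * (empirical ?y (n k) (\<lambda>y. empirical ?x (m k) (grad_ratio_fun i y))
              - empirical ?x (m k) (\<lambda>x. mean_score x $ i))\<bar> \<le> \<eta>"
      using \<psi>(3) unfolding right_diff_distrib by linarith
  qed simp
qed

subsection \<open>Linearisation of the estimator\<close>

text \<open>The deterministic core, for one outcome at which all approximations hold with error \<open>\<eta>\<close>.
  Expand the gradient of the criterion around \<open>\<theta>\<^sup>*\<close>: its value at \<open>\<theta>\<close> is almost 0 by assumption,
  its Hessian differs from \<open>J\<close> by at most \<open>6 \<eta>\<close> (\<open>4 \<eta>\<close> from the ratio, \<open>\<eta>\<close> from the empirical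
  measure, \<open>\<eta>\<close> from the distance to \<open>\<theta>\<^sup>*\<close>), and its value at \<open>\<theta>\<^sup>*\<close> is \<open>- A - B\<close> up to a multiple
  of \<open>\<eta> / s\<close>. The remainder is proportional to \<open>\<eta> L\<close> with \<open>L = s * norm (\<theta> - \<theta>\<^sup>*)\<close>. Boundedness
  of \<open>L\<close>, the rate of convergence of the estimator, is obtained from the same expansion, because
  for small \<open>\<eta>\<close> the remainder can be absorbed on the left.\<close>

lemma linearisation_estimate:
  fixes J :: "real ^ 'd ^ 'd" and x :: "nat \<Rightarrow> 'x" and y :: "nat \<Rightarrow> 'y" and m n :: nat
  defines "D \<equiv> real CARD('d)"
  defines "A \<equiv> \<lambda>j. empirical y n (\<lambda>y. partial_deriv j (\<lambda>\<theta>. ln (marg \<theta> y)) \<theta>s)"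
    and "B \<equiv> \<lambda>j. empirical x m (\<lambda>x. mean_score x $ j)"
  assumes x: "x \<in> space (iid_space P)" and m: "m > 0"
    and \<eta>: "0 < \<eta>" "\<eta> \<le> 1" "\<eta> * (1 + D * \<rho>)\<^sup>2 \<le> 1/2"
    and r0: "\<And>y. \<bar>ratio x m \<theta>s y - 1\<bar> \<le> \<eta>"
    and r1: "\<And>i y. \<bar>sqrt (real m) * empirical x m (grad_ratio_fun i y)\<bar> \<le> C1" "C1 \<le> \<eta> * sqrt (real m)"
    and r2: "\<And>i j y \<theta>. \<theta> \<in> ball \<theta>s \<rho> \<Longrightarrow> \<bar>partial_deriv i (partial_deriv j (\<lambda>\<theta>. ratio x m \<theta> y)) \<theta>\<bar> \<le> \<eta>"
    and hq: "\<And>i j \<xi>. \<xi> \<in> ball \<theta>s \<rho> \<Longrightarrow>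
        \<bar>empirical y n (log_marg_hess i j \<xi>) - (\<integral>y. log_marg_hess i j \<xi> y \<partial>Q)\<bar> \<le> \<eta>"
    and hc: "\<And>i j \<xi>. \<xi> \<in> ball \<theta>s r \<Longrightarrow>
        \<bar>(\<integral>y. log_marg_hess i j \<xi> y \<partial>Q) - (\<integral>y. log_marg_hess i j \<theta>s y \<partial>Q)\<bar> \<le> \<eta>" and r: "r \<le> \<rho>"
    and equi: "\<And>i. \<bar>sqrt (real m) * (empirical y n (\<lambda>y. empirical x m (grad_ratio_fun i y)) - B i)\<bar> \<le> \<eta>"
    and g: "\<And>k. k < n \<Longrightarrow> 0 < g (y k)"
    and \<theta>: "\<theta> \<in> ball \<theta>s r"
    and s: "0 \<le> s" "s \<le> sqrt (real m)"
    and grad: "\<And>j. \<bar>s * partial_deriv j (mc_KL f h g x y m n) \<theta>\<bar> \<le> \<eta>"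
    and J: "\<And>i j. J $ i $ j = - (\<integral>y. log_marg_hess i j \<theta>s y \<partial>Q)"
    and c: "\<And>v. norm v \<le> c * norm (J *v v)" "0 \<le> c" "c * D * (6 * \<eta> * D) \<le> 1/2"
    and AB: "\<And>j. \<bar>s * (A j + B j)\<bar> \<le> C2"
  shows "norm (s *\<^sub>R (J *v (\<theta> - \<theta>s) - (\<chi> j. A j + B j)))
      \<le> \<eta> * (D * ((2 * C1 + 2) + 6 * D * (2 * c * D * (C2 + (2 * C1 + 2)))))"
proof -
  let ?K = "mc_KL f h g x y m n"
  let ?R = "\<lambda>y \<theta>. ratio x m \<theta> y"
  note x\<mu> = iid_path_in_space[OF x]
  define \<Delta> where "\<Delta> = \<theta> - \<theta>s"
  have sm: "sqrt (real m) > 0" using m by simp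
  have r1': "\<bar>partial_deriv i (?R y) \<theta>s\<bar> \<le> \<eta>" for i y
  proof -
    have "\<bar>sqrt (real m) * empirical x m (grad_ratio_fun i y)\<bar> \<le> \<eta> * sqrt (real m)"
      by (rule order_trans[OF r1(1) r1(2)])
    then have "sqrt (real m) * \<bar>empirical x m (grad_ratio_fun i y)\<bar> \<le> sqrt (real m) * \<eta>"
      by (simp only: abs_mult abs_of_pos[OF sm] mult.commute[of \<eta>])
    then show ?thesis unfolding ratio_grad_at[OF x] by (rule mult_left_le_imp_le[OF _ sm])
  qed
  note RB = ratio_bounds[OF x\<mu> _ \<eta>(3)[unfolded D_def] r0 r1' r2]
  have \<eta>0: "0 \<le> \<eta>" using \<eta>(1) by simp
  have R_half: "1/2 \<le> ratio x m \<xi> y" if "\<xi> \<in> ball \<theta>s \<rho>" for \<xi> y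
    by (rule RB(1)) (use that \<eta>0 in auto)
  have R_pos: "0 < ratio x m \<xi> y" if "\<xi> \<in> ball \<theta>s \<rho>" for \<xi> y
    using R_half[OF that, of y] by linarith
  note KP = mc_KL_partials[OF x\<mu> open_ball ball_in_interior R_pos g]
  have ball_r: "\<xi> \<in> ball \<theta>s \<rho>" if "\<xi> \<in> ball \<theta>s r" for \<xi> using that r by auto
  have hess_close: "\<bar>partial_deriv i (partial_deriv j ?K) \<xi> - J $ j $ i\<bar> \<le> 6 * \<eta>" if \<xi>: "\<xi> \<in> ball \<theta>s r" for i j \<xi>
  proof -
    note \<xi>' = ball_r[OF \<xi>]
    let ?T = "\<lambda>y. partial_deriv i (partial_deriv j (?R y)) \<xi> / ?R y \<xi>
          - partial_deriv i (?R y) \<xi> * partial_deriv j (?R y) \<xi> / (?R y \<xi>)\<^sup>2"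
    have "partial_deriv i (partial_deriv j ?K) \<xi> = - empirical y n (log_marg_hess i j \<xi>) - empirical y n ?T"
      by (rule KP(3)) (use \<xi>' in auto)
    moreover have "\<bar>empirical y n ?T\<bar> \<le> 4 * \<eta>"
      by (rule empirical_bound, rule RB(2)) (use \<xi>' \<eta>0 in auto)
    moreover have "J $ j $ i = - (\<integral>y. log_marg_hess i j \<theta>s y \<partial>Q)"
      unfolding J by (simp only: log_marg_hess_commute[of i j])
    ultimately show ?thesis using hq[OF \<xi>', of i j] hc[OF \<xi>, of i j] by linarith
  qed
  have K_ex: "second_partials_exist_on ?K (ball \<theta>s \<rho>)" by (rule KP(1)) auto
  have err: "\<bar>partial_deriv j ?K \<theta> - partial_deriv j ?K \<theta>s - (J *v \<Delta>) $ j\<bar> \<le> 6 * \<eta> * D * norm \<Delta>" for j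
  proof -
    have "has_partial_deriv i (partial_deriv j ?K) \<xi>" if "norm (\<xi> - \<theta>s) \<le> norm (\<theta> - \<theta>s)" for \<xi> i
    proof -
      have "\<xi> \<in> ball \<theta>s \<rho>" using that ball_r[OF \<theta>] by (simp add: dist_norm norm_minus_commute)
      then show ?thesis using K_ex by (auto simp: second_partials_exist_on_def)
    qed
    from coordinate_mean_value[of \<theta>s \<theta> "partial_deriv j ?K", OF this]
    obtain \<xi> where \<xi>: "\<And>i. norm (\<xi> i - \<theta>s) \<le> norm (\<theta> - \<theta>s)"
      "partial_deriv j ?K \<theta> - partial_deriv j ?K \<theta>s =
        (\<Sum>i\<in>UNIV. partial_deriv i (partial_deriv j ?K) (\<xi> i) * \<Delta> $ i)" unfolding \<Delta>_def by blast
    have \<xi>r: "\<xi> i \<in> ball \<theta>s r" for i using \<xi>(1)[of i] \<theta> by (simp add: dist_norm norm_minus_commute)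
    have "partial_deriv j ?K \<theta> - partial_deriv j ?K \<theta>s - (J *v \<Delta>) $ j =
        (\<Sum>i\<in>UNIV. (partial_deriv i (partial_deriv j ?K) (\<xi> i) - J $ j $ i) * \<Delta> $ i)"
      unfolding \<xi>(2) by (simp add: matrix_vector_mult_def left_diff_distrib sum_subtractf)
    also have "\<bar>\<dots>\<bar> \<le> (\<Sum>i\<in>(UNIV::'d set). 6 * \<eta> * norm \<Delta>)"
      by (rule order_trans[OF sum_abs], rule sum_mono, unfold abs_mult)
        (intro mult_mono hess_close \<xi>r component_le_norm_cart; use \<eta>0 in simp)
    also have "\<dots> = 6 * \<eta> * D * norm \<Delta>" by (simp add: D_def)
    finally show ?thesis .
  qed
  \<comment> \<open>The contribution of the ratio to the gradient at \<open>\<theta>\<^sup>*\<close>. It is compared with \<open>B\<close> in two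
    steps; after multiplication by \<open>sqrt m\<close>, dropping the denominator costs \<open>2 C1 \<eta>\<close>, replacing
    the empirical measure by \<open>Q\<close> costs \<open>\<eta>\<close>.\<close>
  define T where "T j = empirical y n (\<lambda>y. partial_deriv j (?R y) \<theta>s / ?R y \<theta>s)" for j
  have \<theta>s: "\<theta>s \<in> ball \<theta>s \<rho>" using A4(1) by simp
  have K_grad: "partial_deriv j ?K \<theta>s = - A j - T j" for j
    unfolding A_def T_def by (rule KP(2)) (use \<theta>s in auto)
  have T_B: "\<bar>s * (T j - B j)\<bar> \<le> (2 * C1 + 1) * \<eta>" for j
  proof -
    let ?E = "empirical y n (\<lambda>y. empirical x m (grad_ratio_fun j y))"
    have "sqrt (real m) * (T j - ?E) =
        empirical y n (\<lambda>y. sqrt (real m) * (partial_deriv j (?R y) \<theta>s / ?R y \<theta>s - empirical x m (grad_ratio_fun j y)))"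
      unfolding T_def empirical_diff empirical_cmult ..
    also have "\<bar>\<dots>\<bar> \<le> C1 * (2 * \<eta>)"
    proof (rule empirical_bound)
      fix y
      let ?q = "ratio x m \<theta>s y" and ?p = "empirical x m (grad_ratio_fun j y)"
      have q: "1/2 \<le> ?q" by (rule R_half[OF \<theta>s])
      have eq: "sqrt (real m) * (?p / ?q - ?p) = (sqrt (real m) * ?p) * ((1 - ?q) / ?q)"
        using q by (simp add: field_simps)
      have "\<bar>(1 - ?q) / ?q\<bar> \<le> \<eta> / (1/2)"
        unfolding abs_divide using r0[of y] q \<eta>0 by (intro frac_le) auto
      then have "\<bar>sqrt (real m) * ?p\<bar> * \<bar>(1 - ?q) / ?q\<bar> \<le> C1 * (2 * \<eta>)"
        using r1(1)[of j y] by (intro mult_mono) auto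
      then show "\<bar>sqrt (real m) * (partial_deriv j (?R y) \<theta>s / ?q - ?p)\<bar> \<le> C1 * (2 * \<eta>)"
        unfolding ratio_grad_at[OF x] eq abs_mult .
    qed
    finally have 1: "\<bar>sqrt (real m) * (T j - ?E)\<bar> \<le> C1 * (2 * \<eta>)" .
    have "sqrt (real m) * (T j - B j) = sqrt (real m) * (T j - ?E) + sqrt (real m) * (?E - B j)"
      by (simp add: algebra_simps)
    then have "\<bar>sqrt (real m) * (T j - B j)\<bar> \<le> C1 * (2 * \<eta>) + \<eta>"
      using 1 equi[of j] by linarith
    moreover have "\<bar>s * (T j - B j)\<bar> \<le> \<bar>sqrt (real m) * (T j - B j)\<bar>"
      unfolding abs_mult using s by (intro mult_right_mono) auto
    ultimately show ?thesis by (simp add: algebra_simps)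
  qed
  define L where "L = s * norm \<Delta>"
  have L0: "0 \<le> L" using s by (simp add: L_def)
  have main: "\<bar>s * ((J *v \<Delta>) $ j - (A j + B j))\<bar> \<le> (2 * C1 + 2) * \<eta> + 6 * \<eta> * D * L" for j
  proof -
    define e where "e = partial_deriv j ?K \<theta> - partial_deriv j ?K \<theta>s - (J *v \<Delta>) $ j"
    have "\<bar>s * e\<bar> \<le> s * (6 * \<eta> * D * norm \<Delta>)"
      unfolding abs_mult e_def using err[of j] s(1) by (simp add: mult_left_mono)
    then have 1: "\<bar>s * e\<bar> \<le> 6 * \<eta> * D * L" by (simp add: L_def mult_ac)
    have "s * ((J *v \<Delta>) $ j - (A j + B j)) = s * partial_deriv j ?K \<theta> + s * (T j - B j) - s * e"
      unfolding e_def K_grad by (simp add: algebra_simps)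
    then show ?thesis using 1 grad[of j] T_B[of j] by (simp add: algebra_simps)
  qed
  have C1: "0 \<le> C1" using r1(1)[of undefined undefined] by linarith
  \<comment> \<open>\<open>L \<le> const + L / 2\<close>, by invertibility of \<open>J\<close> and smallness of \<open>\<eta>\<close>.\<close>
  have L_bound: "L \<le> 2 * c * D * (C2 + (2 * C1 + 2))"
  proof -
    have comp: "\<bar>s * (J *v \<Delta>) $ j\<bar> \<le> C2 + (2 * C1 + 2) + 6 * \<eta> * D * L" for j
    proof -
      have "(2 * C1 + 2) * \<eta> \<le> 2 * C1 + 2" using \<eta>(2) C1 mult_left_mono[of \<eta> 1 "2 * C1 + 2"] by simp
      moreover have "s * (J *v \<Delta>) $ j = s * ((J *v \<Delta>) $ j - (A j + B j)) + s * (A j + B j)"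
        by (simp add: algebra_simps)
      ultimately show ?thesis using main[of j] AB[of j] by linarith
    qed
    have "norm (s *\<^sub>R (J *v \<Delta>)) \<le> (\<Sum>j\<in>UNIV. \<bar>(s *\<^sub>R (J *v \<Delta>)) $ j\<bar>)" by (rule norm_le_l1_cart)
    also have "\<dots> \<le> (\<Sum>j\<in>(UNIV::'d set). C2 + (2 * C1 + 2) + 6 * \<eta> * D * L)"
      using comp by (intro sum_mono) simp
    also have "\<dots> = D * (C2 + (2 * C1 + 2) + 6 * \<eta> * D * L)" by (simp add: D_def)
    finally have nb: "norm (s *\<^sub>R (J *v \<Delta>)) \<le> D * (C2 + (2 * C1 + 2) + 6 * \<eta> * D * L)" .
    have "L \<le> s * (c * norm (J *v \<Delta>))" unfolding L_def using c(1) s(1) by (intro mult_left_mono) auto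
    also have "\<dots> = c * norm (s *\<^sub>R (J *v \<Delta>))" using s(1) by simp
    also have "\<dots> \<le> c * (D * (C2 + (2 * C1 + 2) + 6 * \<eta> * D * L))" by (rule mult_left_mono[OF nb c(2)])
    also have "\<dots> = c * D * (C2 + (2 * C1 + 2)) + (c * D * (6 * \<eta> * D)) * L" by (simp add: algebra_simps)
    also have "\<dots> \<le> c * D * (C2 + (2 * C1 + 2)) + 1/2 * L"
      using mult_right_mono[OF c(3) L0] by simp
    finally show ?thesis by simp
  qed
  have "norm (s *\<^sub>R (J *v \<Delta> - (\<chi> j. A j + B j))) \<le> (\<Sum>j\<in>UNIV. \<bar>(s *\<^sub>R (J *v \<Delta> - (\<chi> j. A j + B j))) $ j\<bar>)"
    by (rule norm_le_l1_cart)
  also have "\<dots> \<le> (\<Sum>j\<in>(UNIV::'d set). (2 * C1 + 2) * \<eta> + 6 * \<eta> * D * L)"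
    using main by (intro sum_mono) simp
  also have "\<dots> = \<eta> * (D * ((2 * C1 + 2) + 6 * D * L))" by (simp add: D_def algebra_simps)
  also have "\<dots> \<le> \<eta> * (D * ((2 * C1 + 2) + 6 * D * (2 * c * D * (C2 + (2 * C1 + 2)))))"
    using L_bound \<eta>0 by (intro mult_left_mono add_left_mono) (auto simp: D_def)
  finally show ?thesis by (simp add: \<Delta>_def)
qed

text \<open>All conditions of \<open>linearisation_estimate\<close> hold simultaneously with high probability. The
  order of choices matters: the bounds \<open>C1\<close> and \<open>C2\<close> come from stochastic boundedness and depend
  only on \<open>\<epsilon>\<close>; then \<open>\<eta>\<close> is chosen so small that the resulting error is at most \<open>\<delta>\<close>; finally the
  radius \<open>r\<close> of the neighbourhood of \<open>\<theta>\<^sup>*\<close> depends on \<open>\<eta>\<close>.\<close>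

lemma estimator_linearisation:
  fixes J :: "real ^ 'd ^ 'd" and \<theta>h :: "nat \<Rightarrow> 'w \<Rightarrow> real ^ 'd"
  defines "\<psi> \<equiv> \<lambda>y. grad (\<lambda>\<theta>. ln (marg \<theta> y)) \<theta>s"
  assumes M: "prob_space M" and X: "iid_seq M P X" and Y: "iid_seq M Q Y"
    and m: "filterlim m at_top sequentially" and n: "filterlim n at_top sequentially"
    and \<psi>2: "finite_second_moment Q \<psi>" and \<psi>0: "\<And>i. (\<integral>y. \<psi> y $ i \<partial>Q) = 0"
    and J: "\<And>i j. J $ i $ j = - (\<integral>y. log_marg_hess i j \<theta>s y \<partial>Q)" "invertible J"
    and consistent: "tendsto_in_prob M \<theta>h \<theta>s sequentially"
    and gradient: "tendsto_in_prob M (\<lambda>k \<omega>. sqrt (real (min (m k) (n k))) *\<^sub>R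
          grad (mc_KL f h g (\<lambda>i. X i \<omega>) (\<lambda>j. Y j \<omega>) (m k) (n k)) (\<theta>h k \<omega>)) 0 sequentially"
    and "\<epsilon> > 0" "\<delta> > 0"
  shows "whp M \<epsilon> (\<lambda>k \<omega>. norm (sqrt (real (min (m k) (n k))) *\<^sub>R (J *v (\<theta>h k \<omega> - \<theta>s) -
           ((1 / real (n k)) *\<^sub>R (\<Sum>j<n k. \<psi> (Y j \<omega>)) +
            (1 / real (m k)) *\<^sub>R (\<Sum>i<m k. mean_score (X i \<omega>))))) \<le> \<delta>)"
proof -
  interpret M: prob_space M by fact
  let ?D = "real CARD('d)"
  let ?x = "\<lambda>\<omega> i. X i \<omega>" and ?y = "\<lambda>\<omega> j. Y j \<omega>"
  have D: "?D \<ge> 1" using zero_less_card_finite[where 'a='d] by linarith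
  obtain K where K: "\<And>v. norm (matrix_inv J *v v) \<le> norm v * K" "K > 0"
    using bounded_linear.pos_bounded[OF matrix_vector_mul_bounded_linear[of "matrix_inv J"]] by blast
  have K': "norm v \<le> K * norm (J *v v)" for v
    using K(1)[of "J *v v"] matrix_inv_works(2)[OF J(2)] by (simp add: matrix_vector_mul_assoc mult.commute)
  \<comment> \<open>Ten events are combined below; those that are intersections over coordinates share \<open>e\<close>
    equally among them.\<close>
  define e where "e = \<epsilon> / 10"
  have e: "e > 0" "e / ?D > 0" using \<open>\<epsilon> > 0\<close> D by (auto simp: e_def)
  have "\<forall>i. \<exists>C. C > 0 \<and>
      whp (iid_space P) (e / ?D) (\<lambda>m x. \<forall>y. \<bar>sqrt (real m) * empirical x m (grad_ratio_fun i y)\<bar> \<le> C)"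
    using ratio_grad_stochastically_bounded[OF e(2)] by blast
  from choice[OF this] obtain c1 where c1': "\<forall>i. c1 i > 0 \<and>
      whp (iid_space P) (e / ?D) (\<lambda>m x. \<forall>y. \<bar>sqrt (real m) * empirical x m (grad_ratio_fun i y)\<bar> \<le> c1 i)" ..
  note c1 = c1'[rule_format, THEN conjunct1] c1'[rule_format, THEN conjunct2]
  have \<psi>m: "(\<lambda>y. \<psi> y $ i) \<in> borel_measurable Q" "integrable Q (\<lambda>y. (\<psi> y $ i)\<^sup>2)" for i
    using \<psi>2 by (simp_all add: finite_second_moment_def)
  have "\<exists>C>0. whp M (e / ?D) (\<lambda>n \<omega>. \<bar>sqrt (real n) * empirical (?y \<omega>) n (\<lambda>y. \<psi> y $ i)\<bar> \<le> C)" for i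
    by (rule iid_mean_stochastically_bounded[OF M Y \<psi>m \<psi>0 e(2)])
  then have "\<forall>i. \<exists>C. C > 0 \<and>
      whp M (e / ?D) (\<lambda>n \<omega>. \<bar>sqrt (real n) * empirical (?y \<omega>) n (\<lambda>y. \<psi> y $ i)\<bar> \<le> C)" by blast
  from choice[OF this] obtain c2 where c2': "\<forall>i. c2 i > 0 \<and>
      whp M (e / ?D) (\<lambda>n \<omega>. \<bar>sqrt (real n) * empirical (?y \<omega>) n (\<lambda>y. \<psi> y $ i)\<bar> \<le> c2 i)" ..
  note c2 = c2'[rule_format, THEN conjunct1] c2'[rule_format, THEN conjunct2]
  have ms: "(\<lambda>x. mean_score x $ i) \<in> borel_measurable P" "integrable P (\<lambda>x. (mean_score x $ i)\<^sup>2)" for i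
    using mean_score_second_moment by (simp_all add: finite_second_moment_def)
  have "\<exists>C>0. whp M (e / ?D) (\<lambda>n \<omega>. \<bar>sqrt (real n) * empirical (?x \<omega>) n (\<lambda>x. mean_score x $ i)\<bar> \<le> C)" for i
    by (rule iid_mean_stochastically_bounded[OF M X ms mean_score_mean e(2)])
  then have "\<forall>i. \<exists>C. C > 0 \<and>
      whp M (e / ?D) (\<lambda>n \<omega>. \<bar>sqrt (real n) * empirical (?x \<omega>) n (\<lambda>x. mean_score x $ i)\<bar> \<le> C)" by blast
  from choice[OF this] obtain c3 where c3': "\<forall>i. c3 i > 0 \<and>
      whp M (e / ?D) (\<lambda>n \<omega>. \<bar>sqrt (real n) * empirical (?x \<omega>) n (\<lambda>x. mean_score x $ i)\<bar> \<le> c3 i)" ..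
  note c3 = c3'[rule_format, THEN conjunct1] c3'[rule_format, THEN conjunct2]
  define C1 where "C1 = (\<Sum>i\<in>UNIV. c1 i)"
  define C2 where "C2 = (\<Sum>i\<in>UNIV. c2 i) + (\<Sum>i\<in>UNIV. c3 i)"
  have le_sum: "c i \<le> (\<Sum>i\<in>UNIV. c i)" if "\<And>i. c i > 0" for c :: "'d \<Rightarrow> real" and i
    by (rule member_le_sum) (simp_all add: less_imp_le[OF that])
  have C: "0 \<le> C1" "0 \<le> C2"
    unfolding C1_def C2_def
    by (simp_all add: add_nonneg_nonneg sum_nonneg less_imp_le[OF c1(1)] less_imp_le[OF c2(1)] less_imp_le[OF c3(1)])
  \<comment> \<open>The factor of \<open>\<eta>\<close> in the conclusion of \<open>linearisation_estimate\<close>.\<close>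
  define Ct where "Ct = ?D * ((2 * C1 + 2) + 6 * ?D * (2 * K * ?D * (C2 + (2 * C1 + 2))))"
  have Ct: "Ct > 0"
  proof -
    have "0 < 2 * C1 + 2" using C by linarith
    moreover have "0 \<le> 6 * ?D * (2 * K * ?D * (C2 + (2 * C1 + 2)))"
      using K(2) D C by (intro mult_nonneg_nonneg add_nonneg_nonneg) auto
    ultimately have "0 < (2 * C1 + 2) + 6 * ?D * (2 * K * ?D * (C2 + (2 * C1 + 2)))" by (rule add_pos_nonneg)
    then show ?thesis unfolding Ct_def using D by (intro mult_pos_pos) linarith+
  qed
  define \<eta> where "\<eta> = min (min 1 (1 / (2 * (1 + ?D * \<rho>)\<^sup>2))) (min (\<delta> / Ct) (1 / (12 * K * ?D * ?D)))"
  have k0: "(1 + ?D * \<rho>)\<^sup>2 > 0" using A4(1) D by (intro zero_less_power add_pos_nonneg) auto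
  have \<eta>: "\<eta> > 0" "\<eta> \<le> 1" "\<eta> * (1 + ?D * \<rho>)\<^sup>2 \<le> 1/2" "\<eta> * Ct \<le> \<delta>" "K * ?D * (6 * \<eta> * ?D) \<le> 1/2"
  proof -
    have "0 < 1 / (2 * (1 + ?D * \<rho>)\<^sup>2)" "0 < \<delta> / Ct" "0 < 1 / (12 * K * ?D * ?D)"
      using k0 Ct K(2) D \<open>\<delta> > 0\<close> by (simp_all del: zero_less_divide_iff add: divide_pos_pos)
    then show "\<eta> > 0" "\<eta> \<le> 1" by (simp_all add: \<eta>_def del: zero_less_divide_iff)
    have "\<eta> \<le> 1 / (2 * (1 + ?D * \<rho>)\<^sup>2)" by (simp add: \<eta>_def)
    then have "\<eta> * (1 + ?D * \<rho>)\<^sup>2 \<le> 1 / (2 * (1 + ?D * \<rho>)\<^sup>2) * (1 + ?D * \<rho>)\<^sup>2"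
      by (rule mult_right_mono) simp
    then show "\<eta> * (1 + ?D * \<rho>)\<^sup>2 \<le> 1/2" using k0 by simp
    have "\<eta> \<le> \<delta> / Ct" by (simp add: \<eta>_def)
    then show "\<eta> * Ct \<le> \<delta>" using Ct by (simp add: pos_le_divide_eq)
    have "\<eta> \<le> 1 / (12 * K * ?D * ?D)" by (simp add: \<eta>_def)
    then have "\<eta> * (12 * K * ?D * ?D) \<le> 1" using K(2) D by (subst (asm) pos_le_divide_eq) auto
    then show "K * ?D * (6 * \<eta> * ?D) \<le> 1/2" by (simp add: algebra_simps)
  qed
  obtain r where r: "r > 0" "r \<le> \<rho>" "\<And>i j \<xi>. \<xi> \<in> ball \<theta>s r \<Longrightarrow>
     \<bar>(\<integral>y. log_marg_hess i j \<xi> y \<partial>Q) - (\<integral>y. log_marg_hess i j \<theta>s y \<partial>Q)\<bar> \<le> \<eta>"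
    using mean_log_marg_hess_cont_uniform[OF \<eta>(1)] by (elim exE conjE) blast
  \<comment> \<open>The events: ratio, its gradient and its Hessian; empirical Hessian of the log marginal
    density; exchange of the two empirical measures; positive \<open>g\<close>; consistency; approximate
    stationarity; boundedness of the two leading terms.\<close>
  define Q1 where "Q1 k \<omega> \<longleftrightarrow> (\<forall>y. \<bar>ratio (?x \<omega>) (m k) \<theta>s y - 1\<bar> \<le> \<eta>)" for k \<omega>
  define Q2 where "Q2 k \<omega> \<longleftrightarrow> (\<forall>i. \<forall>y. \<bar>sqrt (real (m k)) * empirical (?x \<omega>) (m k) (grad_ratio_fun i y)\<bar> \<le> c1 i)" for k \<omega>
  define Q3 where "Q3 k \<omega> \<longleftrightarrow> (\<forall>i j y. \<forall>\<theta>\<in>ball \<theta>s \<rho>.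
      \<bar>partial_deriv i (partial_deriv j (\<lambda>\<theta>. ratio (?x \<omega>) (m k) \<theta> y)) \<theta>\<bar> \<le> \<eta>)" for k \<omega>
  define Q4 where "Q4 k \<omega> \<longleftrightarrow> (\<forall>i j. \<forall>\<phi>\<in>{log_marg_hess i j \<theta> | \<theta>. \<theta> \<in> cball \<theta>s \<rho>}.
      \<bar>empirical (?y \<omega>) (n k) \<phi> - (\<integral>y. \<phi> y \<partial>Q)\<bar> \<le> \<eta>)" for k \<omega>
  define Q5 where "Q5 k \<omega> \<longleftrightarrow> (\<forall>i. \<bar>sqrt (real (m k)) *
           (empirical (?y \<omega>) (n k) (\<lambda>y. empirical (?x \<omega>) (m k) (grad_ratio_fun i y))
              - empirical (?x \<omega>) (m k) (\<lambda>x. mean_score x $ i))\<bar> \<le> \<eta>)" for k \<omega>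
  define Q6 where "Q6 k \<omega> \<longleftrightarrow> (\<forall>j. 0 < g (Y j \<omega>))" for k :: nat and \<omega>
  define Q7 where "Q7 k \<omega> \<longleftrightarrow> dist (\<theta>h k \<omega>) \<theta>s \<le> r/2" for k \<omega>
  define Q8 where "Q8 k \<omega> \<longleftrightarrow> dist (sqrt (real (min (m k) (n k))) *\<^sub>R
          grad (mc_KL f h g (?x \<omega>) (?y \<omega>) (m k) (n k)) (\<theta>h k \<omega>)) 0 \<le> \<eta>" for k \<omega>
  define Q9 where "Q9 k \<omega> \<longleftrightarrow> (\<forall>i. \<bar>sqrt (real (n k)) * empirical (?y \<omega>) (n k) (\<lambda>y. \<psi> y $ i)\<bar> \<le> c2 i)" for k \<omega>
  define Q10 where "Q10 k \<omega> \<longleftrightarrow> (\<forall>i. \<bar>sqrt (real (m k)) * empirical (?x \<omega>) (m k) (\<lambda>x. mean_score x $ i)\<bar> \<le> c3 i)" for k \<omega>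
  note PS = prob_space_iid_space[OF prob_space_P] and QS = prob_space_iid_space[OF prob_space_Q]
  have fin: "whp N e (\<lambda>k \<omega>. \<forall>i. R i k \<omega>)" if "prob_space N" "\<And>i::'d. whp N (e / ?D) (R i)"
    for N :: "'n measure" and R
    using whp_finite_all[OF that(1) finite[of UNIV], of "e / ?D" R] that(2) D by simp
  have W1: "whp M e Q1" unfolding Q1_def
    by (rule whp_compose_index[OF whp_iid[OF M X ratio_whp[OF \<eta>(1) e(1)]] m])
  have W2: "whp M e Q2" unfolding Q2_def
    by (rule whp_compose_index[OF whp_iid[OF M X fin[OF PS c1(2)]] m])
  have W3: "whp M e Q3" unfolding Q3_def
    by (rule whp_compose_index[OF whp_iid[OF M X ratio_hess_whp[OF \<eta>(1) e(1)]] m])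
  have "whp (iid_space Q) e (\<lambda>n y. \<forall>i j. \<forall>\<phi>\<in>{log_marg_hess i j \<theta> | \<theta>. \<theta> \<in> cball \<theta>s \<rho>}.
      \<bar>empirical y n \<phi> - (\<integral>y. \<phi> y \<partial>Q)\<bar> \<le> \<eta>)"
    by (rule whp_finite_all_UNIV[OF QS e(1)], rule whp_finite_all_UNIV[OF QS], assumption)
      (rule glivenko_cantelli_whp[OF prob_space_Q gc_log_marg_hess \<eta>(1)])
  then have W4: "whp M e Q4" unfolding Q4_def
    by (rule whp_compose_index[OF whp_iid[OF M Y] n])
  have W5: "whp M e Q5" unfolding Q5_def
    by (rule whp_finite_all_UNIV[OF M e(1)]) (rule ratio_grad_equicontinuity[OF M X Y m n \<eta>(1)])
  have "AE \<omega> in M. 0 < g (Y j \<omega>)" for j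
  proof (rule AE_distrD[OF iid_seq_measurable[OF M Y]])
    have "distr M Q (Y j) = Q" using Y by (simp add: iid_seq_def)
    then show "AE y in distr M Q (Y j). 0 < g y" by (simp only: AE_g_pos)
  qed
  then have W6: "whp M e Q6" unfolding Q6_def
    using e by (intro whp_AE) (auto simp: AE_all_countable)
  have W7: "whp M e Q7" unfolding Q7_def by (rule tendsto_in_prob_whp[OF M consistent]) (use r e in auto)
  have W8: "whp M e Q8" unfolding Q8_def by (rule tendsto_in_prob_whp[OF M gradient \<eta>(1) e(1)])
  have W9: "whp M e Q9" unfolding Q9_def by (rule whp_compose_index[OF fin[OF M c2(2)] n])
  have W10: "whp M e Q10" unfolding Q10_def by (rule whp_compose_index[OF fin[OF M c3(2)] m])
  have "whp M (real (length [Q1, Q2, Q3, Q4, Q5, Q6, Q7, Q8, Q9, Q10]) * e)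
      (\<lambda>k \<omega>. list_all (\<lambda>Q. Q k \<omega>) [Q1, Q2, Q3, Q4, Q5, Q6, Q7, Q8, Q9, Q10])"
    by (rule whp_conj_list[OF M]) (use W1 W2 W3 W4 W5 W6 W7 W8 W9 W10 e in simp_all)
  then have all: "whp M \<epsilon> (\<lambda>k \<omega>. list_all (\<lambda>Q. Q k \<omega>) [Q1, Q2, Q3, Q4, Q5, Q6, Q7, Q8, Q9, Q10])"
    by (simp add: e_def)
  \<comment> \<open>The gradient of the ratio is at most \<open>C1 / sqrt m\<close>, which eventually is below \<open>\<eta>\<close>.\<close>
  have "filterlim (\<lambda>k. sqrt (real (m k))) at_top sequentially"
    by (rule filterlim_compose[OF sqrt_at_top filterlim_compose[OF filterlim_real_sequentially m]])
  then have "\<forall>\<^sub>F k in sequentially. C1 / \<eta> \<le> sqrt (real (m k))" by (simp add: filterlim_at_top)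
  moreover have "\<forall>\<^sub>F k in sequentially. m k > 0"
    by (rule eventually_compose_filterlim[OF eventually_gt_at_top m])
  ultimately have "\<forall>\<^sub>F k in sequentially. \<forall>\<omega>\<in>space M.
      list_all (\<lambda>Q. Q k \<omega>) [Q1, Q2, Q3, Q4, Q5, Q6, Q7, Q8, Q9, Q10] \<longrightarrow>
      norm (sqrt (real (min (m k) (n k))) *\<^sub>R (J *v (\<theta>h k \<omega> - \<theta>s) -
           ((1 / real (n k)) *\<^sub>R (\<Sum>j<n k. \<psi> (Y j \<omega>)) +
            (1 / real (m k)) *\<^sub>R (\<Sum>i<m k. mean_score (X i \<omega>))))) \<le> \<delta>"
  proof eventually_elim
    case (elim k)
    show ?case
    proof (intro ballI impI)
      fix \<omega> assume \<omega>: "\<omega> \<in> space M"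
      assume "list_all (\<lambda>Q. Q k \<omega>) [Q1, Q2, Q3, Q4, Q5, Q6, Q7, Q8, Q9, Q10]"
      then have q: "Q1 k \<omega>" "Q2 k \<omega>" "Q3 k \<omega>" "Q4 k \<omega>" "Q5 k \<omega>" "Q6 k \<omega>" "Q7 k \<omega>" "Q8 k \<omega>" "Q9 k \<omega>" "Q10 k \<omega>"
        by simp_all
      let ?s = "sqrt (real (min (m k) (n k)))"
      let ?A = "\<lambda>j. empirical (?y \<omega>) (n k) (\<lambda>y. partial_deriv j (\<lambda>\<theta>. ln (marg \<theta> y)) \<theta>s)"
      let ?B = "\<lambda>j. empirical (?x \<omega>) (m k) (\<lambda>x. mean_score x $ j)"
      have \<psi>_nth: "\<psi> y $ j = partial_deriv j (\<lambda>\<theta>. ln (marg \<theta> y)) \<theta>s" for y j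
        by (simp add: \<psi>_def grad_def)
      have est: "norm (?s *\<^sub>R (J *v (\<theta>h k \<omega> - \<theta>s) - (\<chi> j. ?A j + ?B j)))
          \<le> \<eta> * (?D * ((2 * C1 + 2) + 6 * ?D * (2 * K * ?D * (C2 + (2 * C1 + 2)))))"
      proof (rule linearisation_estimate[where r = r])
        show "?x \<omega> \<in> space (iid_space P)"
          using measurable_space[OF iid_seq_process(1)[OF M X] \<omega>] .
        show "m k > 0" by (rule elim(2))
        show "0 < \<eta>" "\<eta> \<le> 1" "\<eta> * (1 + ?D * \<rho>)\<^sup>2 \<le> 1/2" by (rule \<eta>)+
        show "\<bar>ratio (?x \<omega>) (m k) \<theta>s y - 1\<bar> \<le> \<eta>" for y using q(1) by (simp add: Q1_def)
        show "\<bar>sqrt (real (m k)) * empirical (?x \<omega>) (m k) (grad_ratio_fun i y)\<bar> \<le> C1" for i y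
        proof -
          have "\<bar>sqrt (real (m k)) * empirical (?x \<omega>) (m k) (grad_ratio_fun i y)\<bar> \<le> c1 i"
            by (rule q(2)[unfolded Q2_def, rule_format])
          also have "\<dots> \<le> C1" unfolding C1_def by (rule le_sum[OF c1(1)])
          finally show ?thesis .
        qed
        show "C1 \<le> \<eta> * sqrt (real (m k))" using elim(1) \<eta>(1) by (simp add: field_simps)
        show "\<bar>partial_deriv i (partial_deriv j (\<lambda>\<theta>. ratio (?x \<omega>) (m k) \<theta> y)) \<theta>\<bar> \<le> \<eta>"
          if "\<theta> \<in> ball \<theta>s \<rho>" for i j y \<theta> by (rule q(3)[unfolded Q3_def, rule_format, OF that])
        show "\<bar>empirical (?y \<omega>) (n k) (log_marg_hess i j \<xi>) - (\<integral>y. log_marg_hess i j \<xi> y \<partial>Q)\<bar> \<le> \<eta>"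
          if "\<xi> \<in> ball \<theta>s \<rho>" for i j \<xi>
        proof -
          have "log_marg_hess i j \<xi> \<in> {log_marg_hess i j \<theta> | \<theta>. \<theta> \<in> cball \<theta>s \<rho>}"
            using that by (intro CollectI exI[of _ \<xi>]) simp
          then show ?thesis by (rule q(4)[unfolded Q4_def, rule_format])
        qed
        show "\<bar>(\<integral>y. log_marg_hess i j \<xi> y \<partial>Q) - (\<integral>y. log_marg_hess i j \<theta>s y \<partial>Q)\<bar> \<le> \<eta>"
          if "\<xi> \<in> ball \<theta>s r" for i j \<xi> by (rule r(3)[OF that])
        show "r \<le> \<rho>" by (rule r)
        show "\<bar>sqrt (real (m k)) * (empirical (?y \<omega>) (n k) (\<lambda>y. empirical (?x \<omega>) (m k) (grad_ratio_fun i y)) - ?B i)\<bar> \<le> \<eta>" for i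
          using q(5) by (simp add: Q5_def)
        show "0 < g (Y l \<omega>)" for l using q(6) by (simp add: Q6_def)
        show "\<theta>h k \<omega> \<in> ball \<theta>s r" using q(7) r(1) by (simp add: Q7_def dist_commute)
        show "0 \<le> ?s" "?s \<le> sqrt (real (m k))" by simp_all
        show "\<bar>?s * partial_deriv j (mc_KL f h g (?x \<omega>) (?y \<omega>) (m k) (n k)) (\<theta>h k \<omega>)\<bar> \<le> \<eta>" for j
        proof -
          let ?v = "?s *\<^sub>R grad (mc_KL f h g (?x \<omega>) (?y \<omega>) (m k) (n k)) (\<theta>h k \<omega>)"
          have "\<bar>?v $ j\<bar> \<le> norm ?v" by (rule component_le_norm_cart)
          also have "\<dots> \<le> \<eta>" using q(8) unfolding Q8_def dist_norm by simp
          finally show ?thesis by (simp add: grad_def)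
        qed
        show "J $ i $ j = - (\<integral>y. log_marg_hess i j \<theta>s y \<partial>Q)" for i j by (rule J)
        show "norm v \<le> K * norm (J *v v)" for v by (rule K')
        show "0 \<le> K" using K(2) by simp
        show "K * ?D * (6 * \<eta> * ?D) \<le> 1/2" by (rule \<eta>)
        show "\<bar>?s * (?A j + ?B j)\<bar> \<le> C2" for j
        proof -
          have "\<bar>?s * ?A j\<bar> \<le> \<bar>sqrt (real (n k)) * ?A j\<bar>"
            unfolding abs_mult by (intro mult_right_mono) auto
          also have "\<dots> \<le> c2 j" using q(9) by (simp add: Q9_def \<psi>_nth)
          also have "\<dots> \<le> (\<Sum>i\<in>UNIV. c2 i)" by (rule le_sum[OF c2(1)])
          finally have a: "\<bar>?s * ?A j\<bar> \<le> (\<Sum>i\<in>UNIV. c2 i)" .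
          have "\<bar>?s * ?B j\<bar> \<le> \<bar>sqrt (real (m k)) * ?B j\<bar>"
            unfolding abs_mult by (intro mult_right_mono) auto
          also have "\<dots> \<le> c3 j" using q(10) by (simp add: Q10_def)
          also have "\<dots> \<le> (\<Sum>i\<in>UNIV. c3 i)" by (rule le_sum[OF c3(1)])
          finally have "\<bar>?s * ?B j\<bar> \<le> (\<Sum>i\<in>UNIV. c3 i)" .
          with a show ?thesis unfolding C2_def distrib_left by linarith
        qed
      qed
      have "(\<chi> j. ?A j + ?B j) = (1 / real (n k)) *\<^sub>R (\<Sum>j<n k. \<psi> (Y j \<omega>)) +
            (1 / real (m k)) *\<^sub>R (\<Sum>i<m k. mean_score (X i \<omega>))"
        by (simp add: vec_eq_iff empirical_def \<psi>_nth)
      with est \<eta>(4) show "norm (?s *\<^sub>R (J *v (\<theta>h k \<omega> - \<theta>s) -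
           ((1 / real (n k)) *\<^sub>R (\<Sum>j<n k. \<psi> (Y j \<omega>)) +
            (1 / real (m k)) *\<^sub>R (\<Sum>i<m k. mean_score (X i \<omega>))))) \<le> \<delta>"
        unfolding Ct_def by simp
    qed
  qed
  from whp_mono_eventually[OF all this] show ?thesis .
qed

subsection \<open>Central limit theorem for the estimator\<close>

text \<open>The normed linear part converges by the two-sample central limit theorem. The norming
  matrix is of order \<open>sqrt (min m n)\<close>, the rate at which the linearisation error vanishes, so
  that the normed error tends to 0 in probability and Slutsky's lemma applies.\<close>

lemma estimator_CLT:
  fixes J V W :: "real ^ 'd ^ 'd" and \<theta>h :: "nat \<Rightarrow> nat \<Rightarrow> 'w \<Rightarrow> real ^ 'd"
  defines "\<psi> \<equiv> \<lambda>y. grad (\<lambda>\<theta>. ln (marg \<theta> y)) \<theta>s"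
  defines "V \<equiv> cov_matrix Q \<psi>" and "W \<equiv> cov_matrix P mean_score"
  assumes M: "prob_space M" and X: "iid_seq M P X" and Y: "iid_seq M Q Y"
    and ind: "indep_rvs M (iid_space P) (\<lambda>\<omega> i. X i \<omega>) (iid_space Q) (\<lambda>\<omega> j. Y j \<omega>)"
    and \<psi>2: "finite_second_moment Q \<psi>" and \<psi>0: "has_bochner_integral Q \<psi> 0"
    and J: "integrable Q (\<lambda>y. hess (\<lambda>\<theta>. ln (marg \<theta> y)) \<theta>s)"
      "J = - (\<integral>y. hess (\<lambda>\<theta>. ln (marg \<theta> y)) \<theta>s \<partial>Q)" "invertible J"
    and meas: "\<And>m n. \<theta>h m n \<in> borel_measurable M"
    and consistent: "tendsto_in_prob M (\<lambda>(m, n). \<theta>h m n) \<theta>s (sequentially \<times>\<^sub>F sequentially)"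
    and gradient: "tendsto_in_prob M (\<lambda>(m, n) \<omega>. sqrt (real (min m n)) *\<^sub>R
          grad (mc_KL f h g (\<lambda>i. X i \<omega>) (\<lambda>j. Y j \<omega>) m n) (\<theta>h m n \<omega>)) 0 (sequentially \<times>\<^sub>F sequentially)"
    and inv: "invertible V" "invertible W"
  shows "tendsto_in_distr M
             (\<lambda>(m, n) \<omega>. inv_sqrt_matrix ((1 / real n) *\<^sub>R V + (1 / real m) *\<^sub>R W) *v
                (J *v (\<theta>h m n \<omega> - \<theta>s)))
             std_normal_vec (sequentially \<times>\<^sub>F sequentially)"
proof -
  have \<psi>i: "integrable Q \<psi>" "(\<integral>y. \<psi> y \<partial>Q) = 0" using \<psi>0 by (simp_all add: has_bochner_integral_iff)
  have \<psi>0': "(\<integral>y. \<psi> y $ i \<partial>Q) = 0" for i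
    using integral_vec_nth(2)[OF \<psi>i(1), of i] \<psi>i(2) by simp
  have Jij: "J $ i $ j = - (\<integral>y. log_marg_hess i j \<theta>s y \<partial>Q)" for i j
    using integral_mat_nth(2)[OF J(1), of i j] by (simp add: J(2) hess_def)
  note ms2 = mean_score_second_moment and ms0 = mean_score_mean
  note Vq = cov_matrix_quadratic_form[OF \<psi>2 \<psi>0', folded V_def]
  note Wq = cov_matrix_quadratic_form[OF ms2 ms0, folded W_def]
  have Vpd: "pos_def V" unfolding V_def by (rule cov_matrix_pos_def[OF \<psi>2 \<psi>0' inv(1)[unfolded V_def]])
  have Wpd: "pos_def W" unfolding W_def by (rule cov_matrix_pos_def[OF ms2 ms0 inv(2)[unfolded W_def]])
  have msi: "integrable P mean_score"
  proof -
    interpret P: prob_space P by (rule prob_space_P)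
    have "integrable P (\<lambda>x. norm (mean_score x))"
      by (rule P.square_integrable_imp_integrable[OF _ Wq(3)]) (use Wq(4) in simp)
    then show ?thesis using Wq(4) by (simp add: integrable_norm_iff)
  qed
  have ms0': "(\<integral>x. mean_score x \<partial>P) = 0"
    using integral_vec_nth(2)[OF msi] ms0 by (simp add: vec_eq_iff)
  define \<Sigma> where "\<Sigma> m n = (1 / real n) *\<^sub>R V + (1 / real m) *\<^sub>R W" for m n :: nat
  from pooled_covariance[OF Vpd Wpd, folded \<Sigma>_def]
  obtain K where K': "K > 0 \<and> (\<forall>m n. 0 < m \<longrightarrow> 0 < n \<longrightarrow> pos_def (\<Sigma> m n) \<and>
      (\<forall>t. norm (inv_sqrt_matrix (\<Sigma> m n) *v t) \<le> K * sqrt (real (min m n)) * norm t))" ..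
  have K: "K > 0" "\<And>m n. 0 < m \<Longrightarrow> 0 < n \<Longrightarrow> pos_def (\<Sigma> m n)"
    "\<And>m n t. 0 < m \<Longrightarrow> 0 < n \<Longrightarrow> norm (inv_sqrt_matrix (\<Sigma> m n) *v t) \<le> K * sqrt (real (min m n)) * norm t"
    using K' by simp_all
  define Z where "Z m n \<omega> = inv_sqrt_matrix (\<Sigma> m n) *v (J *v (\<theta>h m n \<omega> - \<theta>s))" for m n \<omega>
  have matm: "(\<lambda>\<omega>. (A :: real ^ 'd ^ 'd) *v U \<omega>) \<in> borel_measurable M" if "U \<in> borel_measurable M" for A and U :: "'w \<Rightarrow> real ^ 'd"
    by (rule measurable_compose[OF that borel_measurable_continuous_onI])
      (rule linear_continuous_on[OF matrix_vector_mul_bounded_linear])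
  have Zm: "Z m n \<in> borel_measurable M" for m n
    unfolding Z_def using meas[of m n] by (intro matm) simp
  \<comment> \<open>The limit along an arbitrary pair of sequences with \<open>m k, n k > k\<close>.\<close>
  have limit: "(\<lambda>k. LINT \<omega>|M. H (Z (m k) (n k) \<omega>)) \<longlonglongrightarrow> (LINT z|std_gauss. H z)"
    if mk: "\<And>k. k < m k" and nk: "\<And>k. k < n k"
      and H: "continuous_on UNIV H" "bounded (range H)" for m n :: "nat \<Rightarrow> nat" and H :: "real ^ 'd \<Rightarrow> real"
  proof -
    have m: "filterlim m at_top sequentially" and n: "filterlim n at_top sequentially"
      by (rule filterlim_at_top_mono[OF filterlim_ident]; simp add: less_imp_le[OF mk] less_imp_le[OF nk])+
    have pos: "m k > 0" "n k > 0" for k using mk[of k] nk[of k] by auto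
    have mn: "filterlim (\<lambda>k. (m k, n k)) (sequentially \<times>\<^sub>F sequentially) sequentially"
      by (rule filterlim_Pair[OF m n])
    define S where "S k \<omega> = (1 / real (n k)) *\<^sub>R (\<Sum>j<n k. \<psi> (Y j \<omega>)) +
            (1 / real (m k)) *\<^sub>R (\<Sum>i<m k. mean_score (X i \<omega>))" for k \<omega>
    define T where "T k \<omega> = inv_sqrt_matrix (\<Sigma> (m k) (n k)) *v S k \<omega>" for k \<omega>
    have [measurable]: "\<psi> \<in> borel_measurable Q" "mean_score \<in> borel_measurable P"
      "\<And>i. X i \<in> measurable M P" "\<And>i. Y i \<in> measurable M Q"
      using Vq(4) Wq(4) iid_seq_measurable[OF M X] iid_seq_measurable[OF M Y] by auto
    have Tm: "T k \<in> borel_measurable M" for k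
      unfolding T_def S_def by (rule matm) measurable
    have ch: "(\<lambda>k. CLINT \<omega>|M. iexp (t \<bullet> T k \<omega>)) \<longlonglongrightarrow> (CLINT z|std_gauss. iexp (t \<bullet> z))" for t
      unfolding T_def S_def char_std_gauss
      by (rule two_sample_char_limit[where \<Sigma> = "\<lambda>k. \<Sigma> (m k) (n k)" and K = K,
            OF M X Y ind Vq(4,3) \<psi>i(2) Wq(4,3) ms0' Vpd Vq(2) Wpd Wq(2) m n pos \<Sigma>_def
              K(3)[OF pos] K(2)[OF pos]])
    have lin: "whp M \<epsilon> (\<lambda>k \<omega>. norm (sqrt (real (min (m k) (n k))) *\<^sub>R (J *v (\<theta>h (m k) (n k) \<omega> - \<theta>s) - S k \<omega>)) \<le> \<delta>)"
      if "\<epsilon> > 0" "\<delta> > 0" for \<epsilon> \<delta>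
      unfolding S_def \<psi>_def
    proof (rule estimator_linearisation[OF M X Y m n _ _ Jij J(3) _ _ that])
      show "finite_second_moment Q (\<lambda>y. grad (\<lambda>\<theta>. ln (marg \<theta> y)) \<theta>s)" using \<psi>2 by (simp add: \<psi>_def)
      show "(\<integral>y. grad (\<lambda>\<theta>. ln (marg \<theta> y)) \<theta>s $ i \<partial>Q) = 0" for i using \<psi>0'[of i] by (simp add: \<psi>_def)
      show "tendsto_in_prob M (\<lambda>k. \<theta>h (m k) (n k)) \<theta>s sequentially"
        using tendsto_in_prob_compose[OF consistent mn] by simp
      show "tendsto_in_prob M (\<lambda>k \<omega>. sqrt (real (min (m k) (n k))) *\<^sub>R
          grad (mc_KL f h g (\<lambda>i. X i \<omega>) (\<lambda>j. Y j \<omega>) (m k) (n k)) (\<theta>h (m k) (n k) \<omega>)) 0 sequentially"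
        using tendsto_in_prob_compose[OF gradient mn] by simp
    qed
    have close: "whp M \<epsilon> (\<lambda>k \<omega>. norm (Z (m k) (n k) \<omega> - T k \<omega>) \<le> \<delta>)" if "\<epsilon> > 0" "\<delta> > 0" for \<epsilon> \<delta>
    proof (rule whp_mono[OF lin[OF that(1), of "\<delta> / K"]])
      show "0 < \<delta> / K" using that K(1) by simp
      fix k \<omega>
      let ?v = "J *v (\<theta>h (m k) (n k) \<omega> - \<theta>s) - S k \<omega>"
      assume le: "norm (sqrt (real (min (m k) (n k))) *\<^sub>R ?v) \<le> \<delta> / K"
      have "Z (m k) (n k) \<omega> - T k \<omega> = inv_sqrt_matrix (\<Sigma> (m k) (n k)) *v ?v"
        by (simp add: Z_def T_def matrix_vector_mult_diff_distrib)
      then have "norm (Z (m k) (n k) \<omega> - T k \<omega>) \<le> K * sqrt (real (min (m k) (n k))) * norm ?v"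
        using K(3)[OF pos] by simp
      also have "\<dots> = K * norm (sqrt (real (min (m k) (n k))) *\<^sub>R ?v)" by simp
      also have "\<dots> \<le> K * (\<delta> / K)" using le K(1) by (intro mult_left_mono) auto
      finally show "norm (Z (m k) (n k) \<omega> - T k \<omega>) \<le> \<delta>" using K(1) by simp
    qed simp
    show ?thesis
    proof (rule compact_support_convergence_imp_weak[OF M Zm prob_space_std_gauss sets_std_gauss _ H])
      fix H :: "real ^ 'd \<Rightarrow> real" and R
      assume H: "continuous_on UNIV H" "\<And>z. R < norm z \<Longrightarrow> H z = 0"
      show "(\<lambda>k. LINT \<omega>|M. H (Z (m k) (n k) \<omega>)) \<longlonglongrightarrow> (LINT z|std_gauss. H z)"
        by (rule compact_support_convergence_perturb[OF M Tm Zm close H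
              char_convergence_imp_compact_support_convergence[OF M Tm prob_space_std_gauss sets_std_gauss ch H]])
    qed
  qed
  show ?thesis
    unfolding tendsto_in_distr_def std_normal_vec_eq
  proof (intro conjI allI impI)
    fix p :: "nat \<times> nat"
    show "(case p of (m, n) \<Rightarrow> \<lambda>\<omega>. inv_sqrt_matrix ((1 / real n) *\<^sub>R V + (1 / real m) *\<^sub>R W) *v
                (J *v (\<theta>h m n \<omega> - \<theta>s))) \<in> borel_measurable M"
      using Zm[of "fst p" "snd p"] by (simp add: Z_def[abs_def] \<Sigma>_def case_prod_beta)
  next
    fix H :: "real ^ 'd \<Rightarrow> real" assume H: "continuous_on UNIV H" "bounded (range H)"
    show "((\<lambda>p. LINT \<omega>|M. H ((case p of (m, n) \<Rightarrow> \<lambda>\<omega>. inv_sqrt_matrix ((1 / real n) *\<^sub>R V + (1 / real m) *\<^sub>R W) *v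
                (J *v (\<theta>h m n \<omega> - \<theta>s))) \<omega>)) \<longlongrightarrow> (LINT z|std_gauss. H z)) (sequentially \<times>\<^sub>F sequentially)"
      by (rule tendsto_prod_sequentiallyI) (use limit[OF _ _ H] in \<open>simp add: Z_def \<Sigma>_def\<close>)
  qed
qed

end

section \<open>Asymptotic normality of the Monte Carlo estimator\<close>

theorem theorem2p3:
  fixes \<Theta> :: "(real ^ 'd::finite) set"
    and f :: "real ^ 'd \<Rightarrow> 'x \<Rightarrow> 'y::{metric_space, second_countable_topology} \<Rightarrow> real"
    and \<mu> P :: "'x measure" and \<nu> Q :: "'y measure"
    and h :: "'x \<Rightarrow> real" and g :: "'y \<Rightarrow> real"
    and M :: "'w measure"
    and X :: "nat \<Rightarrow> 'w \<Rightarrow> 'x" and Y :: "nat \<Rightarrow> 'w \<Rightarrow> 'y"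
    and \<theta>s :: "real ^ 'd" and \<rho> :: real
    and E :: "'x \<Rightarrow> real ^ 'd"
    and \<theta>h :: "nat \<Rightarrow> nat \<Rightarrow> 'w \<Rightarrow> real ^ 'd"
    and V W J :: "real ^ 'd ^ 'd"
  assumes sigma_finite: "sigma_finite_measure \<mu>" "sigma_finite_measure \<nu>"
    and Y_space: "space \<nu> = UNIV" "sets borel \<subseteq> sets \<nu>"
    and f_density: "\<And>\<theta>. \<theta> \<in> \<Theta> \<Longrightarrow> is_prob_density (\<mu> \<Otimes>\<^sub>M \<nu>) (\<lambda>(x, y). f \<theta> x y)"
    and marg_pos: "\<And>\<theta> y. \<theta> \<in> \<Theta> \<Longrightarrow> integrable \<mu> (\<lambda>x. f \<theta> x y) \<and> 0 < marg_density \<mu> f \<theta> y"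
    and h_density: "is_prob_density \<mu> h" and P_def: "P = density \<mu> (\<lambda>x. ennreal (h x))"
    and g_density: "is_prob_density \<nu> g" and Q_def: "Q = density \<nu> (\<lambda>y. ennreal (g y))"
    and importance: "\<And>\<theta> y. \<theta> \<in> \<Theta> \<Longrightarrow> (\<integral>x. f \<theta> x y / h x \<partial>P) = marg_density \<mu> f \<theta> y"
    and prob_space: "prob_space M"
    and iid: "iid_seq M P X" "iid_seq M Q Y"
    and indep: "indep_rvs M (iid_space P) (\<lambda>\<omega> i. X i \<omega>) (iid_space Q) (\<lambda>\<omega> j. Y j \<omega>)"
    and A1_smooth: "\<And>x y. x \<in> space \<mu> \<Longrightarrow>
          second_partials_exist_on (\<lambda>\<theta>. f \<theta> x y) (interior \<Theta>) \<and>
          continuous_on (interior \<Theta>) (hess (\<lambda>\<theta>. f \<theta> x y))"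
    and A1_integral: "\<And>y. second_partials_under_integral \<mu> (\<lambda>\<theta> x. cond_density \<mu> f \<theta> x y) (interior \<Theta>)"
    and A2: "\<And>x. x \<in> space \<mu> \<Longrightarrow>
          continuous_on UNIV (\<lambda>y. grad (\<lambda>\<theta>. cond_density \<mu> f \<theta> x y) \<theta>s)"
    and A3_interior: "\<theta>s \<in> interior \<Theta>"
    and A3_score: "has_bochner_integral Q (\<lambda>y. grad (\<lambda>\<theta>. ln (marg_density \<mu> f \<theta> y)) \<theta>s) 0"
    and A3_V: "finite_second_moment Q (\<lambda>y. grad (\<lambda>\<theta>. ln (marg_density \<mu> f \<theta> y)) \<theta>s)"
          "V = cov_matrix Q (\<lambda>y. grad (\<lambda>\<theta>. ln (marg_density \<mu> f \<theta> y)) \<theta>s)"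
    and A3_J: "integrable Q (\<lambda>y. hess (\<lambda>\<theta>. ln (marg_density \<mu> f \<theta> y)) \<theta>s)"
          "J = - (\<integral>y. hess (\<lambda>\<theta>. ln (marg_density \<mu> f \<theta> y)) \<theta>s \<partial>Q)"
          "invertible J"
    and A4: "\<rho> > 0" "cball \<theta>s \<rho> \<subseteq> \<Theta>"
          "glivenko_cantelli_mat Q
             {(\<lambda>y. hess (\<lambda>\<theta>. ln (marg_density \<mu> f \<theta> y)) \<theta>') | \<theta>'. \<theta>' \<in> cball \<theta>s \<rho>}"
    and A5: "glivenko_cantelli P (range (\<lambda>y x. cond_density \<mu> f \<theta>s x y / h x))"
    and A6_donsker: "donsker_vec P
             (range (\<lambda>y x. grad (\<lambda>\<theta>. cond_density \<mu> f \<theta> x y) \<theta>s /\<^sub>R h x))"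
    and A6_envelope: "envelope_vec P
             (range (\<lambda>y x. grad (\<lambda>\<theta>. cond_density \<mu> f \<theta> x y) \<theta>s /\<^sub>R h x)) E"
          "finite_second_moment P E"
    and A7: "glivenko_cantelli_mat P
             {(\<lambda>x. hess (\<lambda>\<theta>. cond_density \<mu> f \<theta> x y) \<theta>' /\<^sub>R h x) | y \<theta>'. \<theta>' \<in> cball \<theta>s \<rho>}"
    and A8_measurable: "\<And>m n. \<theta>h m n \<in> borel_measurable M"
    and A8_consistent: "tendsto_in_prob M (\<lambda>(m, n). \<theta>h m n) \<theta>s (sequentially \<times>\<^sub>F sequentially)"
    and A8_gradient: "tendsto_in_prob M
             (\<lambda>(m, n) \<omega>. sqrt (real (min m n)) *\<^sub>R
                grad (mc_KL f h g (\<lambda>i. X i \<omega>) (\<lambda>j. Y j \<omega>) m n) (\<theta>h m n \<omega>))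
             0 (sequentially \<times>\<^sub>F sequentially)"
    and W_def: "W = cov_matrix P
             (\<lambda>x. \<integral>y. grad (\<lambda>\<theta>. cond_density \<mu> f \<theta> x y) \<theta>s /\<^sub>R h x \<partial>Q)"
  shows "finite_second_moment P
           (\<lambda>x. \<integral>y. grad (\<lambda>\<theta>. cond_density \<mu> f \<theta> x y) \<theta>s /\<^sub>R h x \<partial>Q) \<and>
         (invertible V \<and> invertible W \<longrightarrow>
           tendsto_in_distr M
             (\<lambda>(m, n) \<omega>. inv_sqrt_matrix ((1 / real n) *\<^sub>R V + (1 / real m) *\<^sub>R W) *v
                (J *v (\<theta>h m n \<omega> - \<theta>s)))
             std_normal_vec (sequentially \<times>\<^sub>F sequentially))"
proof -
  interpret mc_model \<Theta> f \<mu> P \<nu> Q h g \<theta>s \<rho> E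
    by (rule mc_model.intro) (fact Y_space f_density marg_pos h_density P_def g_density Q_def importance
      A1_smooth A1_integral A2 A3_interior A4 A5 A6_donsker A6_envelope A7)+
  have ms: "mean_score = (\<lambda>x. \<integral>y. grad (\<lambda>\<theta>. cond_density \<mu> f \<theta> x y) \<theta>s /\<^sub>R h x \<partial>Q)"
    by (rule ext) (rule mean_score_def)
  show ?thesis
  proof (intro conjI impI)
    show "finite_second_moment P
           (\<lambda>x. \<integral>y. grad (\<lambda>\<theta>. cond_density \<mu> f \<theta> x y) \<theta>s /\<^sub>R h x \<partial>Q)"
      using mean_score_second_moment unfolding ms .
    assume inv: "invertible V \<and> invertible W"
    show "tendsto_in_distr M
             (\<lambda>(m, n) \<omega>. inv_sqrt_matrix ((1 / real n) *\<^sub>R V + (1 / real m) *\<^sub>R W) *v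
                (J *v (\<theta>h m n \<omega> - \<theta>s)))
             std_normal_vec (sequentially \<times>\<^sub>F sequentially)"
      unfolding A3_V(2) W_def ms[symmetric]
      by (rule estimator_CLT[OF prob_space iid indep A3_V(1) A3_score A3_J A8_measurable
            A8_consistent A8_gradient])
        (use inv in \<open>simp_all add: A3_V(2) W_def ms\<close>)
  qed
qed

end
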